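(* Consider the partially linear model $\mathcal P$ described in the context, with true law $P_0=P_{\theta_0,\eta_0}$, with $\mathbb E|W|^{2+\delta}<\infty$ for some $\delta>0$, and with $J=\sigma^{-2}\,\mathbb E\big(W^2-(\mathbb E[W\mid Z])^2\big)>0$. Let $\beta_m=(\beta_{m,1},\dots,\beta_{m,k_m})^{\mathrm t}$ be B-splines of degree $l$ on $[0,1]$ with equally spaced knots, orthonormalised in $L_2([0,1],P_Z)$, with $k_m\to\infty$. Let $(m_n)$ be a subsequence tending to infinity such that: (1) $\mathbb E(W^2\mid Z)\le C$ $P_Z$-almost surely for some constant $C$; (2) $k_{m_n}^2/\sqrt n\to0$, $\xi_{m_n}k_{m_n}/\sqrt n\to0$ and $a_n\sqrt{k_{m_n}}\,\xi_{m_n}\to0$; (3) $\eta_0$ is $s$-times continuously differentiable and $l+1\ge s$; (4) $k_{m_n}^{-s}\sqrt n\to0$. Then the maximum likelihood (least squares) estimator $\widehat\theta_{m_n,n}$ of $\theta$ in the parametric model $\mathcal P_{m_n}$ is best regular in $\mathcal P$, i.e. it is regular with limiting law $\mathrm N(0,J^{-1})$.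
   Context: Model. $X_1,\dots,X_n$ are i.i.d. copies of $X=(W,Y,Z)$ with values in $\mathbb R\times\mathbb R\times[0,1]$. Under $P_{\theta,\eta}$, $X$ has Lebesgue density $$p_{\theta,\eta}(w,y,z)=\frac1{\sqrt{2\pi}\,\sigma}\exp\big(-\tfrac12(y-\eta(z)-\theta w)^2/\sigma^2\big)f_{W,Z}(w,z),$$ where $\sigma>0$ and the joint density $f_{W,Z}$ are fixed, $\theta\in\Theta\subset\mathbb R$ ($\theta_0$ interior to $\Theta$), and $\eta\in\mathcal H$, the space of $s$-times continuously differentiable real functions on $[0,1]$. $\mathcal P=\{P_{\theta,\eta}:\theta\in\Theta,\eta\in\mathcal H\}$. $P_Z$ is the law of $Z$. Parametric models. $\mathcal P_m$ consists of the laws with Lebesgue density $$(w,y,z)\mapsto\frac1{\sqrt{2\pi}\,\sigma}\exp\big(-\tfrac12(y-\beta_m(z)^{\mathrm t}\gamma-\theta w)^2/\sigma^2\big)f_{W,Z}(w,z),\qquad \theta\in\Theta,\ \gamma\in\mathbb R^{k_m},$$ with the same fixed $\sigma$ and $f_{W,Z}$. $(\widehat\theta_{m,n},\widehat\gamma_{m,n})$ is the maximum likelihood estimator of $(\theta,\gamma)$ in $\mathcal P_m$ based on $X_1,\dots,X_n$, i.e. the minimiser of $\sum_{i=1}^n(Y_i-\beta_m(Z_i)^{\mathrm t}\gamma-\theta W_i)^2$. Notation. $\xi_m=\sup_{z\in[0,1]}\|\beta_m(z)\|$ (Euclidean norm); $b_0(z)=\mathbb E(W\mid Z=z)$; $b_m(z)=\beta_m(z)^{\mathrm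 t}\,\mathbb E[W\beta_m(Z)]$; $(a_n)$ is a sequence with $\|b_0-b_{m_n}\|_{L_2(P_Z)}\le a_n$. Efficiency. Consider local paths $\theta_0+\tau/\sqrt n$, $\eta_n(b)=\eta_0+b/\sqrt n$ with $\tau\in\mathbb R$, $b\in\mathcal H$. An estimator sequence $\widehat\theta_n$ is regular in $\mathcal P$ if there is a law $L$ such that for every $(\tau,b)$, $\sqrt n(\widehat\theta_n-\theta_0-\tau/\sqrt n)$ converges weakly to $L$ under $P^n_{\theta_0+\tau/\sqrt n,\eta_n(b)}$ ($n$-fold product measure); it is best regular if $L=\mathrm N(0,J^{-1})$, where $J$ is the semiparametric efficient information for $\theta$, here equal to $\sigma^{-2}\mathbb E(W^2-(\mathbb E[W\mid Z])^2)$. *)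

theory Defs
  imports "HOL-Probability.Probability"
begin

section \<open>The partially linear model\<close>

type_synonym obs = "real \<times> real \<times> real"

abbreviation W_of :: "obs \<Rightarrow> real" where "W_of x \<equiv> fst x"
abbreviation Y_of :: "obs \<Rightarrow> real" where "Y_of x \<equiv> fst (snd x)"
abbreviation Z_of :: "obs \<Rightarrow> real" where "Z_of x \<equiv> snd (snd x)"

text \<open>
  A joint density of \<open>(W, Z)\<close> on \<open>\<real> \<times> [0,1]\<close>, extended by zero to the plane. Since it vanishes for
  \<open>z\<close> outside the unit interval, the values of a regression function \<open>\<eta>\<close> there never matter, and
  continuity of \<open>\<eta>\<close> on the interval suffices for measurability of the model density.
\<close>

definition joint_density :: "(real \<times> real \<Rightarrow> real) \<Rightarrow> bool" where
  "joint_density f \<longleftrightarrow>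
     f \<in> borel_measurable borel \<and>
     (\<forall>u. 0 \<le> f u) \<and>
     (\<forall>w z. z \<notin> {0..1} \<longrightarrow> f (w, z) = 0) \<and>
     (\<integral>\<^sup>+ u. ennreal (f u) \<partial>lborel) = 1"

definition plm_density ::
  "real \<Rightarrow> (real \<times> real \<Rightarrow> real) \<Rightarrow> real \<Rightarrow> (real \<Rightarrow> real) \<Rightarrow> obs \<Rightarrow> real" where
  "plm_density \<sigma> f \<theta> \<eta> x =
     normal_density (\<eta> (Z_of x) + \<theta> * W_of x) \<sigma> (Y_of x) * f (W_of x, Z_of x)"

definition plm_law ::
  "real \<Rightarrow> (real \<times> real \<Rightarrow> real) \<Rightarrow> real \<Rightarrow> (real \<Rightarrow> real) \<Rightarrow> obs measure" where
  "plm_law \<sigma> f \<theta> \<eta> = density lborel (\<lambda>x. ennreal (plm_density \<sigma> f \<theta> \<eta> x))"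

text \<open>\<open>k\<close>-fold continuous differentiability on \<open>S\<close>; at boundary points derivatives are one-sided.\<close>

definition cont_diff_on :: "nat \<Rightarrow> real set \<Rightarrow> (real \<Rightarrow> real) \<Rightarrow> bool" where
  "cont_diff_on k S g \<longleftrightarrow>
     (\<exists>D :: nat \<Rightarrow> real \<Rightarrow> real.
        (\<forall>x\<in>S. D 0 x = g x) \<and>
        (\<forall>j<k. \<forall>x\<in>S. (D j has_real_derivative D (Suc j) x) (at x within S)) \<and>
        (\<forall>j\<le>k. continuous_on S (D j)))"

definition smooth_space :: "nat \<Rightarrow> (real \<Rightarrow> real) set" where
  "smooth_space s = {\<eta>. cont_diff_on s {0..1} \<eta>}"


section \<open>Conditional expectations given \<open>Z\<close> and the information\<close>

definition Z_algebra :: "obs measure" where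
  "Z_algebra = vimage_algebra UNIV Z_of borel"

definition Z_law :: "obs measure \<Rightarrow> real measure" where
  "Z_law P = distr P borel Z_of"

text \<open>\<open>b0\<close> is a version of \<open>z \<mapsto> E(W | Z = z)\<close>.\<close>

definition regression_W_Z :: "obs measure \<Rightarrow> (real \<Rightarrow> real) \<Rightarrow> bool" where
  "regression_W_Z P b0 \<longleftrightarrow>
     b0 \<in> borel_measurable borel \<and>
     (AE x in P. real_cond_exp P Z_algebra W_of x = b0 (Z_of x))"

definition plm_information :: "real \<Rightarrow> obs measure \<Rightarrow> real" where
  "plm_information \<sigma> P =
     (\<integral>x. ((W_of x)\<^sup>2 - (real_cond_exp P Z_algebra W_of x)\<^sup>2) \<partial>P) / \<sigma>\<^sup>2"


section \<open>Orthonormalised B-splines\<close>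

text \<open>The Cox--de Boor recursion: \<open>bspline t d j\<close> is the \<open>j\<close>-th B-spline of degree \<open>d\<close> with
  knots \<open>t\<close>.\<close>

fun bspline :: "(nat \<Rightarrow> real) \<Rightarrow> nat \<Rightarrow> nat \<Rightarrow> real \<Rightarrow> real" where
  "bspline t 0 j z = (if t j \<le> z \<and> z < t (Suc j) then 1 else 0)"
| "bspline t (Suc d) j z =
     (z - t j) / (t (j + d + 1) - t j) * bspline t d j z +
     (t (j + d + 2) - z) / (t (j + d + 2) - t (j + 1)) * bspline t d (j + 1) z"

text \<open>
  Equally spaced knots with mesh \<open>1/N\<close>, continued by \<open>l\<close> further knots on either side of \<open>[0,1]\<close>.
  The \<open>N + l\<close> B-splines of degree \<open>l\<close> with indices \<open>j < N + l\<close> are those that do not vanish on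
  \<open>(0,1)\<close>; there they span all splines of degree \<open>l\<close> with knots \<open>i/N\<close>. Repeating the boundary
  knots instead would give the same span and hence, up to an orthogonal matrix, the same
  orthonormalised family.
\<close>

definition spline_knots :: "nat \<Rightarrow> nat \<Rightarrow> nat \<Rightarrow> real" where
  "spline_knots l N i = (real i - real l) / real N"

text \<open>
  \<open>\<beta> 0, \<dots>, \<beta> (N + l - 1)\<close> arise from the B-splines by a linear transformation and are
  orthonormal in \<open>L\<^sub>2(Q)\<close>. Such families differ only by an orthogonal matrix, so the
  parametric models, the estimators, \<open>\<xi>\<close> and \<open>b\<^sub>m\<close> do not depend on the orthonormalisation chosen.
\<close>

definition orthonormal_bsplines ::
  "nat \<Rightarrow> nat \<Rightarrow> real measure \<Rightarrow> (nat \<Rightarrow> real \<Rightarrow> real) \<Rightarrow> bool" where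
  "orthonormal_bsplines l N Q \<beta> \<longleftrightarrow>
     (\<exists>A :: nat \<Rightarrow> nat \<Rightarrow> real. \<forall>i<N + l. \<forall>z.
        \<beta> i z = (\<Sum>j<N + l. A i j * bspline (spline_knots l N) l j z)) \<and>
     (\<forall>i<N + l. \<forall>j<N + l. (\<integral>z. \<beta> i z * \<beta> j z \<partial>Q) = (if i = j then 1 else 0))"

definition sup_norm_basis :: "nat \<Rightarrow> (nat \<Rightarrow> real \<Rightarrow> real) \<Rightarrow> real" where
  "sup_norm_basis k \<beta> = (SUP z\<in>{0..1}. L2_set (\<lambda>j. \<beta> j z) {..<k})"

definition series_fun :: "nat \<Rightarrow> (nat \<Rightarrow> real \<Rightarrow> real) \<Rightarrow> (nat \<Rightarrow> real) \<Rightarrow> real \<Rightarrow> real" where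
  "series_fun k \<beta> \<gamma> z = (\<Sum>j<k. \<beta> j z * \<gamma> j)"

definition projection_W :: "obs measure \<Rightarrow> nat \<Rightarrow> (nat \<Rightarrow> real \<Rightarrow> real) \<Rightarrow> real \<Rightarrow> real" where
  "projection_W P k \<beta> = series_fun k \<beta> (\<lambda>j. \<integral>x. W_of x * \<beta> j (Z_of x) \<partial>P)"

definition L2_dist :: "real measure \<Rightarrow> (real \<Rightarrow> real) \<Rightarrow> (real \<Rightarrow> real) \<Rightarrow> real" where
  "L2_dist Q g h = sqrt (\<integral>z. (g z - h z)\<^sup>2 \<partial>Q)"


section \<open>Maximum likelihood in the parametric models\<close>

text \<open>A parameter \<open>\<gamma> \<in> \<real>\<^sup>k\<close> is a function of which only the values at indices \<open>j < k\<close> matter.\<close>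

definition likelihood ::
  "real \<Rightarrow> (real \<times> real \<Rightarrow> real) \<Rightarrow> nat \<Rightarrow> (nat \<Rightarrow> real \<Rightarrow> real) \<Rightarrow> nat \<Rightarrow> (nat \<Rightarrow> obs) \<Rightarrow>
   real \<Rightarrow> (nat \<Rightarrow> real) \<Rightarrow> real" where
  "likelihood \<sigma> f k \<beta> n x \<theta> \<gamma> = (\<Prod>i<n. plm_density \<sigma> f \<theta> (series_fun k \<beta> \<gamma>) (x i))"

definition is_mle ::
  "real set \<Rightarrow> real \<Rightarrow> (real \<times> real \<Rightarrow> real) \<Rightarrow> nat \<Rightarrow> (nat \<Rightarrow> real \<Rightarrow> real) \<Rightarrow> nat \<Rightarrow> (nat \<Rightarrow> obs) \<Rightarrow>
   real \<Rightarrow> (nat \<Rightarrow> real) \<Rightarrow> bool" where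
  "is_mle \<Theta> \<sigma> f k \<beta> n x \<theta> \<gamma> \<longleftrightarrow>
     \<theta> \<in> \<Theta> \<and>
     (\<forall>\<theta>'\<in>\<Theta>. \<forall>\<gamma>'. likelihood \<sigma> f k \<beta> n x \<theta>' \<gamma>' \<le> likelihood \<sigma> f k \<beta> n x \<theta> \<gamma>)"

definition sum_of_squares ::
  "nat \<Rightarrow> (nat \<Rightarrow> real \<Rightarrow> real) \<Rightarrow> nat \<Rightarrow> (nat \<Rightarrow> obs) \<Rightarrow> real \<Rightarrow> (nat \<Rightarrow> real) \<Rightarrow> real" where
  "sum_of_squares k \<beta> n x \<theta> \<gamma> =
     (\<Sum>i<n. (Y_of (x i) - series_fun k \<beta> \<gamma> (Z_of (x i)) - \<theta> * W_of (x i))\<^sup>2)"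

text \<open>Almost every sample has \<open>f (W\<^sub>i, Z\<^sub>i) > 0\<close> for all \<open>i\<close>, and then maximum likelihood is least
  squares.\<close>

lemma is_mle_iff_least_squares:
  assumes "\<sigma> > 0" and pos: "\<And>i. i < n \<Longrightarrow> f (W_of (x i), Z_of (x i)) > 0"
  shows "is_mle \<Theta> \<sigma> f k \<beta> n x \<theta> \<gamma> \<longleftrightarrow>
     \<theta> \<in> \<Theta> \<and> (\<forall>\<theta>'\<in>\<Theta>. \<forall>\<gamma>'. sum_of_squares k \<beta> n x \<theta> \<gamma> \<le> sum_of_squares k \<beta> n x \<theta>' \<gamma>')"
proof -
  define c where "c = (\<Prod>i<n. 1 / sqrt (2 * pi * \<sigma>\<^sup>2) * f (W_of (x i), Z_of (x i)))"
  have c: "c > 0"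
    unfolding c_def using assms by (intro prod_pos) auto
  have lik: "likelihood \<sigma> f k \<beta> n x t g = c * exp (- sum_of_squares k \<beta> n x t g / (2 * \<sigma>\<^sup>2))" for t g
  proof -
    have "likelihood \<sigma> f k \<beta> n x t g =
      (\<Prod>i<n. (1 / sqrt (2 * pi * \<sigma>\<^sup>2) * f (W_of (x i), Z_of (x i))) *
        exp (- (Y_of (x i) - series_fun k \<beta> g (Z_of (x i)) - t * W_of (x i))\<^sup>2 / (2 * \<sigma>\<^sup>2)))"
      unfolding likelihood_def plm_density_def normal_density_def
      by (intro prod.cong refl) (simp add: diff_diff_eq mult.commute mult.left_commute)
    also have "\<dots> = c * exp (\<Sum>i<n. - (Y_of (x i) - series_fun k \<beta> g (Z_of (x i)) - t * W_of (x i))\<^sup>2 / (2 * \<sigma>\<^sup>2))"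
      unfolding c_def prod.distrib by (simp add: exp_sum)
    finally show ?thesis
      unfolding sum_of_squares_def by (simp add: sum_negf sum_divide_distrib)
  qed
  have "likelihood \<sigma> f k \<beta> n x t' g' \<le> likelihood \<sigma> f k \<beta> n x t g \<longleftrightarrow>
      sum_of_squares k \<beta> n x t g \<le> sum_of_squares k \<beta> n x t' g'" for t t' g g'
    unfolding lik using c \<open>\<sigma> > 0\<close> by (simp add: divide_le_cancel)
  then show ?thesis
    unfolding is_mle_def by simp
qed

text \<open>
  \<open>T n\<close> is the \<open>\<theta>\<close>-component of a maximum likelihood estimator based on \<open>n\<close> observations, for the
  parametric model with basis \<open>\<beta> n 0, \<dots>, \<beta> n (k n - 1)\<close>. A maximiser need not exist (\<open>\<Theta>\<close> need
  not be closed) nor be unique (singular design): \<open>T n\<close> is a measurable selection, arbitrary on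
  samples for which there is no maximiser.
\<close>

definition mle_theta_sequence ::
  "real set \<Rightarrow> real \<Rightarrow> (real \<times> real \<Rightarrow> real) \<Rightarrow> (nat \<Rightarrow> nat) \<Rightarrow> (nat \<Rightarrow> nat \<Rightarrow> real \<Rightarrow> real) \<Rightarrow>
   (nat \<Rightarrow> (nat \<Rightarrow> obs) \<Rightarrow> real) \<Rightarrow> bool" where
  "mle_theta_sequence \<Theta> \<sigma> f k \<beta> T \<longleftrightarrow>
     (\<forall>n. T n \<in> borel_measurable (PiM {..<n} (\<lambda>_. borel :: obs measure)) \<and>
        (\<forall>x\<in>space (PiM {..<n} (\<lambda>_. borel :: obs measure)).
           (\<exists>\<theta> \<gamma>. is_mle \<Theta> \<sigma> f (k n) (\<beta> n) n x \<theta> \<gamma>) \<longrightarrow>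
           (\<exists>\<gamma>. is_mle \<Theta> \<sigma> f (k n) (\<beta> n) n x (T n x) \<gamma>)))"


section \<open>Regular and best regular estimators\<close>

definition local_law ::
  "real \<Rightarrow> (real \<times> real \<Rightarrow> real) \<Rightarrow> real \<Rightarrow> (real \<Rightarrow> real) \<Rightarrow> real \<Rightarrow> (real \<Rightarrow> real) \<Rightarrow> nat \<Rightarrow>
   (nat \<Rightarrow> obs) measure" where
  "local_law \<sigma> f \<theta>0 \<eta>0 \<tau> b n =
     PiM {..<n} (\<lambda>_. plm_law \<sigma> f (\<theta>0 + \<tau> / sqrt (real n)) (\<lambda>z. \<eta>0 z + b z / sqrt (real n)))"

definition regular_with_law ::
  "nat \<Rightarrow> real \<Rightarrow> (real \<times> real \<Rightarrow> real) \<Rightarrow> real \<Rightarrow> (real \<Rightarrow> real) \<Rightarrow>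
   (nat \<Rightarrow> (nat \<Rightarrow> obs) \<Rightarrow> real) \<Rightarrow> real measure \<Rightarrow> bool" where
  "regular_with_law s \<sigma> f \<theta>0 \<eta>0 T L \<longleftrightarrow>
     real_distribution L \<and>
     (\<forall>\<tau>. \<forall>b\<in>smooth_space s.
        weak_conv_m
          (\<lambda>n. distr (local_law \<sigma> f \<theta>0 \<eta>0 \<tau> b n) borel
                 (\<lambda>x. sqrt (real n) * (T n x - \<theta>0 - \<tau> / sqrt (real n))))
          L)"

definition best_regular ::
  "nat \<Rightarrow> real \<Rightarrow> (real \<times> real \<Rightarrow> real) \<Rightarrow> real \<Rightarrow> (real \<Rightarrow> real) \<Rightarrow>
   (nat \<Rightarrow> (nat \<Rightarrow> obs) \<Rightarrow> real) \<Rightarrow> bool" where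
  "best_regular s \<sigma> f \<theta>0 \<eta>0 T \<longleftrightarrow>
     regular_with_law s \<sigma> f \<theta>0 \<eta>0 T
       (density lborel
          (\<lambda>t. ennreal (normal_density 0 (sqrt (1 / plm_information \<sigma> (plm_law \<sigma> f \<theta>0 \<eta>0))) t)))"

end

theory Submission
  imports Defs
begin

text \<open>
  Given the design \<open>(W\<^sub>i, Z\<^sub>i)\<close>, whose law does not depend on the parameters, the noise
  \<open>e\<^sub>i = Y\<^sub>i - \<eta>(Z\<^sub>i) - \<theta> W\<^sub>i\<close> is exactly normal under every law of the model, so neither
  contiguity nor a central limit theorem is needed. Let \<open>M\<close> be the projection of \<open>\<real>\<^sup>n\<close> off the
  columns \<open>\<beta>\<^sub>j(Z\<^sub>i)\<close> and \<open>c = M W / |M W|\<^sup>2\<close>. The least squares estimator is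
  \<open>\<Sum> c\<^sub>i Y\<^sub>i = \<theta> + \<Sum> c\<^sub>i (\<eta> - g)(Z\<^sub>i) + \<Sum> c\<^sub>i e\<^sub>i\<close> for every spline \<open>g\<close>, because \<open>c\<close> annihilates the
  columns and \<open>\<Sum> c\<^sub>i W\<^sub>i = 1\<close>. Since \<open>\<Sum> c\<^sub>i\<^sup>2 = 1 / |M W|\<^sup>2\<close>, the last sum times \<open>\<surd>n\<close> is normal with
  variance \<open>\<sigma>\<^sup>2 / (|M W|\<^sup>2 / n)\<close> given the design, and the bias times \<open>\<surd>n\<close> is at most of the order
  \<open>\<surd>n sup |\<eta> - g|\<close>, which vanishes for a spline of optimal order.

  It remains that \<open>|M W|\<^sup>2 / n\<close> tends in probability to \<open>V = E (W - E(W|Z))\<^sup>2\<close>. With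
  \<open>U = W - E(W|Z)\<close>, this follows from the law of large numbers for \<open>U\<^sup>2\<close> once the empirical Gram
  matrix of the \<open>\<beta>\<^sub>j\<close> is near the identity, the empirical inner products of \<open>U\<close> with the \<open>\<beta>\<^sub>j\<close> are
  small, and \<open>E(W|Z)\<close> is near its projection; all of this is controlled by first moments of
  \<open>design_defect\<close>. The limit of characteristic functions is then identified by Levy's theorem.
\<close>

section \<open>Reproduction of polynomials by B-splines\<close>

text \<open>Three obstacles shape the details. The set \<Theta> is only known to contain an interval
  around \<open>\<theta>0\<close>, and \<open>T n\<close> is arbitrary where no maximiser exists, so
  the linear formula holds only if its value falls into that interval. Characteristic functions suit
  this: they are bounded by 1, so an exceptional event costs at most twice its probability, and each
  such cost is dominated pointwise by a multiple of a squared noise term or of the design defect.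
  Integrating that bound does the work of Chebyshev's and Markov's inequalities. The number of
  columns grows with n, so the Gram matrix is compared with the identity in the Frobenius norm; the
  expected square of the error is at most \<xi>^2 k / n, which is below (\<xi> k / sqrt n)^2. No
  fourth moment of W is assumed, so the squares of \<open>U\<close> may have infinite variance and
  their law of large numbers needs truncation. The spline approximation must be uniform and of full
  order up to the ends of the interval. A quasi-interpolant built from blossoms achieves this:
  locality and polynomial reproduction suffice, and no inverse of a collocation or Gram matrix has
  to be bounded.\<close>

lemma bspline_nonzero_imp:
  assumes "strict_mono t" "bspline t d j z \<noteq> 0"
  shows "t j \<le> z \<and> z < t (j + d + 1)"
  using assms(2)
proof (induction d arbitrary: j)
  case 0
  then show ?case by (auto split: if_splits)
next
  case (Suc d)
  have *: "t j < t (j + 1)" "t (j + d + 1) < t (j + d + 2)"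
    using assms(1) by (auto simp: strict_mono_def)
  consider "bspline t d j z \<noteq> 0" | "bspline t d (j + 1) z \<noteq> 0"
    using Suc.prems by fastforce
  then show ?case
  proof cases
    case 1
    with Suc.IH[of j] * show ?thesis by auto
  next
    case 2
    with Suc.IH[of "j + 1"] * show ?thesis by auto
  qed
qed

text \<open>The Cox--de Boor weights are negative only where the splines that they multiply
  vanish.\<close>

lemma bspline_nonneg:
  assumes "strict_mono t"
  shows "bspline t d j z \<ge> 0"
proof (induction d arbitrary: j)
  case (Suc d)
  have *: "t j < t (j + d + 1)" "t (j + 1) < t (j + d + 2)"
    using assms by (auto simp: strict_mono_def)
  have "(z - t j) / (t (j + d + 1) - t j) * bspline t d j z \<ge> 0"
    using Suc.IH[of j] bspline_nonzero_imp[OF assms, of d j z] *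
    by (cases "bspline t d j z = 0") auto
  moreover have "(t (j + d + 2) - z) / (t (j + d + 2) - t (j + 1)) * bspline t d (j + 1) z \<ge> 0"
    using Suc.IH[of "j + 1"] bspline_nonzero_imp[OF assms, of d "j + 1" z] *
    by (cases "bspline t d (j + 1) z = 0") (auto simp: eval_nat_numeral)
  ultimately show ?case by simp
qed auto

lemma bspline_borel [measurable]: "bspline t d j \<in> borel_measurable borel"
proof (induction d arbitrary: j)
  case 0
  have "bspline t 0 j = (\<lambda>z. if t j \<le> z \<and> z < t (Suc j) then 1 else 0)" by (rule ext) simp
  then show ?case by simp
next
  case (Suc d)
  note Suc.IH[measurable]
  have "bspline t (Suc d) j = (\<lambda>z. (z - t j) / (t (j + d + 1) - t j) * bspline t d j z +
     (t (j + d + 2) - z) / (t (j + d + 2) - t (j + 1)) * bspline t d (j + 1) z)"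
    by (rule ext) simp
  then show ?case by simp
qed

text \<open>Marsden's identity, with the sign of the dual variable reversed. The condition
  \<open>d \<le> \<mu>\<close> ensures that all d + 1 splines that are alive on the knot interval of
  \<open>z\<close> have a natural number as index.\<close>

lemma marsden_identity:
  fixes t :: "nat \<Rightarrow> real"
  assumes t: "strict_mono t" and z: "t \<mu> \<le> z" "z < t (Suc \<mu>)" and "d \<le> \<mu>"
  shows "(\<Sum>j\<le>\<mu>. bspline t d j z * (\<Prod>i<d. y + t (j + i + 1))) = (y + z) ^ d"
  using \<open>d \<le> \<mu>\<close>
proof (induction d)
  case 0
  have "bspline t 0 j z = (if j = \<mu> then 1 else 0)" if "j \<le> \<mu>" for j
  proof (cases "j = \<mu>")
    case False
    then have "t (Suc j) \<le> t \<mu>" using t that by (simp add: strict_mono_less_eq)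
    with z False show ?thesis by auto
  qed (use z in auto)
  then show ?case by simp
next
  case (Suc d)
  define B where "B j = bspline t d j z" for j
  define \<psi> where "\<psi> j = (\<Prod>i<d. y + t (j + i + 1))" for j
  define \<psi>' where "\<psi>' j = (\<Prod>i<Suc d. y + t (j + i + 1))" for j
  have IH: "(\<Sum>j\<le>\<mu>. B j * \<psi> j) = (y + z) ^ d"
    using Suc by (simp add: B_def \<psi>_def)
  have \<psi>'1: "\<psi>' j = \<psi> j * (y + t (j + d + 1))" for j by (simp add: \<psi>'_def \<psi>_def)
  have \<psi>'2: "\<psi>' j = (y + t (Suc j)) * \<psi> (Suc j)" for j
    unfolding \<psi>'_def \<psi>_def by (subst prod.lessThan_Suc_shift) simp
  \<comment> \<open>Since \<open>Suc d \<le> \<mu>\<close>, the support of spline 0 of degree d ends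
    before \<open>z\<close>. Together with \<open>B1\<close> this makes the index shift in the
    recursion lossless at both ends.\<close>
  have B0: "B 0 = 0"
  proof -
    have "t (d + 1) \<le> t \<mu>" using t Suc.prems by (simp add: strict_mono_less_eq)
    with z bspline_nonzero_imp[OF t, of d 0 z] show ?thesis by (auto simp: B_def)
  qed
  have B1: "B (Suc \<mu>) = 0"
    using z bspline_nonzero_imp[OF t, of d "Suc \<mu>" z] by (auto simp: B_def)
  define a where "a j = (z - t j) / (t (j + d + 1) - t j)" for j
  have a: "(t (j + d + 1) - z) / (t (j + d + 1) - t j) = 1 - a j" for j
  proof -
    have "t j < t (j + d + 1)" using t by (simp add: strict_mono_def)
    then show ?thesis by (simp add: a_def field_simps)
  qed
  have "bspline t (Suc d) j z = a j * B j + (1 - a (Suc j)) * B (Suc j)" for j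
    unfolding bspline.simps a[of "Suc j", symmetric] B_def unfolding a_def by simp
  then have "(\<Sum>j\<le>\<mu>. bspline t (Suc d) j z * \<psi>' j) =
     (\<Sum>j\<le>\<mu>. a j * B j * \<psi>' j) + (\<Sum>j\<le>\<mu>. (1 - a (Suc j)) * B (Suc j) * \<psi>' j)"
    by (simp add: sum.distrib distrib_right)
  also have "(\<Sum>j\<le>\<mu>. a j * B j * \<psi>' j) = (\<Sum>j<\<mu>. a (Suc j) * B (Suc j) * \<psi>' (Suc j))"
    by (subst sum.atMost_shift) (simp add: B0)
  also have "(\<Sum>j\<le>\<mu>. (1 - a (Suc j)) * B (Suc j) * \<psi>' j) =
      (\<Sum>j<\<mu>. (1 - a (Suc j)) * B (Suc j) * \<psi>' j)"
    by (simp add: lessThan_Suc_atMost[symmetric] B1)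
  also have "(\<Sum>j<\<mu>. a (Suc j) * B (Suc j) * \<psi>' (Suc j)) + \<dots> =
      (\<Sum>j<\<mu>. (y + z) * (B (Suc j) * \<psi> (Suc j)))"
    unfolding sum.distrib[symmetric]
  proof (intro sum.cong refl)
    fix j
    have "t (Suc j) < t (Suc j + d + 1)" using t by (simp add: strict_mono_def)
    \<comment> \<open>The weights represent \<open>z\<close> as an affine combination of the two end
      knots of the support, so the two products in knots merge into a factor
      \<open>y + z\<close>.\<close>
    then have *: "a (Suc j) * (y + t (Suc j + d + 1)) + (1 - a (Suc j)) * (y + t (Suc j)) = y + z"
      by (simp add: a_def divide_simps) (simp add: algebra_simps)
    show "a (Suc j) * B (Suc j) * \<psi>' (Suc j) + (1 - a (Suc j)) * B (Suc j) * \<psi>' j =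
        (y + z) * (B (Suc j) * \<psi> (Suc j))"
      unfolding \<psi>'1[of "Suc j"] \<psi>'2[of j] by (simp only: flip: *) (simp only: algebra_simps)
  qed
  also have "\<dots> = (y + z) * (\<Sum>j\<le>\<mu>. B j * \<psi> j)"
    by (subst sum.atMost_shift) (simp add: B0 sum_distrib_left)
  finally show ?case using IH by (simp add: \<psi>'_def)
qed

section \<open>Blossoms of monomials\<close>

text \<open>The elementary symmetric polynomial of degree \<open>r\<close> in \<open>d\<close> variables, divided by its number of
  terms: the blossom of \<open>x \<mapsto> x ^ r\<close> regarded as a polynomial of degree \<open>d\<close>.\<close>

definition blossom_power :: "nat \<Rightarrow> nat \<Rightarrow> (nat \<Rightarrow> real) \<Rightarrow> real" where
  "blossom_power d r \<tau> = coeff (\<Prod>i<d. [:\<tau> i, 1:]) (d - r) / real (d choose r)"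

lemma degree_prod_linear_le: "degree (\<Prod>i<d. [:\<tau> i, 1 :: real:]) \<le> d"
  by (rule order.trans[OF degree_prod_sum_le]) auto

text \<open>The coefficient is a sum of products of \<open>r\<close> of the numbers
  \<open>\<tau> i\<close>, one for each subset of size \<open>r\<close>; the induction bounds the
  number of subsets by \<open>2 ^ d\<close>, and the binomial in the denominator is at least
  1.\<close>

lemma blossom_power_bound:
  assumes "\<And>i. i < d \<Longrightarrow> \<bar>\<tau> i\<bar> \<le> \<rho>" "r \<le> d"
  shows "\<bar>blossom_power d r \<tau>\<bar> \<le> 2 ^ d * \<rho> ^ r"
proof -
  have *: "\<bar>coeff (\<Prod>i<d. [:\<tau> i, 1:]) e\<bar> \<le> 2 ^ d * \<rho> ^ r" if "e + r = d" for e r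
    using that assms(1)
  proof (induction d arbitrary: e r)
    case (Suc d)
    define p where "p = (\<Prod>i<d. [:\<tau> i, 1:])"
    have \<rho>: "\<rho> \<ge> 0" using Suc.prems(2)[of 0] by simp
    have IH: "\<bar>coeff p e\<bar> \<le> 2 ^ d * \<rho> ^ r" if "e + r = d" for e r
      using Suc.IH[OF that] Suc.prems(2) by (simp add: p_def)
    have 1: "\<bar>\<tau> d * coeff p e\<bar> \<le> 2 ^ d * \<rho> ^ r"
    proof (cases r)
      case 0
      then have "coeff p e = 0"
        using Suc.prems(1) degree_prod_linear_le[of \<tau> d] by (intro coeff_eq_0) (simp add: p_def)
      then show ?thesis using \<rho> by simp
    next
      case (Suc r')
      then have "\<bar>coeff p e\<bar> \<le> 2 ^ d * \<rho> ^ r'" using Suc.prems(1) by (intro IH) simp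
      then have "\<bar>\<tau> d\<bar> * \<bar>coeff p e\<bar> \<le> \<rho> * (2 ^ d * \<rho> ^ r')"
        using Suc.prems(2)[of d] \<rho> by (intro mult_mono) auto
      then show ?thesis using Suc by (simp add: abs_mult mult_ac)
    qed
    have 2: "\<bar>(case e of 0 \<Rightarrow> 0 | Suc e' \<Rightarrow> coeff p e')\<bar> \<le> 2 ^ d * \<rho> ^ r"
      using IH Suc.prems(1) \<rho> by (auto split: nat.split)
    have "(\<Prod>i<Suc d. [:\<tau> i, 1:]) = smult (\<tau> d) p + pCons 0 p"
      by (simp add: p_def mult.commute)
    then have "coeff (\<Prod>i<Suc d. [:\<tau> i, 1:]) e = \<tau> d * coeff p e + (case e of 0 \<Rightarrow> 0 | Suc e' \<Rightarrow> coeff p e')"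
      by (simp add: coeff_pCons)
    with 1 2 show ?case by simp
  qed auto
  have "real (d choose r) \<ge> 1"
    using assms(2) by (simp add: Suc_leI)
  then have "\<bar>blossom_power d r \<tau>\<bar> \<le> \<bar>coeff (\<Prod>i<d. [:\<tau> i, 1:]) (d - r)\<bar>"
    unfolding blossom_power_def abs_divide by (simp add: divide_le_eq mult_left_le mult_le_cancel_left1)
  with *[of "d - r" r] assms(2) show ?thesis by simp
qed

text \<open>Adding \<open>h\<close> to every variable composes the generating polynomial with x + h;
  comparing coefficients gives the binomial expansion, transported to blossoms. It serves to move
  the centre of a Taylor polynomial from the evaluation point to a point attached to a
  B-spline.\<close>

lemma blossom_power_shift:
  assumes "p \<le> d"
  shows "blossom_power d p (\<lambda>i. \<tau> i + h) =
    (\<Sum>r\<le>p. real (p choose r) * h ^ (p - r) * blossom_power d r \<tau>)"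
proof -
  define P where "P = (\<Prod>i<d. [:\<tau> i, 1:])"
  have poly_P: "poly P x = (\<Sum>k\<le>d. coeff P k * x ^ k)" for x
    unfolding poly_altdef using degree_prod_linear_le[of \<tau> d]
    by (intro sum.mono_neutral_left) (auto simp: P_def coeff_eq_0)
  have "(\<Prod>i<d. [:\<tau> i + h, 1:]) = pcompose P [:h, 1:]"
    by (simp add: P_def pcompose_prod pcompose_pCons add.commute)
  also have "\<dots> = (\<Sum>k\<le>d. smult (coeff P k) ([:h, 1:] ^ k))"
  proof (rule poly_ext)
    fix x
    show "poly (pcompose P [:h, 1:]) x = poly (\<Sum>k\<le>d. smult (coeff P k) ([:h, 1:] ^ k)) x"
      by (simp add: poly_pcompose poly_sum poly_P)
  qed
  finally have "coeff (\<Prod>i<d. [:\<tau> i + h, 1:]) (d - p) = (\<Sum>k\<le>d. coeff P k * coeff ([:h, 1:] ^ k) (d - p))"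
    by (simp add: coeff_sum)
  also have "\<dots> = (\<Sum>k\<in>{d-p..d}. coeff P k * coeff ([:h, 1:] ^ k) (d - p))"
    by (intro sum.mono_neutral_right) (auto intro!: coeff_eq_0 simp: degree_linear_power)
  also have "\<dots> = (\<Sum>r\<le>p. coeff P (d - r) * coeff ([:h, 1:] ^ (d - r)) (d - p))"
    using assms by (intro sum.reindex_bij_witness[of _ "\<lambda>r. d - r" "\<lambda>k. d - k"]) auto
  also have "\<dots> = (\<Sum>r\<le>p. coeff P (d - r) * (real ((d - r) choose (p - r)) * h ^ (p - r)))"
  proof (intro sum.cong refl)
    fix r assume "r \<in> {..p}"
    then have "(d - r) choose (d - p) = (d - r) choose (p - r)" "d - r - (d - p) = p - r"
      using assms binomial_symmetric[of "d - p" "d - r"] by auto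
    then show "coeff P (d - r) * coeff ([:h, 1:] ^ (d - r)) (d - p) =
        coeff P (d - r) * (real ((d - r) choose (p - r)) * h ^ (p - r))"
      using \<open>r \<in> {..p}\<close> by (subst coeff_linear_poly_power) auto
  qed
  finally have "blossom_power d p (\<lambda>i. \<tau> i + h) =
      (\<Sum>r\<le>p. coeff P (d - r) * (real ((d - r) choose (p - r)) * h ^ (p - r)) / real (d choose p))"
    by (simp add: blossom_power_def sum_divide_distrib)
  also have "\<dots> = (\<Sum>r\<le>p. real (p choose r) * h ^ (p - r) * blossom_power d r \<tau>)"
  proof (intro sum.cong refl)
    fix r assume "r \<in> {..p}"
    then have "real (d choose p) * real (p choose r) = real (d choose r) * real ((d - r) choose (p - r))"
      using choose_mult[of r p d] assms by (metis atMost_iff of_nat_mult)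
    moreover have "real (d choose p) > 0" "real (d choose r) > 0"
      using assms \<open>r \<in> {..p}\<close> by auto
    ultimately show "coeff P (d - r) * (real ((d - r) choose (p - r)) * h ^ (p - r)) / real (d choose p) =
        real (p choose r) * h ^ (p - r) * blossom_power d r \<tau>"
      by (simp add: blossom_power_def P_def field_simps)
  qed
  finally show ?thesis .
qed

text \<open>Marsden's identity holds for every value of the dual variable, hence as an identity of
  polynomials in it; this is its coefficient of degree \<open>d - r\<close>.\<close>

lemma bspline_reproduces_power:
  fixes t :: "nat \<Rightarrow> real"
  assumes "strict_mono t" "t \<mu> \<le> z" "z < t (Suc \<mu>)" "d \<le> \<mu>" "r \<le> d"
  shows "(\<Sum>j\<le>\<mu>. bspline t d j z * blossom_power d r (\<lambda>i. t (j + i + 1) - a)) = (z - a) ^ r"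
proof -
  have "(\<Sum>j\<le>\<mu>. smult (bspline t d j z) (\<Prod>i<d. [:t (j + i + 1) - a, 1:])) = [:z - a, 1:] ^ d"
  proof (rule poly_ext)
    fix x
    show "poly (\<Sum>j\<le>\<mu>. smult (bspline t d j z) (\<Prod>i<d. [:t (j + i + 1) - a, 1:])) x = poly ([:z - a, 1:] ^ d) x"
      using marsden_identity[OF assms(1-4), of "x - a"]
      by (simp add: poly_sum poly_prod algebra_simps)
  qed
  then have "(\<Sum>j\<le>\<mu>. bspline t d j z * coeff (\<Prod>i<d. [:t (j + i + 1) - a, 1:]) (d - r)) =
      coeff ([:z - a, 1:] ^ d) (d - r)"
    by (drule_tac arg_cong[where f = "\<lambda>p. coeff p (d - r)"]) (simp add: coeff_sum)
  also have "\<dots> = real (d choose r) * (z - a) ^ r"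
    using assms(5) by (subst coeff_linear_poly_power) (auto simp: binomial_symmetric[symmetric])
  finally show ?thesis
    using assms(5) by (simp add: blossom_power_def sum_divide_distrib[symmetric])
qed

section \<open>Approximation of smooth functions by splines\<close>

lemma blossom_power_0: "blossom_power d 0 \<tau> = 1"
proof -
  have "degree (\<Prod>i<d. [:\<tau> i, 1:]) = d"
    by (subst degree_prod_eq_sum_degree) auto
  moreover have "lead_coeff (\<Prod>i<d. [:\<tau> i, 1:]) = 1"
    by (simp add: lead_coeff_prod)
  ultimately show ?thesis
    by (simp add: blossom_power_def)
qed

lemma divide_fact_le: "0 \<le> x \<Longrightarrow> x / fact n \<le> (x :: real)"
  using divide_left_mono[of 1 "fact n" x] by simp

text \<open>The exponent \<open>s - r\<close> complements the factor \<rho>^r in the bound of the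
  blossom of degree r, so that every derivative contributes an error of the full order s.\<close>

lemma taylor_bound_within:
  fixes D :: "nat \<Rightarrow> real \<Rightarrow> real"
  assumes S: "convex S" "x \<in> S" "z \<in> S" and "r < s"
    and D: "\<And>j u. j < s \<Longrightarrow> u \<in> S \<Longrightarrow> (D j has_real_derivative D (Suc j) u) (at u within S)"
    and M: "\<And>u. u \<in> S \<Longrightarrow> \<bar>D s u\<bar> \<le> M"
  shows "\<bar>D r x - (\<Sum>q<s - r. D (r + q) z * (x - z) ^ q / fact q)\<bar> \<le> M * \<bar>x - z\<bar> ^ (s - r)"
proof -
  define n where "n = s - r - 1"
  have n: "s - r = Suc n" "s = r + Suc n" using \<open>r < s\<close> by (auto simp: n_def)
  have "norm (D (r + 0) x - (\<Sum>i\<le>n. D (r + i) z * (x - z) ^ i / fact i)) \<le> M * norm (x - z) ^ Suc n / fact n"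
    using D M n S by (intro field_Taylor[where f = "\<lambda>i. D (r + i)"]) auto
  also have "\<dots> \<le> M * norm (x - z) ^ Suc n"
    using M[OF \<open>x \<in> S\<close>] by (intro divide_fact_le mult_nonneg_nonneg) auto
  finally show ?thesis
    unfolding n(1) lessThan_Suc_atMost by simp
qed

text \<open>Re-expansion of a Taylor polynomial about another centre: the order of summation is
  exchanged with p = r + q, and (p choose r) / p! = 1 / (r! q!).\<close>

lemma sum_taylor_blossom:
  fixes a c :: "nat \<Rightarrow> real"
  shows "(\<Sum>p<s. a p / fact p * (\<Sum>r\<le>p. real (p choose r) * h ^ (p - r) * c r)) =
    (\<Sum>r<s. c r / fact r * (\<Sum>q<s - r. a (r + q) * h ^ q / fact q))"
proof -
  have "(\<Sum>p<s. a p / fact p * (\<Sum>r\<le>p. real (p choose r) * h ^ (p - r) * c r)) =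
      (\<Sum>p<s. \<Sum>r\<le>p. a p / fact p * (real (p choose r) * h ^ (p - r) * c r))"
    by (simp add: sum_distrib_left)
  also have "\<dots> = (\<Sum>(p, r)\<in>(SIGMA p:{..<s}. {..p}). a p / fact p * (real (p choose r) * h ^ (p - r) * c r))"
    by (subst sum.Sigma) auto
  also have "\<dots> = (\<Sum>(r, q)\<in>(SIGMA r:{..<s}. {..<s - r}). c r / fact r * (a (r + q) * h ^ q / fact q))"
    by (intro sum.reindex_bij_witness[of _ "\<lambda>(r, q). (r + q, r)" "\<lambda>(p, r). (r, p - r)"])
       (auto simp: binomial_fact)
  also have "\<dots> = (\<Sum>r<s. \<Sum>q<s - r. c r / fact r * (a (r + q) * h ^ q / fact q))"
    by (subst sum.Sigma) auto
  finally show ?thesis by (simp add: sum_distrib_left)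
qed

lemma strict_mono_spline_knots: "N \<ge> 1 \<Longrightarrow> strict_mono (spline_knots l N)"
  by (auto simp: strict_mono_def spline_knots_def divide_strict_right_mono)

text \<open>The coefficient of the \<open>j\<close>-th B-spline is the blossom, at the inner knots of that B-spline, of
  the Taylor polynomial of \<open>g\<close> at the left end of its support (moved into the unit interval).
  The Taylor polynomial of \<open>g\<close> at \<open>z\<close> is reproduced exactly, so that the error at \<open>z\<close> only
  involves Taylor remainders between points at distance of the order of the mesh.\<close>

lemma spline_approximation:
  assumes "cont_diff_on s {0..1} g" "s \<le> l + 1"
  obtains K where "K \<ge> 0" and "\<And>N. N \<ge> 1 \<Longrightarrow>
    \<exists>\<gamma>. \<forall>z\<in>{0..<1}. \<bar>g z - (\<Sum>j<N + l. \<gamma> j * bspline (spline_knots l N) l j z)\<bar> \<le> K / real N ^ s"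
proof -
  from assms(1) obtain D where D0: "\<And>x. x \<in> {0..1} \<Longrightarrow> D 0 x = g x"
    and D: "\<And>j x. j < s \<Longrightarrow> x \<in> {0..1} \<Longrightarrow> (D j has_real_derivative D (Suc j) x) (at x within {0..1})"
    and Dc: "\<And>j. j \<le> s \<Longrightarrow> continuous_on {0..1} (D j)"
    unfolding cont_diff_on_def by blast
  have "compact (D s ` {0..1})"
    by (intro compact_continuous_image Dc) auto
  then obtain M where M: "\<And>x. x \<in> {0..1} \<Longrightarrow> \<bar>D s x\<bar> \<le> M"
    using compact_imp_bounded bounded_iff by (metis imageI real_norm_def)
  have M0: "M \<ge> 0" using M[of 0] by simp
  show thesis
  proof (cases "s = 0")
    case True
    have "\<exists>\<gamma>. \<forall>z\<in>{0..<1}. \<bar>g z - (\<Sum>j<N + l. \<gamma> j * bspline (spline_knots l N) l j z)\<bar> \<le> M / real N ^ s"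
      \<comment> \<open>Without derivatives a bounded function is approximated to the required order
        by the zero spline.\<close>
      for N
      using M D0 True by (intro exI[of _ "\<lambda>_. 0"]) auto
    with M0 show ?thesis by (intro that[of M])
  next
    case False
    then have s: "s \<ge> 1" by simp
    \<comment> \<open>There are \<open>s\<close> Taylor terms, each with \<open>2 ^ l\<close> from
      the blossom bound and \<open>M\<close> from the remainder; the support of a spline has length
      (l + 1) / N, whose s-th power gives the last factor.\<close>
    define K where "K = real s * (2 ^ l * M) * real (l + 1) ^ s"
    have "\<exists>\<gamma>. \<forall>z\<in>{0..<1}. \<bar>g z - (\<Sum>j<N + l. \<gamma> j * bspline (spline_knots l N) l j z)\<bar> \<le> K / real N ^ s"
      if N: "N \<ge> 1" for N
    proof -
      define t where "t = spline_knots l N"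
      have t: "strict_mono t" unfolding t_def by (rule strict_mono_spline_knots[OF N])
      define B where "B j z = bspline t l j z" for j z
      define x where "x j = max 0 (t j)" for j
      define c where "c j r a = blossom_power l r (\<lambda>i. t (j + i + 1) - a)" for j r a
      define \<gamma> where "\<gamma> j = (\<Sum>r<s. D r (x j) / fact r * c j r (x j))" for j
      define \<rho> where "\<rho> = real (l + 1) / real N"
      have t_eq: "t j = (real j - real l) / real N" for j by (simp add: t_def spline_knots_def)
      have "\<bar>g z - (\<Sum>j<N + l. \<gamma> j * B j z)\<bar> \<le> K / real N ^ s" if z: "z \<in> {0..<1}" for z
      proof -
        define i where "i = nat \<lfloor>real N * z\<rfloor>"
        \<comment> \<open>The knots start at -l / N, so the mesh interval with number
          \<open>i\<close> has knot index \<open>i + l\<close>; in particular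
          \<open>l \<le> \<mu>\<close>, as Marsden's identity requires.\<close>
        define \<mu> where "\<mu> = i + l"
        have i: "real i \<le> real N * z" "real N * z < real i + 1"
          using z by (auto simp: i_def)
        have "real N * z < real N * 1" using z N by (intro mult_strict_left_mono) auto
        with i(1) have "real i < real N" by linarith
        then have \<mu>: "\<mu> < N + l" by (simp add: \<mu>_def)
        have z\<mu>: "t \<mu> \<le> z" "z < t (Suc \<mu>)"
          using i N by (auto simp: t_eq \<mu>_def field_simps)
        have B_supp: "t j \<le> z \<and> z < t (j + l + 1)" if "B j z \<noteq> 0" for j
          using bspline_nonzero_imp[OF t] that by (auto simp: B_def)
        have B0: "B j z = 0" if "j > \<mu>" for j
        proof -
          have "t (Suc \<mu>) \<le> t j" using t that by (simp add: strict_mono_less_eq)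
          with B_supp[of j] z\<mu> show ?thesis by auto
        qed
        have B_nonneg: "B j z \<ge> 0" for j unfolding B_def by (rule bspline_nonneg[OF t])
        \<comment> \<open>Powers are centred at the evaluation point itself, where only the constant
          one survives.\<close>
        have rep: "(\<Sum>j\<le>\<mu>. B j z * c j p z) = (if p = 0 then 1 else 0)" if "p \<le> l" for p
          unfolding B_def c_def using bspline_reproduces_power[OF t z\<mu> _ that, of z]
          by (simp add: \<mu>_def power_0_left)
        have B_sum: "(\<Sum>j\<le>\<mu>. B j z) = 1"
          using rep[of 0] by (simp add: c_def blossom_power_0)
        \<comment> \<open>Taylor remainder of the r-th derivative, expanded at \<open>z\<close> and
          evaluated at \<open>x j\<close>. The value \<open>g z\<close>, once re-expanded about
          \<open>x j\<close>, differs from the spline exactly by these remainders.\<close>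
        define e where "e j r = D r (x j) - (\<Sum>q<s - r. D (r + q) z * (x j - z) ^ q / fact q)" for j r
        have recentre: "(\<Sum>p<s. D p z / fact p * c j p z) =
            (\<Sum>r<s. c j r (x j) / fact r * (\<Sum>q<s - r. D (r + q) z * (x j - z) ^ q / fact q))" for j
        proof -
          have "c j p z = (\<Sum>r\<le>p. real (p choose r) * (x j - z) ^ (p - r) * c j r (x j))" if "p < s" for p
            unfolding c_def using blossom_power_shift[of p l "\<lambda>i. t (j + i + 1) - x j" "x j - z"] that assms(2)
            by simp
          then have "(\<Sum>p<s. D p z / fact p * c j p z) =
              (\<Sum>p<s. D p z / fact p * (\<Sum>r\<le>p. real (p choose r) * (x j - z) ^ (p - r) * c j r (x j)))"
            by (intro sum.cong refl) simp
          then show ?thesis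
            unfolding sum_taylor_blossom[where a = "\<lambda>p. D p z" and c = "\<lambda>r. c j r (x j)"] .
        qed
        have "g z = (\<Sum>p<s. D p z / fact p * (\<Sum>j\<le>\<mu>. B j z * c j p z))"
        proof -
          have "(\<Sum>p<s. D p z / fact p * (\<Sum>j\<le>\<mu>. B j z * c j p z)) = (\<Sum>p<s. if p = 0 then D p z else 0)"
            using assms(2) by (intro sum.cong refl) (simp add: rep)
          also have "\<dots> = g z" using s z D0[of z] by simp
          finally show ?thesis ..
        qed
        also have "\<dots> = (\<Sum>j\<le>\<mu>. B j z * (\<Sum>p<s. D p z / fact p * c j p z))"
          unfolding sum_distrib_left by (subst sum.swap) (intro sum.cong refl, simp)
        also have "\<dots> = (\<Sum>j\<le>\<mu>. B j z * (\<Sum>r<s. c j r (x j) / fact r * (\<Sum>q<s - r. D (r + q) z * (x j - z) ^ q / fact q)))"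
          by (simp only: recentre)
        finally have gz: "g z = \<dots>" .
        have sumB: "(\<Sum>j<N + l. \<gamma> j * B j z) = (\<Sum>j\<le>\<mu>. B j z * \<gamma> j)"
          using \<mu> B0 by (intro sum.mono_neutral_cong_right) auto
        have "(\<Sum>j<N + l. \<gamma> j * B j z) - g z = (\<Sum>j\<le>\<mu>. B j z * (\<Sum>r<s. c j r (x j) / fact r * e j r))"
          unfolding sumB gz sum_subtractf[symmetric] right_diff_distrib[symmetric]
          by (intro sum.cong refl) (simp add: \<gamma>_def e_def right_diff_distrib sum_subtractf mult_ac)
        also have "\<bar>\<dots>\<bar> \<le> (\<Sum>j\<le>\<mu>. B j z * (real s * (2 ^ l * M) * \<rho> ^ s))"
        proof (rule order.trans[OF sum_abs], intro sum_mono)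
          fix j assume "j \<in> {..\<mu>}"
          show "\<bar>B j z * (\<Sum>r<s. c j r (x j) / fact r * e j r)\<bar> \<le> B j z * (real s * (2 ^ l * M) * \<rho> ^ s)"
          proof (cases "B j z = 0")
            case False
            have "t (j + l + 1) = t j + \<rho>"
              by (simp add: t_eq \<rho>_def add_divide_distrib[symmetric])
            with B_supp[OF False] have tj: "t j \<le> z" "z < t j + \<rho>" by auto
            have xj: "x j \<in> {0..1}" using tj z by (auto simp: x_def)
            have xz: "\<bar>x j - z\<bar> \<le> \<rho>" using tj z unfolding x_def atLeastLessThan_iff by linarith
            have \<rho>0: "\<rho> \<ge> 0" by (simp add: \<rho>_def)
            have cb: "\<bar>c j r (x j)\<bar> \<le> 2 ^ l * \<rho> ^ r" if "r < s" for r
              unfolding c_def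
            proof (rule blossom_power_bound)
              fix i assume "i < l"
              have "t (j + i + 1) = t j + real (i + 1) / real N"
                by (simp add: t_eq add_divide_distrib[symmetric])
              moreover have "real (i + 1) / real N \<le> \<rho>" "0 \<le> real (i + 1) / real N"
                using \<open>i < l\<close> by (auto simp: \<rho>_def divide_right_mono)
              \<comment> \<open>Needed when \<open>t j\<close> is negative and
                \<open>x j = 0\<close>: then \<open>t j\<close> is at least -\<rho>, so the inner
                knots stay within \<rho> of \<open>x j\<close>.\<close>
              moreover have "t j + \<rho> = real (j + 1) / real N"
                by (simp add: t_eq \<rho>_def add_divide_distrib[symmetric])
              moreover have "real (j + 1) / real N \<ge> 0" by simp
              ultimately show "\<bar>t (j + i + 1) - x j\<bar> \<le> \<rho>"
                unfolding x_def by linarith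
            qed (use that assms(2) in simp)
            have eb: "\<bar>e j r\<bar> \<le> M * \<rho> ^ (s - r)" if "r < s" for r
            proof -
              have "\<bar>e j r\<bar> \<le> M * \<bar>x j - z\<bar> ^ (s - r)"
                unfolding e_def using xj z that D M by (intro taylor_bound_within[of "{0..1}"]) auto
              also have "\<dots> \<le> M * \<rho> ^ (s - r)"
                using xz M0 by (intro mult_left_mono power_mono) auto
              finally show ?thesis .
            qed
            have "\<bar>\<Sum>r<s. c j r (x j) / fact r * e j r\<bar> \<le> (\<Sum>r<s. 2 ^ l * M * \<rho> ^ s)"
            proof (rule order.trans[OF sum_abs], intro sum_mono)
              fix r assume r: "r \<in> {..<s}"
              have \<rho>s: "\<rho> ^ r * \<rho> ^ (s - r) = \<rho> ^ s" using r by (simp add: power_add[symmetric])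
              have "\<bar>c j r (x j) / fact r\<bar> \<le> \<bar>c j r (x j)\<bar>"
                using divide_fact_le[of "\<bar>c j r (x j)\<bar>" r] by simp
              also have "\<dots> \<le> 2 ^ l * \<rho> ^ r" using cb r by simp
              finally have "\<bar>c j r (x j) / fact r * e j r\<bar> \<le> (2 ^ l * \<rho> ^ r) * (M * \<rho> ^ (s - r))"
                unfolding abs_mult using eb[of r] r M0 \<rho>0 by (intro mult_mono) simp_all
              also have "\<dots> = 2 ^ l * M * \<rho> ^ s"
                unfolding \<rho>s[symmetric] by (simp only: ac_simps)
              finally show "\<bar>c j r (x j) / fact r * e j r\<bar> \<le> 2 ^ l * M * \<rho> ^ s" .
            qed
            then show ?thesis
              unfolding abs_mult abs_of_nonneg[OF B_nonneg] by (intro mult_left_mono B_nonneg) (simp add: mult_ac)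
          qed auto
        qed
        also have "\<dots> = K / real N ^ s"
          unfolding sum_distrib_right[symmetric] B_sum by (simp add: K_def \<rho>_def power_divide)
        finally show ?thesis by (simp add: abs_minus_commute)
      qed
      then show ?thesis unfolding B_def t_def by blast
    qed
    moreover have "K \<ge> 0" using M0 by (simp add: K_def)
    ultimately show ?thesis by (intro that[of K])
  qed
qed

section \<open>Orthonormalised B-splines\<close>

text \<open>Gaussian elimination: a nonzero entry of the new row serves as pivot, its column is
  eliminated from the other rows, and the pivot unknown is recovered by back substitution. Index
  sets instead of matrix types allow the dimension to vary with n.\<close>

lemma underdetermined_system_solvable:
  fixes A :: "'a \<Rightarrow> 'b \<Rightarrow> real"
  assumes "finite R" "finite C" "card R < card C"
  shows "\<exists>x. (\<exists>j\<in>C. x j \<noteq> 0) \<and> (\<forall>i\<in>R. (\<Sum>j\<in>C. A i j * x j) = 0)"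
  using assms
proof (induction R arbitrary: A C rule: finite_induct)
  case empty
  then have "C \<noteq> {}" by auto
  then show ?case by (intro exI[of _ "\<lambda>_. 1"]) auto
next
  case (insert r R)
  show ?case
  proof (cases "\<forall>j\<in>C. A r j = 0")
    case True
    have "card R < card C" using insert.prems insert.hyps by simp
    from insert.IH[OF insert.prems(1) this, of A] obtain x where
      "\<exists>j\<in>C. x j \<noteq> 0" "\<forall>i\<in>R. (\<Sum>j\<in>C. A i j * x j) = 0" by blast
    moreover from True have "(\<Sum>j\<in>C. A r j * x j) = 0" by simp
    ultimately show ?thesis by blast
  next
    case False
    then obtain p where p: "p \<in> C" "A r p \<noteq> 0" by blast
    define A' where "A' i j = A i j - A i p / A r p * A r j" for i j
    have "card R < card (C - {p})"
      using insert.prems insert.hyps p by simp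
    with insert.IH[of "C - {p}" A'] insert.prems obtain x where
      x: "\<exists>j\<in>C - {p}. x j \<noteq> 0" "\<And>i. i \<in> R \<Longrightarrow> (\<Sum>j\<in>C - {p}. A' i j * x j) = 0" by auto
    define s where "s = (\<Sum>j\<in>C - {p}. A r j * x j)"
    define y where "y = x(p := - s / A r p)"
    have sum_y: "(\<Sum>j\<in>C. A i j * y j) = A i p * (- s / A r p) + (\<Sum>j\<in>C - {p}. A i j * x j)" for i
      using insert.prems p by (subst sum.remove[of C p]) (auto simp: y_def intro!: sum.cong)
    have "(\<Sum>j\<in>C. A i j * y j) = 0" if "i \<in> insert r R" for i
    proof (cases "i = r")
      case True
      then show ?thesis using p by (simp add: sum_y s_def)
    next
      case False
      then have "(\<Sum>j\<in>C - {p}. A' i j * x j) = 0" using x(2) that by simp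
      moreover have "(\<Sum>j\<in>C - {p}. A' i j * x j) = (\<Sum>j\<in>C - {p}. A i j * x j) - A i p / A r p * s"
        by (simp add: A'_def s_def algebra_simps sum_subtractf sum_distrib_left)
      ultimately show ?thesis by (simp add: sum_y)
    qed
    moreover have "\<exists>j\<in>C. y j \<noteq> 0" using x(1) by (auto simp: y_def)
    ultimately show ?thesis by blast
  qed
qed

text \<open>The l-th unit vector is appended to \<open>G\<close> as an extra column. The k + 1
  columns have a nontrivial relation \<open>x\<close>; applying \<open>A\<close> to it expresses the
  other entries of \<open>x\<close> through \<open>x k\<close>. Hence \<open>x k\<close> is nonzero,
  and dividing by it shows that \<open>G\<close> maps the l-th column of \<open>A\<close> to the
  unit vector.\<close>

lemma right_inverse_imp_left_inverse:
  fixes A G :: "nat \<Rightarrow> nat \<Rightarrow> real"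
  assumes AG: "\<And>i l. i < k \<Longrightarrow> l < k \<Longrightarrow> (\<Sum>j<k. A i j * G j l) = (if i = l then 1 else 0)"
    and il: "i < k" "l < k"
  shows "(\<Sum>j<k. G i j * A j l) = (if i = l then 1 else 0)"
proof -
  have AG': "(\<Sum>p<k. A q p * (\<Sum>j<k. G p j * x j)) = x q" if "q < k" for q x
  proof -
    have "(\<Sum>p<k. A q p * (\<Sum>j<k. G p j * x j)) = (\<Sum>j<k. (\<Sum>p<k. A q p * G p j) * x j)"
      unfolding sum_distrib_left sum_distrib_right by (subst sum.swap) (simp add: mult.assoc)
    also have "\<dots> = (\<Sum>j<k. if q = j then x j else 0)"
      using that by (intro sum.cong refl) (simp add: AG)
    finally show ?thesis using that by simp
  qed
  define M where "M p j = (if j < k then G p j else if p = l then 1 else 0)" for p j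
  obtain x where x: "\<exists>j\<in>{..<Suc k}. x j \<noteq> 0" "\<forall>p\<in>{..<k}. (\<Sum>j<Suc k. M p j * x j) = 0"
    using underdetermined_system_solvable[of "{..<k}" "{..<Suc k}" M] by auto
  have Gx: "(\<Sum>j<k. G p j * x j) = - (if p = l then x k else 0)" if "p < k" for p
    using x(2) that by (auto simp: M_def add_eq_0_iff2)
  have xq: "x q = - A q l * x k" if "q < k" for q
  proof -
    have "x q = (\<Sum>p<k. A q p * (- (if p = l then x k else 0)))"
      by (subst AG'[OF that, of x, symmetric]) (simp add: Gx)
    also have "\<dots> = (\<Sum>p<k. if p = l then - A q l * x k else 0)"
      by (intro sum.cong) auto
    finally show ?thesis using il by simp
  qed
  have "x k \<noteq> 0"
  proof
    assume "x k = 0"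
    then have "x j = 0" if "j < Suc k" for j using xq[of j] that by (cases "j = k") auto
    with x(1) show False by auto
  qed
  moreover have "(\<Sum>j<k. G i j * A j l) * x k = - (\<Sum>j<k. G i j * x j)"
    by (simp add: xq sum_distrib_right sum_negf mult.assoc)
  ultimately show ?thesis using Gx[OF il(1)] by (auto split: if_splits)
qed

text \<open>Each step of the recursion at most doubles the bound. This crude growth is harmless: the
  bound only serves integrability and the finiteness of suprema.\<close>

lemma bspline_le:
  assumes t: "strict_mono t"
  shows "bspline t d j z \<le> 2 ^ d"
proof (induction d arbitrary: j)
  case (Suc d)
  have step: "a * bspline t d i z \<le> 2 ^ d" if "bspline t d i z \<noteq> 0 \<Longrightarrow> a \<le> 1" for a i
  proof (cases "bspline t d i z = 0")
    case False
    then have "a * bspline t d i z \<le> 1 * bspline t d i z"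
      using that bspline_nonneg[OF t, of d i z] by (intro mult_right_mono) auto
    with Suc.IH[of i] show ?thesis by simp
  qed auto
  have *: "t j < t (j + d + 1)" "t (j + 1) < t (j + d + 2)"
    using t by (auto simp: strict_mono_def)
  have "(z - t j) / (t (j + d + 1) - t j) * bspline t d j z \<le> 2 ^ d"
    using bspline_nonzero_imp[OF t, of d j z] * by (intro step) (auto simp: divide_le_eq)
  moreover have "(t (j + d + 2) - z) / (t (j + d + 2) - t (j + 1)) * bspline t d (j + 1) z \<le> 2 ^ d"
    using bspline_nonzero_imp[OF t, of d "j + 1" z] * by (intro step) (auto simp: divide_le_eq)
  ultimately show ?case by simp
qed auto

lemma abs_bspline_le: "strict_mono t \<Longrightarrow> \<bar>bspline t d j z\<bar> \<le> 2 ^ d"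
  using bspline_le[of t d j z] bspline_nonneg[of t d j z] by simp

section \<open>Bounds and span of the orthonormalised family\<close>

lemma orthonormal_bsplines_representation:
  assumes "orthonormal_bsplines l N Q \<beta>"
  obtains A where "\<And>i z. i < N + l \<Longrightarrow> \<beta> i z = (\<Sum>j<N + l. A i j * bspline (spline_knots l N) l j z)"
  using assms unfolding orthonormal_bsplines_def by blast

lemma orthonormal_bsplines_borel:
  assumes "orthonormal_bsplines l N Q \<beta>" "i < N + l"
  shows "\<beta> i \<in> borel_measurable borel"
proof -
  obtain A where "\<And>z. \<beta> i z = (\<Sum>j<N + l. A i j * bspline (spline_knots l N) l j z)"
    using orthonormal_bsplines_representation[OF assms(1)] assms(2) by metis
  then have "\<beta> i = (\<lambda>z. \<Sum>j<N + l. A i j * bspline (spline_knots l N) l j z)" by (rule ext)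
  then show ?thesis by simp
qed

lemma orthonormal_bsplines_bounded:
  assumes "orthonormal_bsplines l N Q \<beta>" "N \<ge> 1"
  obtains K where "\<And>i z. i < N + l \<Longrightarrow> \<bar>\<beta> i z\<bar> \<le> K"
proof -
  obtain A where A: "\<And>i z. i < N + l \<Longrightarrow> \<beta> i z = (\<Sum>j<N + l. A i j * bspline (spline_knots l N) l j z)"
    using orthonormal_bsplines_representation[OF assms(1)] by metis
  have "\<bar>\<beta> i z\<bar> \<le> (\<Sum>i<N + l. \<Sum>j<N + l. \<bar>A i j\<bar> * 2 ^ l)" if i: "i < N + l" for i z
  proof -
    have "\<bar>\<beta> i z\<bar> \<le> (\<Sum>j<N + l. \<bar>A i j * bspline (spline_knots l N) l j z\<bar>)"
      unfolding A[OF i] by (rule sum_abs)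
    also have "\<dots> \<le> (\<Sum>j<N + l. \<bar>A i j\<bar> * 2 ^ l)"
      unfolding abs_mult
      by (intro sum_mono mult_left_mono abs_bspline_le strict_mono_spline_knots assms(2)) auto
    also have "\<dots> \<le> (\<Sum>i<N + l. \<Sum>j<N + l. \<bar>A i j\<bar> * 2 ^ l)"
      using i by (intro member_le_sum) (auto intro!: sum_nonneg)
    finally show ?thesis .
  qed
  then show thesis by (rule that)
qed

text \<open>Approximation is proved with plain B-splines, but the models are spanned by the
  orthonormal family. Orthonormality says that the transformation \<open>A\<close> has the matrix
  \<open>G\<close> of inner products as right inverse; \<open>A\<close> is square, so
  \<open>G\<close> is also a left inverse and recovers the B-splines at every point, not merely
  almost everywhere.\<close>

lemma bspline_in_span_orthonormal:
  assumes "orthonormal_bsplines l N Q \<beta>" "N \<ge> 1" "finite_measure Q" "sets Q = sets borel"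
  shows "\<exists>\<gamma>. \<forall>z. (\<Sum>j<N + l. c j * bspline (spline_knots l N) l j z) = series_fun (N + l) \<beta> \<gamma> z"
proof -
  interpret finite_measure Q by fact
  define k where "k = N + l"
  define B where "B j = bspline (spline_knots l N) l j" for j
  obtain A where A: "\<And>i z. i < k \<Longrightarrow> \<beta> i z = (\<Sum>j<k. A i j * B j z)"
    using orthonormal_bsplines_representation[OF assms(1)] unfolding k_def B_def by metis
  obtain K where K: "\<And>i z. i < k \<Longrightarrow> \<bar>\<beta> i z\<bar> \<le> K"
    using orthonormal_bsplines_bounded[OF assms(1,2)] unfolding k_def by metis
  have [measurable]: "B j \<in> borel_measurable Q" for j
    unfolding B_def measurable_cong_sets[OF assms(4) refl] by simp
  have [measurable]: "\<beta> i \<in> borel_measurable Q" if "i < k" for i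
    unfolding measurable_cong_sets[OF assms(4) refl]
    using orthonormal_bsplines_borel[OF assms(1)] that by (simp add: k_def)
  have int: "integrable Q (\<lambda>z. B j z * \<beta> i z)" if "i < k" for i j
  proof (rule integrable_const_bound[where B = "2 ^ l * K"])
    have "\<bar>B j z\<bar> * \<bar>\<beta> i z\<bar> \<le> 2 ^ l * K" for z
      unfolding B_def
      by (intro mult_mono abs_bspline_le strict_mono_spline_knots assms(2) K[OF that]) auto
    then show "AE z in Q. norm (B j z * \<beta> i z) \<le> 2 ^ l * K" by (simp add: abs_mult)
  qed (use that in measurable)
  define G where "G j i = (\<integral>z. B j z * \<beta> i z \<partial>Q)" for j i
  have AG: "(\<Sum>j<k. A i j * G j p) = (if i = p then 1 else 0)" if "i < k" "p < k" for i p
  proof -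
    have "(\<Sum>j<k. A i j * G j p) = (\<integral>z. (\<Sum>j<k. A i j * (B j z * \<beta> p z)) \<partial>Q)"
      unfolding G_def using int that by (subst Bochner_Integration.integral_sum) auto
    also have "\<dots> = (\<integral>z. \<beta> i z * \<beta> p z \<partial>Q)"
      by (simp add: A[OF that(1)] sum_distrib_right mult.assoc)
    finally show ?thesis using assms(1) that by (simp add: orthonormal_bsplines_def k_def)
  qed
  have B: "B j z = (\<Sum>i<k. G j i * \<beta> i z)" if "j < k" for j z
  proof -
    have "(\<Sum>i<k. G j i * \<beta> i z) = (\<Sum>i<k. \<Sum>p<k. G j i * (A i p * B p z))"
      by (simp add: A sum_distrib_left)
    also have "\<dots> = (\<Sum>p<k. (\<Sum>i<k. G j i * A i p) * B p z)"
      by (subst sum.swap) (simp add: sum_distrib_right mult.assoc)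
    also have "\<dots> = (\<Sum>p<k. if j = p then B p z else 0)"
      using right_inverse_imp_left_inverse[of k A G, OF AG that] by (intro sum.cong) auto
    finally show ?thesis using that by simp
  qed
  have "(\<Sum>j<k. c j * B j z) = series_fun k \<beta> (\<lambda>i. \<Sum>j<k. c j * G j i) z" for z
  proof -
    have "(\<Sum>j<k. c j * B j z) = (\<Sum>j<k. \<Sum>i<k. c j * (G j i * \<beta> i z))"
      by (simp add: B sum_distrib_left)
    then show ?thesis
      unfolding series_fun_def by (subst (asm) sum.swap) (simp add: sum_distrib_left mult_ac)
  qed
  then show ?thesis unfolding k_def B_def by blast
qed

text \<open>\<open>SUP\<close> over the reals is informative only for a set that is bounded above,
  hence the appeal to boundedness of the basis.\<close>

lemma sup_norm_basis_bound:
  assumes "orthonormal_bsplines l N Q \<beta>" "N \<ge> 1" "z \<in> {0..1}"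
  shows "(\<Sum>j<N + l. (\<beta> j z)\<^sup>2) \<le> (sup_norm_basis (N + l) \<beta>)\<^sup>2" and "sup_norm_basis (N + l) \<beta> \<ge> 0"
proof -
  obtain K where K: "\<And>i z. i < N + l \<Longrightarrow> \<bar>\<beta> i z\<bar> \<le> K"
    using orthonormal_bsplines_bounded[OF assms(1,2)] by metis
  have "L2_set (\<lambda>j. \<beta> j z) {..<N + l} \<le> (\<Sum>j<N + l. K)" for z
    using K by (intro order.trans[OF L2_set_le_sum_abs] sum_mono) auto
  then have "bdd_above ((\<lambda>z. L2_set (\<lambda>j. \<beta> j z) {..<N + l}) ` {0..1})"
    by (intro bdd_aboveI2)
  then have *: "L2_set (\<lambda>j. \<beta> j z) {..<N + l} \<le> sup_norm_basis (N + l) \<beta>"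
    unfolding sup_norm_basis_def using assms(3) by (intro cSUP_upper)
  then show "sup_norm_basis (N + l) \<beta> \<ge> 0"
    using L2_set_nonneg[of "\<lambda>j. \<beta> j z" "{..<N + l}"] by linarith
  from * have "(L2_set (\<lambda>j. \<beta> j z) {..<N + l})\<^sup>2 \<le> (sup_norm_basis (N + l) \<beta>)\<^sup>2"
    by (intro power_mono L2_set_nonneg)
  then show "(\<Sum>j<N + l. (\<beta> j z)\<^sup>2) \<le> (sup_norm_basis (N + l) \<beta>)\<^sup>2"
    by (simp add: L2_set_def sum_nonneg)
qed

section \<open>Least squares\<close>

text \<open>One Gram--Schmidt step: both \<open>y\<close> and the new column are projected off the
  old columns, and the residual of \<open>y\<close> is projected off that of the column. The columns
  may be linearly dependent, as happens for singular designs.\<close>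

lemma orthogonal_projection_exists:
  fixes b :: "nat \<Rightarrow> nat \<Rightarrow> real"
  shows "\<exists>\<gamma>. \<forall>j<k. (\<Sum>i<n. (y i - (\<Sum>j<k. b j i * \<gamma> j)) * b j i) = 0"
proof (induction k arbitrary: y)
  case (Suc k)
  obtain \<gamma>y where \<gamma>y: "\<And>j. j < k \<Longrightarrow> (\<Sum>i<n. (y i - (\<Sum>j<k. b j i * \<gamma>y j)) * b j i) = 0"
    using Suc.IH by blast
  obtain \<gamma>b where \<gamma>b: "\<And>j. j < k \<Longrightarrow> (\<Sum>i<n. (b k i - (\<Sum>j<k. b j i * \<gamma>b j)) * b j i) = 0"
    using Suc.IH by blast
  define y' where "y' i = y i - (\<Sum>j<k. b j i * \<gamma>y j)" for i
  define b' where "b' i = b k i - (\<Sum>j<k. b j i * \<gamma>b j)" for i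
  define a where "a = (\<Sum>i<n. y' i * b' i) / (\<Sum>i<n. (b' i)\<^sup>2)"
  define \<gamma> where "\<gamma> = (\<lambda>j. \<gamma>y j - a * \<gamma>b j)(k := a)"
  have res: "y i - (\<Sum>j<Suc k. b j i * \<gamma> j) = y' i - a * b' i" for i
    by (simp add: \<gamma>_def y'_def b'_def right_diff_distrib sum_subtractf sum_distrib_left mult_ac)
  have y'b: "(\<Sum>i<n. y' i * b j i) = 0" and b'b: "(\<Sum>i<n. b' i * b j i) = 0" if "j < k" for j
    using \<gamma>y[OF that] \<gamma>b[OF that] by (simp_all add: y'_def b'_def)
  have orth: "(\<Sum>i<n. (y' i - a * b' i) * b j i) = 0" if "j < k" for j
  proof -
    have "(\<Sum>i<n. (y' i - a * b' i) * b j i) = (\<Sum>i<n. y' i * b j i) - a * (\<Sum>i<n. b' i * b j i)"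
      by (simp add: algebra_simps sum_subtractf sum_distrib_left)
    then show ?thesis using y'b[OF that] b'b[OF that] by simp
  qed
  have ab: "(\<Sum>i<n. (y' i - a * b' i) * b' i) = 0"
  proof (cases "(\<Sum>i<n. (b' i)\<^sup>2) = 0")
    case True
    then have "b' i = 0" if "i < n" for i using that by (subst (asm) sum_nonneg_eq_0_iff) auto
    then show ?thesis by simp
  next
    case False
    have "(\<Sum>i<n. (y' i - a * b' i) * b' i) = (\<Sum>i<n. y' i * b' i) - a * (\<Sum>i<n. (b' i)\<^sup>2)"
      by (simp add: algebra_simps sum_subtractf sum_distrib_left power2_eq_square)
    then show ?thesis using False by (simp add: a_def)
  qed
  have "(\<Sum>i<n. (y' i - a * b' i) * b k i) =
      (\<Sum>i<n. (y' i - a * b' i) * b' i) + (\<Sum>i<n. \<Sum>j<k. (y' i - a * b' i) * (b j i * \<gamma>b j))"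
    unfolding sum.distrib[symmetric] sum_distrib_left[symmetric] distrib_left[symmetric]
    by (simp add: b'_def)
  also have "(\<Sum>i<n. \<Sum>j<k. (y' i - a * b' i) * (b j i * \<gamma>b j)) = (\<Sum>j<k. (\<Sum>i<n. (y' i - a * b' i) * b j i) * \<gamma>b j)"
    by (subst sum.swap) (simp add: sum_distrib_right mult.assoc)
  also have "\<dots> = 0" by (simp add: orth)
  finally have "(\<Sum>i<n. (y' i - a * b' i) * b k i) = 0" by (simp add: ab)
  with orth have "\<forall>j<Suc k. (\<Sum>i<n. (y' i - a * b' i) * b j i) = 0" by (auto simp: less_Suc_eq)
  then show ?case unfolding res[symmetric] by (intro exI[of _ \<gamma>])
qed auto

lemma sum_mult_comb_eq_0:
  fixes u :: "nat \<Rightarrow> real"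
  assumes "\<And>j. j < k \<Longrightarrow> (\<Sum>i<n. u i * b j i) = 0"
  shows "(\<Sum>i<n. u i * (\<Sum>j<k. b j i * \<gamma> j)) = 0"
proof -
  have "(\<Sum>i<n. u i * (\<Sum>j<k. b j i * \<gamma> j)) = (\<Sum>j<k. (\<Sum>i<n. u i * b j i) * \<gamma> j)"
    unfolding sum_distrib_left sum_distrib_right by (subst sum.swap) (simp add: mult.assoc)
  with assms show ?thesis by simp
qed

text \<open>\<open>\<gamma>w\<close> is the coefficient vector of the projection of \<open>w\<close>, and \<open>c\<close> the normalised residual of
  that projection. The last property determines the least squares solution for the response \<open>y\<close>.\<close>

lemma least_squares_weights:
  fixes w :: "nat \<Rightarrow> real" and b :: "nat \<Rightarrow> nat \<Rightarrow> real"
  obtains Q \<gamma>w where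
    "Q = (\<Sum>i<n. (w i - (\<Sum>j<k. b j i * \<gamma>w j))\<^sup>2)"
    "\<forall>\<gamma>. Q \<le> (\<Sum>i<n. (w i - (\<Sum>j<k. b j i * \<gamma> j))\<^sup>2)"
    "Q > 0 \<longrightarrow> (\<exists>c. (\<forall>j<k. (\<Sum>i<n. c i * b j i) = 0) \<and> (\<Sum>i<n. c i * w i) = 1 \<and> (\<Sum>i<n. (c i)\<^sup>2) = 1 / Q \<and>
      (\<forall>y. \<exists>\<gamma>h. \<forall>\<theta> \<gamma>.
        (\<Sum>i<n. (y i - (\<Sum>j<k. b j i * \<gamma>h j) - (\<Sum>i<n. c i * y i) * w i)\<^sup>2) + (\<theta> - (\<Sum>i<n. c i * y i))\<^sup>2 * Q
        \<le> (\<Sum>i<n. (y i - (\<Sum>j<k. b j i * \<gamma> j) - \<theta> * w i)\<^sup>2)))"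
proof -
  define L where "L \<gamma> i = (\<Sum>j<k. b j i * \<gamma> j)" for \<gamma> i
  have L_lin: "L (\<lambda>j. x * \<gamma> j + x' * \<gamma>' j) i = x * L \<gamma> i + x' * L \<gamma>' i" for x x' \<gamma> \<gamma>' i
    by (simp add: L_def distrib_left sum.distrib sum_distrib_left mult_ac)
  obtain \<gamma>w where \<gamma>w: "\<And>j. j < k \<Longrightarrow> (\<Sum>i<n. (w i - L \<gamma>w i) * b j i) = 0"
    using orthogonal_projection_exists[where k = k and n = n and y = w and b = b] unfolding L_def by blast
  define u where "u i = w i - L \<gamma>w i" for i
  define Q where "Q = (\<Sum>i<n. (u i)\<^sup>2)"
  have uL: "(\<Sum>i<n. u i * L \<gamma> i) = 0" for \<gamma>
    unfolding L_def using \<gamma>w by (intro sum_mult_comb_eq_0) (simp add: u_def)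
  have pyth: "(\<Sum>i<n. (t * u i + L \<gamma> i)\<^sup>2) = t\<^sup>2 * Q + (\<Sum>i<n. (L \<gamma> i)\<^sup>2)" for t \<gamma>
  proof -
    have "(\<Sum>i<n. (t * u i + L \<gamma> i)\<^sup>2) = t\<^sup>2 * Q + 2 * t * (\<Sum>i<n. u i * L \<gamma> i) + (\<Sum>i<n. (L \<gamma> i)\<^sup>2)"
      by (simp add: Q_def sum_distrib_left sum.distrib[symmetric] power2_eq_square algebra_simps)
    then show ?thesis by (simp add: uL)
  qed
  have Qmin: "Q \<le> (\<Sum>i<n. (w i - L \<gamma> i)\<^sup>2)" for \<gamma>
  proof -
    have "w i - L \<gamma> i = 1 * u i + L (\<lambda>j. 1 * \<gamma>w j + (-1) * \<gamma> j) i" for i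
      unfolding L_lin by (simp add: u_def)
    then have "(\<Sum>i<n. (w i - L \<gamma> i)\<^sup>2) = 1\<^sup>2 * Q + (\<Sum>i<n. (L (\<lambda>j. 1 * \<gamma>w j + (-1) * \<gamma> j) i)\<^sup>2)"
      by (simp only: pyth)
    then show ?thesis by (simp add: sum_nonneg)
  qed
  have "\<exists>c. (\<forall>j<k. (\<Sum>i<n. c i * b j i) = 0) \<and> (\<Sum>i<n. c i * w i) = 1 \<and> (\<Sum>i<n. (c i)\<^sup>2) = 1 / Q \<and>
      (\<forall>y. \<exists>\<gamma>h. \<forall>\<theta> \<gamma>. (\<Sum>i<n. (y i - L \<gamma>h i - (\<Sum>i<n. c i * y i) * w i)\<^sup>2) + (\<theta> - (\<Sum>i<n. c i * y i))\<^sup>2 * Q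
        \<le> (\<Sum>i<n. (y i - L \<gamma> i - \<theta> * w i)\<^sup>2))" if Q: "Q > 0"
  proof -
    define c where "c i = u i / Q" for i
    have cy: "(\<Sum>i<n. c i * v i) = (\<Sum>i<n. u i * v i) / Q" for v
      by (simp add: c_def sum_divide_distrib)
    have "(\<Sum>i<n. u i * w i) = (\<Sum>i<n. u i * u i) + (\<Sum>i<n. u i * L \<gamma>w i)"
      by (simp add: u_def sum.distrib[symmetric] algebra_simps)
    then have uw: "(\<Sum>i<n. u i * w i) = Q" by (simp add: uL Q_def power2_eq_square)
    have "\<exists>\<gamma>h. \<forall>\<theta> \<gamma>. (\<Sum>i<n. (y i - L \<gamma>h i - (\<Sum>i<n. c i * y i) * w i)\<^sup>2) + (\<theta> - (\<Sum>i<n. c i * y i))\<^sup>2 * Q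
        \<le> (\<Sum>i<n. (y i - L \<gamma> i - \<theta> * w i)\<^sup>2)" for y
    proof -
      define th where "th = (\<Sum>i<n. c i * y i)"
      obtain \<gamma>y where \<gamma>y: "\<And>j. j < k \<Longrightarrow> (\<Sum>i<n. (y i - L \<gamma>y i) * b j i) = 0"
        using orthogonal_projection_exists[where k = k and n = n and y = y and b = b] unfolding L_def by blast
      define \<gamma>h where "\<gamma>h j = 1 * \<gamma>y j + (- th) * \<gamma>w j" for j
      define r where "r i = y i - L \<gamma>h i - th * w i" for i
      have r: "r i = (y i - L \<gamma>y i) - th * u i" for i
        unfolding r_def \<gamma>h_def L_lin by (simp add: u_def algebra_simps)
      have yL: "(\<Sum>i<n. (y i - L \<gamma>y i) * L \<gamma> i) = 0" for \<gamma>
        unfolding L_def[of \<gamma>] using \<gamma>y by (intro sum_mult_comb_eq_0) simp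
      have rL: "(\<Sum>i<n. r i * L \<gamma> i) = 0" for \<gamma>
      proof -
        have "(\<Sum>i<n. r i * L \<gamma> i) = (\<Sum>i<n. (y i - L \<gamma>y i) * L \<gamma> i) - th * (\<Sum>i<n. u i * L \<gamma> i)"
          unfolding r left_diff_distrib sum_subtractf sum_distrib_left by (simp add: mult_ac)
        then show ?thesis by (simp add: yL uL)
      qed
      have ru: "(\<Sum>i<n. r i * u i) = 0"
      proof -
        have "(\<Sum>i<n. r i * u i) = (\<Sum>i<n. u i * y i) - (\<Sum>i<n. u i * L \<gamma>y i) - th * Q"
          unfolding r Q_def left_diff_distrib sum_subtractf sum_distrib_left
          by (simp add: mult_ac power2_eq_square)
        then show ?thesis using Q cy[of y] by (simp add: uL th_def)
      qed
      have "(\<Sum>i<n. (r i)\<^sup>2) + (\<theta> - th)\<^sup>2 * Q \<le> (\<Sum>i<n. (y i - L \<gamma> i - \<theta> * w i)\<^sup>2)" for \<theta> \<gamma>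
      proof -
        \<comment> \<open>Chosen so that passing from the least squares solution to an arbitrary
          pair changes the residual by \<open>v\<close>, a combination of \<open>u\<close> and
          columns, to all of which \<open>r\<close> is orthogonal. The factors 1 give the vector the
          shape of \<open>L_lin\<close>.\<close>
        define \<gamma>' where "\<gamma>' j = 1 * (1 * \<gamma>h j + (-1) * \<gamma> j) + (th - \<theta>) * \<gamma>w j" for j
        define v where "v i = (th - \<theta>) * u i + L \<gamma>' i" for i
        have "y i - L \<gamma> i - \<theta> * w i = r i + v i" for i
          unfolding r_def v_def \<gamma>'_def L_lin by (simp add: u_def algebra_simps)
        then have "(\<Sum>i<n. (y i - L \<gamma> i - \<theta> * w i)\<^sup>2) = (\<Sum>i<n. (r i + v i)\<^sup>2)" by simp
        also have "\<dots> = (\<Sum>i<n. (r i)\<^sup>2) + 2 * ((th - \<theta>) * (\<Sum>i<n. r i * u i) + (\<Sum>i<n. r i * L \<gamma>' i)) + (\<Sum>i<n. (v i)\<^sup>2)"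
          by (simp add: v_def sum_distrib_left sum.distrib[symmetric] power2_eq_square algebra_simps)
        also have "\<dots> = (\<Sum>i<n. (r i)\<^sup>2) + ((th - \<theta>)\<^sup>2 * Q + (\<Sum>i<n. (L \<gamma>' i)\<^sup>2))"
          by (simp add: ru rL v_def pyth)
        finally show ?thesis by (simp add: sum_nonneg power2_commute)
      qed
      then show ?thesis unfolding r_def th_def by blast
    qed
    moreover have "\<forall>j<k. (\<Sum>i<n. c i * b j i) = 0"
      using \<gamma>w by (simp add: cy u_def)
    moreover have "(\<Sum>i<n. c i * w i) = 1" using Q by (simp add: cy uw)
    moreover have "(\<Sum>i<n. (c i)\<^sup>2) = 1 / Q"
    proof -
      have "(\<Sum>i<n. (c i)\<^sup>2) = Q / Q\<^sup>2"
        by (simp add: c_def power_divide sum_divide_distrib[symmetric] Q_def)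
      then show ?thesis by (simp add: power2_eq_square)
    qed
    ultimately show ?thesis by blast
  qed
  with Qmin that[of Q \<gamma>w] show thesis
    unfolding L_def Q_def u_def by blast
qed

text \<open>The columns \<open>b j\<close> are nearly orthonormal and nearly orthogonal to \<open>U\<close>, so the projection of
  \<open>U + r + (span of b)\<close> off the columns has almost the length of \<open>U\<close>.\<close>

lemma residual_norm_lower_bound:
  fixes U r :: "nat \<Rightarrow> real" and b :: "nat \<Rightarrow> nat \<Rightarrow> real"
  assumes n: "n > 0"
    and w: "\<And>i. i < n \<Longrightarrow> w i = U i + r i + (\<Sum>j<k. b j i * \<gamma>0 j)"
    and F: "(\<Sum>j<k. \<Sum>p<k. ((\<Sum>i<n. b j i * b p i) / n - (if j = p then 1 else 0))\<^sup>2) \<le> 1 / 4"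
    and \<kappa>: "\<kappa> > 0"
  shows "(1 - \<kappa>) * ((\<Sum>i<n. (U i)\<^sup>2) / n) - (1 + 1 / \<kappa>) * ((\<Sum>i<n. (r i)\<^sup>2) / n)
      - 4 * (\<Sum>j<k. ((\<Sum>i<n. U i * b j i) / n)\<^sup>2) \<le> (\<Sum>i<n. (w i - (\<Sum>j<k. b j i * \<gamma> j))\<^sup>2) / n"
proof -
  define d where "d j = \<gamma> j - \<gamma>0 j" for j
  define x where "x i = (\<Sum>j<k. b j i * d j)" for i
  define D where "D = (\<Sum>j<k. (d j)\<^sup>2)"
  define E where "E j p = (\<Sum>i<n. b j i * b p i) / n - (if j = p then 1 else 0)" for j p
  define v where "v j = (\<Sum>i<n. U i * b j i) / n" for j
  have D0: "D \<ge> 0" by (simp add: D_def sum_nonneg)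
  have xx: "(\<Sum>i<n. (x i)\<^sup>2) / n = D + (\<Sum>j<k. \<Sum>p<k. d j * d p * E j p)"
  proof -
    have "(\<Sum>i<n. (x i)\<^sup>2) = (\<Sum>i<n. \<Sum>j<k. \<Sum>p<k. d j * d p * (b j i * b p i))"
      by (simp add: x_def power2_eq_square sum_product mult_ac)
    also have "\<dots> = (\<Sum>j<k. \<Sum>p<k. \<Sum>i<n. d j * d p * (b j i * b p i))"
      by (rule trans[OF sum.swap], rule sum.cong[OF refl], rule sum.swap)
    finally have "(\<Sum>i<n. (x i)\<^sup>2) / n = (\<Sum>j<k. \<Sum>p<k. d j * d p * ((\<Sum>i<n. b j i * b p i) / n))"
      by (simp add: sum_divide_distrib sum_distrib_left)
    also have "\<dots> = (\<Sum>j<k. \<Sum>p<k. (if j = p then (d j)\<^sup>2 else 0) + d j * d p * E j p)"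
      by (intro sum.cong refl) (auto simp: E_def algebra_simps power2_eq_square)
    finally show ?thesis by (simp add: sum.distrib D_def)
  qed
  \<comment> \<open>Cauchy--Schwarz over pairs of indices: the Frobenius norm of \<open>E\<close> is
    at most 1/2, hence the quadratic form is at most half of \<open>D\<close>.\<close>
  have "(\<Sum>j<k. \<Sum>p<k. d j * d p * E j p)\<^sup>2 \<le> (D / 2)\<^sup>2"
  proof -
    have "(\<Sum>(j, p)\<in>{..<k} \<times> {..<k}. (d j * d p) * E j p)\<^sup>2 \<le>
        (\<Sum>(j, p)\<in>{..<k} \<times> {..<k}. (d j * d p)\<^sup>2) * (\<Sum>(j, p)\<in>{..<k} \<times> {..<k}. (E j p)\<^sup>2)"
      using Cauchy_Schwarz_ineq_sum[of "\<lambda>(j, p). d j * d p" "\<lambda>(j, p). E j p" "{..<k} \<times> {..<k}"]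
      by (simp add: case_prod_unfold)
    moreover have "(\<Sum>(j, p)\<in>{..<k} \<times> {..<k}. (d j * d p)\<^sup>2) = D * D"
      unfolding D_def sum_product sum.cartesian_product by (simp add: power_mult_distrib)
    moreover have "(\<Sum>(j, p)\<in>{..<k} \<times> {..<k}. (E j p)\<^sup>2) \<le> 1 / 4"
      using F unfolding sum.cartesian_product E_def .
    then have "D * D * (\<Sum>(j, p)\<in>{..<k} \<times> {..<k}. (E j p)\<^sup>2) \<le> D * D * (1 / 4)"
      using D0 by (intro mult_left_mono) auto
    ultimately show ?thesis
      unfolding sum.cartesian_product by (simp add: power2_eq_square)
  qed
  then have "\<bar>\<Sum>j<k. \<Sum>p<k. d j * d p * E j p\<bar> \<le> D / 2"
    using D0 by (simp add: abs_le_square_iff[symmetric])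
  with xx have xD: "D / 2 \<le> (\<Sum>i<n. (x i)\<^sup>2) / n" by linarith
  \<comment> \<open>The weights are balanced so that \<open>D / 4\<close> is absorbed by half of the
    lower bound \<open>D / 2\<close> for the mean square of \<open>x\<close>.\<close>
  have Ux: "2 * ((\<Sum>i<n. U i * x i) / n) \<le> D / 4 + 4 * (\<Sum>j<k. (v j)\<^sup>2)"
  proof -
    have "(\<Sum>i<n. U i * x i) / n = (\<Sum>j<k. v j * d j)"
      unfolding x_def v_def sum_distrib_left sum_divide_distrib sum_distrib_right
      by (subst sum.swap) (simp add: mult_ac)
    then have "2 * ((\<Sum>i<n. U i * x i) / n) = (\<Sum>j<k. 2 * (v j * d j))" by (simp add: sum_distrib_left)
    also have "\<dots> \<le> (\<Sum>j<k. (d j)\<^sup>2 / 4 + 4 * (v j)\<^sup>2)"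
    proof (intro sum_mono)
      fix j
      have "0 \<le> (d j / 2 - 2 * v j)\<^sup>2" by simp
      then show "2 * (v j * d j) \<le> (d j)\<^sup>2 / 4 + 4 * (v j)\<^sup>2"
        by (simp add: power2_eq_square algebra_simps)
    qed
    finally show ?thesis by (simp add: sum.distrib D_def sum_divide_distrib sum_distrib_left)
  qed
  have "(1 - \<kappa>) * (\<Sum>i<n. (U i)\<^sup>2) - (1 + 1 / \<kappa>) * (\<Sum>i<n. (r i)\<^sup>2) - 2 * (\<Sum>i<n. U i * x i) + (\<Sum>i<n. (x i)\<^sup>2) / 2
      \<le> (\<Sum>i<n. (w i - (\<Sum>j<k. b j i * \<gamma> j))\<^sup>2)"
  proof -
    have "(1 - \<kappa>) * (\<Sum>i<n. (U i)\<^sup>2) - (1 + 1 / \<kappa>) * (\<Sum>i<n. (r i)\<^sup>2) - 2 * (\<Sum>i<n. U i * x i) + (\<Sum>i<n. (x i)\<^sup>2) / 2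
      = (\<Sum>i<n. (1 - \<kappa>) * (U i)\<^sup>2 - (1 + 1 / \<kappa>) * (r i)\<^sup>2 - 2 * (U i * x i) + (x i)\<^sup>2 / 2)"
      by (simp add: sum_distrib_left sum_divide_distrib sum_subtractf sum.distrib)
    also have "\<dots> \<le> (\<Sum>i<n. (w i - (\<Sum>j<k. b j i * \<gamma> j))\<^sup>2)"
    proof (intro sum_mono)
      fix i assume "i \<in> {..<n}"
      then have wi: "w i - (\<Sum>j<k. b j i * \<gamma> j) = U i + r i - x i"
        by (simp add: w x_def d_def right_diff_distrib sum_subtractf)
      \<comment> \<open>The two squares absorb the products of \<open>r\<close> with
        \<open>U\<close> and with \<open>x\<close>. The product of \<open>U\<close> and
        \<open>x\<close> is kept, because it is controlled in sum by the near orthogonality of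
        \<open>U\<close> to the columns.\<close>
      have "0 \<le> \<kappa> * (U i + r i / \<kappa>)\<^sup>2 + 2 * (r i - x i / 2)\<^sup>2" using \<kappa> by simp
      moreover have "\<kappa> * (U i + r i / \<kappa>)\<^sup>2 = \<kappa> * (U i)\<^sup>2 + 2 * U i * r i + (r i)\<^sup>2 / \<kappa>"
        using \<kappa> by (simp add: power2_eq_square field_simps)
      ultimately have "(1 - \<kappa>) * (U i)\<^sup>2 - (1 + 1 / \<kappa>) * (r i)\<^sup>2 - 2 * (U i * x i) + (x i)\<^sup>2 / 2 \<le> (U i + r i - x i)\<^sup>2"
        by (simp add: power2_eq_square algebra_simps)
      then show "(1 - \<kappa>) * (U i)\<^sup>2 - (1 + 1 / \<kappa>) * (r i)\<^sup>2 - 2 * (U i * x i) + (x i)\<^sup>2 / 2 \<le>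
          (w i - (\<Sum>j<k. b j i * \<gamma> j))\<^sup>2" by (simp add: wi)
    qed
    finally show ?thesis .
  qed
  from divide_right_mono[OF this, of "real n"] n
  have "(1 - \<kappa>) * ((\<Sum>i<n. (U i)\<^sup>2) / n) - (1 + 1 / \<kappa>) * ((\<Sum>i<n. (r i)\<^sup>2) / n)
      - 2 * ((\<Sum>i<n. U i * x i) / n) + ((\<Sum>i<n. (x i)\<^sup>2) / n) / 2
      \<le> (\<Sum>i<n. (w i - (\<Sum>j<k. b j i * \<gamma> j))\<^sup>2) / n"
    by (simp add: diff_divide_distrib add_divide_distrib)
  moreover have "D' / 2 \<le> x' \<Longrightarrow> 2 * u' \<le> D' / 4 + 4 * v' \<Longrightarrow> A - B - 2 * u' + x' / 2 \<le> X \<Longrightarrow> A - B - 4 * v' \<le> X"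
    for A B D' u' v' x' X :: real by linarith
  ultimately show ?thesis using xD Ux unfolding v_def by blast
qed

lemma residual_norm_upper_bound:
  fixes U r :: "nat \<Rightarrow> real"
  assumes "\<kappa> > 0"
  shows "(\<Sum>i<n. (U i + r i)\<^sup>2) / n \<le>
    (1 + \<kappa>) * ((\<Sum>i<n. (U i)\<^sup>2) / n) + (1 + 1 / \<kappa>) * ((\<Sum>i<n. (r i)\<^sup>2) / n)"
proof -
  have "(\<Sum>i<n. (U i + r i)\<^sup>2) \<le> (\<Sum>i<n. (1 + \<kappa>) * (U i)\<^sup>2 + (1 + 1 / \<kappa>) * (r i)\<^sup>2)"
  proof (intro sum_mono)
    fix i
    have "0 \<le> \<kappa> * (U i - r i / \<kappa>)\<^sup>2" using assms by simp
    also have "\<dots> = \<kappa> * (U i)\<^sup>2 - 2 * U i * r i + (r i)\<^sup>2 / \<kappa>"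
      using assms by (simp add: power2_eq_square field_simps)
    finally show "(U i + r i)\<^sup>2 \<le> (1 + \<kappa>) * (U i)\<^sup>2 + (1 + 1 / \<kappa>) * (r i)\<^sup>2"
      by (simp add: power2_eq_square algebra_simps)
  qed
  from divide_right_mono[OF this, of "real n"] show ?thesis
    by (simp add: sum.distrib sum_distrib_left add_divide_distrib)
qed

section \<open>The sample as a function of the design and the noise\<close>

definition design_law :: "(real \<times> real \<Rightarrow> real) \<Rightarrow> (real \<times> real) measure" where
  "design_law f = density lborel (\<lambda>u. ennreal (f u))"

definition noise_law :: "real \<Rightarrow> real measure" where
  "noise_law \<sigma> = density lborel (\<lambda>e. ennreal (normal_density 0 \<sigma> e))"

definition observe :: "real \<Rightarrow> (real \<Rightarrow> real) \<Rightarrow> real \<times> real \<Rightarrow> real \<Rightarrow> obs" where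
  "observe \<theta> \<eta> u e = (fst u, \<eta> (snd u) + \<theta> * fst u + e, snd u)"

lemma sets_design_law [simp, measurable_cong]: "sets (design_law f) = sets borel"
  by (simp add: design_law_def)

lemma sets_noise_law [simp, measurable_cong]: "sets (noise_law \<sigma>) = sets borel"
  by (simp add: noise_law_def)

lemma sets_plm_law [simp, measurable_cong]: "sets (plm_law \<sigma> f \<theta> \<eta>) = sets borel"
  by (simp add: plm_law_def)

lemma space_design_law [simp]: "space (design_law f) = UNIV"
  by (simp add: design_law_def)

lemma space_noise_law [simp]: "space (noise_law \<sigma>) = UNIV"
  by (simp add: noise_law_def)

lemma prob_space_design_law:
  assumes "joint_density f"
  shows "prob_space (design_law f)"
proof (rule prob_spaceI)
  have [measurable]: "f \<in> borel_measurable borel" using assms by (simp add: joint_density_def)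
  show "emeasure (design_law f) (space (design_law f)) = 1"
    using assms unfolding design_law_def joint_density_def by (simp add: emeasure_density)
qed

lemma prob_space_noise_law: "\<sigma> > 0 \<Longrightarrow> prob_space (noise_law \<sigma>)"
  unfolding noise_law_def by (rule prob_space_normal_density)

lemma observe_measurable:
  assumes [measurable]: "\<eta> \<in> borel_measurable borel"
  shows "(\<lambda>(u, e). observe \<theta> \<eta> u e) \<in> borel_measurable borel"
  unfolding observe_def borel_prod[symmetric] by measurable

lemma sets_design_noise: "sets (design_law f \<Otimes>\<^sub>M noise_law \<sigma>) = sets borel"
  unfolding sets_pair_measure_cong[OF sets_design_law sets_noise_law] borel_prod ..

lemma observe_measurable_design_noise:
  assumes "\<eta> \<in> borel_measurable borel" "sets M = sets borel"
  shows "(\<lambda>(u, e). observe \<theta> \<eta> u e) \<in> (design_law f \<Otimes>\<^sub>M noise_law \<sigma>) \<rightarrow>\<^sub>M M"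
  unfolding measurable_cong_sets[OF sets_design_noise assms(2)] by (rule observe_measurable[OF assms(1)])

lemma plm_law_cong:
  assumes "joint_density f" "\<And>z. z \<in> {0..1} \<Longrightarrow> \<eta> z = \<eta>' z"
  shows "plm_law \<sigma> f \<theta> \<eta> = plm_law \<sigma> f \<theta> \<eta>'"
proof -
  have "plm_density \<sigma> f \<theta> \<eta> x = plm_density \<sigma> f \<theta> \<eta>' x" for x
    using assms by (cases "Z_of x \<in> {0..1}") (auto simp: plm_density_def joint_density_def)
  then show ?thesis by (simp add: plm_law_def)
qed

text \<open>For fixed (w, z) the translation y = \<eta>(z) + \<theta> w + e carries the conditional
  density of Y to that of the noise. As y stands between w and z in an observation, Tonelli's
  theorem must exchange y and z beforehand.\<close>

lemma plm_law_eq_distr: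
  assumes f: "joint_density f" and \<sigma>: "\<sigma> > 0" and [measurable]: "\<eta> \<in> borel_measurable borel"
  shows "plm_law \<sigma> f \<theta> \<eta> = distr (design_law f \<Otimes>\<^sub>M noise_law \<sigma>) borel (\<lambda>(u, e). observe \<theta> \<eta> u e)"
proof (rule measure_eqI)
  fix A :: "obs set" assume "A \<in> sets (plm_law \<sigma> f \<theta> \<eta>)"
  then have A': "A \<in> sets borel" by simp
  then have A[measurable]: "A \<in> sets (borel \<Otimes>\<^sub>M (borel \<Otimes>\<^sub>M borel))" unfolding borel_prod .
  have f_borel: "f \<in> borel_measurable borel" using f by (simp add: joint_density_def)
  then have [measurable]: "f \<in> borel_measurable (borel \<Otimes>\<^sub>M borel)" by (simp add: borel_prod)
  have f0: "f u \<ge> 0" for u using f unfolding joint_density_def by blast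
  interpret noise: prob_space "noise_law \<sigma>" by (rule prob_space_noise_law[OF \<sigma>])
  define g where "g w y z = ennreal (normal_density (\<eta> z + \<theta> * w) \<sigma> y * f (w, z)) * indicator A (w, y, z)" for w y z
  have dens: "(\<lambda>x. ennreal (plm_density \<sigma> f \<theta> \<eta> x)) \<in> borel_measurable borel"
  proof -
    have "(\<lambda>(w, y, z). ennreal (normal_density (\<eta> z + \<theta> * w) \<sigma> y * f (w, z))) \<in> borel_measurable (lborel \<Otimes>\<^sub>M (lborel \<Otimes>\<^sub>M lborel))"
      unfolding normal_density_def by measurable
    then show ?thesis unfolding lborel_prod by (simp add: plm_density_def case_prod_unfold)
  qed
  have g_meas[measurable]: "(\<lambda>(w, y, z). g w y z) \<in> borel_measurable (lborel \<Otimes>\<^sub>M (lborel \<Otimes>\<^sub>M lborel))"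
    unfolding g_def normal_density_def by measurable
  have obs[measurable]: "(\<lambda>(u, e). observe \<theta> \<eta> u e) \<in> (design_law f \<Otimes>\<^sub>M noise_law \<sigma>) \<rightarrow>\<^sub>M borel"
    by (rule observe_measurable_design_noise) (fact, simp)
  have ind: "(\<lambda>(u, e). indicator A (observe \<theta> \<eta> u e) :: ennreal) \<in> borel_measurable (borel \<Otimes>\<^sub>M borel)"
    unfolding borel_prod case_prod_unfold
    using observe_measurable[of \<eta> \<theta>] A' unfolding case_prod_unfold by measurable
  have ind': "(\<lambda>(u, e). indicator A (observe \<theta> \<eta> u e) :: ennreal) \<in> borel_measurable (borel \<Otimes>\<^sub>M noise_law \<sigma>)"
    unfolding measurable_cong_sets[OF sets_pair_measure_cong[OF refl sets_noise_law] refl] by (rule ind)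
  have ind_u: "(\<lambda>u. \<integral>\<^sup>+ e. indicator A (observe \<theta> \<eta> u e) \<partial>noise_law \<sigma>) \<in> borel_measurable borel"
    using noise.borel_measurable_nn_integral_fst[OF ind'] by simp
  have shift: "(\<integral>\<^sup>+ y. g w y z \<partial>lborel) =
      ennreal (f (w, z)) * (\<integral>\<^sup>+ e. indicator A (observe \<theta> \<eta> (w, z) e) \<partial>noise_law \<sigma>)" for w z
  proof -
    have [measurable]: "(\<lambda>e. indicator A (observe \<theta> \<eta> (w, z) e) :: ennreal) \<in> borel_measurable borel"
      using measurable_compose[OF measurable_Pair1'[of "(w, z)" borel borel] ind] by simp
    have nd: "normal_density (\<eta> z + \<theta> * w) \<sigma> (\<eta> z + \<theta> * w + e) = normal_density 0 \<sigma> e" for e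
      by (simp add: normal_density_def)
    have "(\<integral>\<^sup>+ y. g w y z \<partial>lborel) = (\<integral>\<^sup>+ e. g w (\<eta> z + \<theta> * w + 1 * e) z \<partial>lborel)"
      by (subst nn_integral_real_affine[where c = 1 and t = "\<eta> z + \<theta> * w"]) (auto simp: g_def)
    also have "\<dots> = (\<integral>\<^sup>+ e. ennreal (f (w, z)) * (ennreal (normal_density 0 \<sigma> e) * indicator A (observe \<theta> \<eta> (w, z) e)) \<partial>lborel)"
      by (intro nn_integral_cong)
         (simp add: g_def observe_def nd ennreal_mult f0 mult_ac)
    also have "\<dots> = ennreal (f (w, z)) * (\<integral>\<^sup>+ e. indicator A (observe \<theta> \<eta> (w, z) e) \<partial>noise_law \<sigma>)"
      unfolding noise_law_def by (subst nn_integral_density) (auto simp: nn_integral_cmult)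
    finally show ?thesis .
  qed
  have "emeasure (plm_law \<sigma> f \<theta> \<eta>) A = (\<integral>\<^sup>+ x. (case x of (w, y, z) \<Rightarrow> g w y z) \<partial>lborel)"
    unfolding plm_law_def using dens A'
    by (simp add: emeasure_density g_def plm_density_def case_prod_unfold)
  also have "\<dots> = (\<integral>\<^sup>+ w. (\<integral>\<^sup>+ y. (\<integral>\<^sup>+ z. g w y z \<partial>lborel) \<partial>lborel) \<partial>lborel)"
    unfolding lborel_prod[symmetric]
    by (simp add: lborel.nn_integral_fst[symmetric] lborel_pair.nn_integral_fst[symmetric] lborel_prod[symmetric])
  also have "\<dots> = (\<integral>\<^sup>+ w. (\<integral>\<^sup>+ z. (\<integral>\<^sup>+ y. g w y z \<partial>lborel) \<partial>lborel) \<partial>lborel)"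
    by (intro nn_integral_cong lborel_pair.Fubini') simp
  also have "\<dots> = (\<integral>\<^sup>+ w. (\<integral>\<^sup>+ z. ennreal (f (w, z)) * (\<integral>\<^sup>+ e. indicator A (observe \<theta> \<eta> (w, z) e) \<partial>noise_law \<sigma>) \<partial>lborel) \<partial>lborel)"
    by (simp add: shift)
  also have "\<dots> = (\<integral>\<^sup>+ u. ennreal (f u) * (\<integral>\<^sup>+ e. indicator A (observe \<theta> \<eta> u e) \<partial>noise_law \<sigma>) \<partial>(lborel \<Otimes>\<^sub>M lborel))"
    using ind_u f_borel by (subst lborel.nn_integral_fst[symmetric]) (auto simp: lborel_prod)
  also have "\<dots> = (\<integral>\<^sup>+ u. (\<integral>\<^sup>+ e. indicator A (observe \<theta> \<eta> u e) \<partial>noise_law \<sigma>) \<partial>design_law f)"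
    unfolding design_law_def lborel_prod using f_borel
    by (subst nn_integral_density) (use ind_u in auto)
  also have "\<dots> = (\<integral>\<^sup>+ x. indicator A (case x of (u, e) \<Rightarrow> observe \<theta> \<eta> u e) \<partial>(design_law f \<Otimes>\<^sub>M noise_law \<sigma>))"
    using A' by (subst noise.nn_integral_fst[symmetric]) auto
  also have "\<dots> = emeasure (distr (design_law f \<Otimes>\<^sub>M noise_law \<sigma>) borel (\<lambda>(u, e). observe \<theta> \<eta> u e)) A"
    using A' by (subst nn_integral_distr[symmetric, where f = "indicator A" and T = "\<lambda>(u, e). observe \<theta> \<eta> u e" and M' = borel]) auto
  finally show "emeasure (plm_law \<sigma> f \<theta> \<eta>) A =
      emeasure (distr (design_law f \<Otimes>\<^sub>M noise_law \<sigma>) borel (\<lambda>(u, e). observe \<theta> \<eta> u e)) A" .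
qed simp

lemma prob_space_plm_law:
  assumes "joint_density f" "\<sigma> > 0" "\<eta> \<in> borel_measurable borel"
  shows "prob_space (plm_law \<sigma> f \<theta> \<eta>)"
proof -
  interpret design: prob_space "design_law f" by (rule prob_space_design_law[OF assms(1)])
  interpret noise: prob_space "noise_law \<sigma>" by (rule prob_space_noise_law[OF assms(2)])
  interpret pair_prob_space "design_law f" "noise_law \<sigma>" ..
  show ?thesis unfolding plm_law_eq_distr[OF assms]
    by (rule prob_space_distr) (rule observe_measurable_design_noise[OF assms(3) refl])
qed

lemma observe_sample_measurable:
  fixes n :: nat
  assumes \<eta>: "\<eta> \<in> borel_measurable borel"
  shows "(\<lambda>(u, e). \<lambda>i\<in>{..<n}. observe \<theta> \<eta> (u i) (e i)) \<in>
    (PiM {..<n} (\<lambda>_. design_law f) \<Otimes>\<^sub>M PiM {..<n} (\<lambda>_. noise_law \<sigma>)) \<rightarrow>\<^sub>M PiM {..<n} (\<lambda>_. plm_law \<sigma> f \<theta> \<eta>)"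
  unfolding case_prod_unfold
proof (rule measurable_restrict)
  fix i assume i: "i \<in> {..<n}"
  have "(\<lambda>x. (fst x i, snd x i)) \<in> (PiM {..<n} (\<lambda>_. design_law f) \<Otimes>\<^sub>M PiM {..<n} (\<lambda>_. noise_law \<sigma>)) \<rightarrow>\<^sub>M (design_law f \<Otimes>\<^sub>M noise_law \<sigma>)"
    using i by measurable
  from measurable_compose[OF this observe_measurable_design_noise[OF \<eta> sets_plm_law]]
  show "(\<lambda>x. observe \<theta> \<eta> (fst x i) (snd x i)) \<in> (PiM {..<n} (\<lambda>_. design_law f) \<Otimes>\<^sub>M PiM {..<n} (\<lambda>_. noise_law \<sigma>)) \<rightarrow>\<^sub>M plm_law \<sigma> f \<theta> \<eta>"
    by simp
qed

text \<open>Collects all design points in one factor and all noise variables in the other, so that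
  Fubini's theorem conditions on the whole design. On a rectangle both sides factor over the
  observations, which reduces the claim to a single one.\<close>

lemma PiM_plm_law_eq_distr:
  fixes n :: nat
  assumes f: "joint_density f" and \<sigma>: "\<sigma> > 0" and \<eta>: "\<eta> \<in> borel_measurable borel"
  shows "PiM {..<n} (\<lambda>_. plm_law \<sigma> f \<theta> \<eta>) =
    distr (PiM {..<n} (\<lambda>_. design_law f) \<Otimes>\<^sub>M PiM {..<n} (\<lambda>_. noise_law \<sigma>)) (PiM {..<n} (\<lambda>_. plm_law \<sigma> f \<theta> \<eta>))
      (\<lambda>(u, e). \<lambda>i\<in>{..<n}. observe \<theta> \<eta> (u i) (e i))"
proof -
  interpret design: prob_space "design_law f" by (rule prob_space_design_law[OF f])
  interpret noise: prob_space "noise_law \<sigma>" by (rule prob_space_noise_law[OF \<sigma>])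
  interpret plm: prob_space "plm_law \<sigma> f \<theta> \<eta>" by (rule prob_space_plm_law[OF f \<sigma> \<eta>])
  interpret D: product_prob_space "\<lambda>_. design_law f" "{..<n}" ..
  interpret E: product_prob_space "\<lambda>_. noise_law \<sigma>" "{..<n}" ..
  interpret L: product_prob_space "\<lambda>_. plm_law \<sigma> f \<theta> \<eta>" "{..<n}" ..
  have sigma_E: "sigma_finite_measure (PiM {..<n} (\<lambda>_. noise_law \<sigma>))"
    by (intro prob_space_imp_sigma_finite prob_space_PiM prob_space_noise_law \<sigma>)
  let ?h = "\<lambda>(u, e). \<lambda>i\<in>{..<n}. observe \<theta> \<eta> (u i) (e i)"
  have obs: "(\<lambda>(u, e). observe \<theta> \<eta> u e) \<in> (design_law f \<Otimes>\<^sub>M noise_law \<sigma>) \<rightarrow>\<^sub>M plm_law \<sigma> f \<theta> \<eta>"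
    by (rule observe_measurable_design_noise[OF \<eta>]) simp
  note h[measurable] = observe_sample_measurable[OF \<eta>, where n = n and \<theta> = \<theta> and f = f and \<sigma> = \<sigma>]
  have "distr (PiM {..<n} (\<lambda>_. design_law f) \<Otimes>\<^sub>M PiM {..<n} (\<lambda>_. noise_law \<sigma>)) (PiM {..<n} (\<lambda>_. plm_law \<sigma> f \<theta> \<eta>)) ?h
      = PiM {..<n} (\<lambda>_. plm_law \<sigma> f \<theta> \<eta>)"
  proof (rule L.PiM_eqI)
    fix A assume A: "\<And>i. i \<in> {..<n} \<Longrightarrow> A i \<in> sets (plm_law \<sigma> f \<theta> \<eta>)"
    have ind: "(\<lambda>(u, e). indicator (A i) (observe \<theta> \<eta> u e) :: ennreal) \<in> borel_measurable (design_law f \<Otimes>\<^sub>M noise_law \<sigma>)"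
      if "i < n" for i
      using measurable_compose[OF obs, of "indicator (A i)" borel] A[of i] that
      by (simp add: case_prod_unfold)
    have ind_e: "(\<lambda>e. indicator (A i) (observe \<theta> \<eta> u e) :: ennreal) \<in> borel_measurable (noise_law \<sigma>)" if "i < n" for i u
      using measurable_compose[OF measurable_Pair1'[of u "design_law f" "noise_law \<sigma>"] ind[OF that]] by simp
    have ind_u: "(\<lambda>u. \<integral>\<^sup>+ e. indicator (A i) (observe \<theta> \<eta> u e) \<partial>noise_law \<sigma>) \<in> borel_measurable (design_law f)" if "i < n" for i
      using noise.borel_measurable_nn_integral_fst[OF ind[OF that]] by simp
    have PA: "Pi\<^sub>E {..<n} A \<in> sets (PiM {..<n} (\<lambda>_. plm_law \<sigma> f \<theta> \<eta>))"
      using A by (intro sets_PiM_I_finite) auto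
    have ind_PiE: "indicator (Pi\<^sub>E {..<n} A) (?h (u, e)) = (\<Prod>i<n. indicator (A i) (observe \<theta> \<eta> (u i) (e i)) :: ennreal)" for u e
      by (auto simp: indicator_def PiE_iff prod_eq_1_iff intro!: prod_zero[symmetric])
    have "emeasure (distr (PiM {..<n} (\<lambda>_. design_law f) \<Otimes>\<^sub>M PiM {..<n} (\<lambda>_. noise_law \<sigma>)) (PiM {..<n} (\<lambda>_. plm_law \<sigma> f \<theta> \<eta>)) ?h) (Pi\<^sub>E {..<n} A)
       = (\<integral>\<^sup>+ x. indicator (Pi\<^sub>E {..<n} A) (?h x) \<partial>(PiM {..<n} (\<lambda>_. design_law f) \<Otimes>\<^sub>M PiM {..<n} (\<lambda>_. noise_law \<sigma>)))"
      using PA by (subst nn_integral_distr[symmetric, where f = "indicator (Pi\<^sub>E {..<n} A)" and T = ?h and M' = "PiM {..<n} (\<lambda>_. plm_law \<sigma> f \<theta> \<eta>)"]) auto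
    also have "\<dots> = (\<integral>\<^sup>+ u. (\<integral>\<^sup>+ e. indicator (Pi\<^sub>E {..<n} A) (?h (u, e)) \<partial>PiM {..<n} (\<lambda>_. noise_law \<sigma>)) \<partial>PiM {..<n} (\<lambda>_. design_law f))"
      using PA by (subst sigma_finite_measure.nn_integral_fst[OF sigma_E, symmetric]) auto
    also have "\<dots> = (\<integral>\<^sup>+ u. (\<Prod>i<n. \<integral>\<^sup>+ e. indicator (A i) (observe \<theta> \<eta> (u i) e) \<partial>noise_law \<sigma>) \<partial>PiM {..<n} (\<lambda>_. design_law f))"
      unfolding ind_PiE using ind_e
      by (intro nn_integral_cong E.product_nn_integral_prod) auto
    also have "\<dots> = (\<Prod>i<n. \<integral>\<^sup>+ u. (\<integral>\<^sup>+ e. indicator (A i) (observe \<theta> \<eta> u e) \<partial>noise_law \<sigma>) \<partial>design_law f)"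
      using ind_u by (intro D.product_nn_integral_prod) auto
    also have "\<dots> = (\<Prod>i<n. emeasure (plm_law \<sigma> f \<theta> \<eta>) (A i))"
    proof (intro prod.cong refl)
      fix i assume i: "i \<in> {..<n}"
      have "(\<integral>\<^sup>+ u. (\<integral>\<^sup>+ e. indicator (A i) (observe \<theta> \<eta> u e) \<partial>noise_law \<sigma>) \<partial>design_law f)
          = (\<integral>\<^sup>+ x. indicator (A i) (case x of (u, e) \<Rightarrow> observe \<theta> \<eta> u e) \<partial>(design_law f \<Otimes>\<^sub>M noise_law \<sigma>))"
        using ind[of i] i by (subst noise.nn_integral_fst[symmetric]) (auto simp: case_prod_unfold)
      also have "\<dots> = emeasure (distr (design_law f \<Otimes>\<^sub>M noise_law \<sigma>) borel (\<lambda>(u, e). observe \<theta> \<eta> u e)) (A i)"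
        using A[OF i] observe_measurable_design_noise[OF \<eta> refl] by (subst nn_integral_distr[symmetric, where f = "indicator (A i)" and T = "\<lambda>(u, e). observe \<theta> \<eta> u e" and M' = borel]) auto
      finally show "(\<integral>\<^sup>+ u. (\<integral>\<^sup>+ e. indicator (A i) (observe \<theta> \<eta> u e) \<partial>noise_law \<sigma>) \<partial>design_law f) = emeasure (plm_law \<sigma> f \<theta> \<eta>) (A i)"
        unfolding plm_law_eq_distr[OF assms] .
    qed
    finally show "emeasure (distr (PiM {..<n} (\<lambda>_. design_law f) \<Otimes>\<^sub>M PiM {..<n} (\<lambda>_. noise_law \<sigma>)) (PiM {..<n} (\<lambda>_. plm_law \<sigma> f \<theta> \<eta>)) ?h) (Pi\<^sub>E {..<n} A)
       = (\<Prod>i<n. emeasure (plm_law \<sigma> f \<theta> \<eta>) (A i))" .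
  qed auto
  then show ?thesis by simp
qed

section \<open>Means of independent variables\<close>

lemma PiM_component_integral:
  fixes g :: "'a \<Rightarrow> real" and i n :: nat
  assumes M: "prob_space M" and "i < n" and [measurable]: "g \<in> borel_measurable M"
  shows "integrable (PiM {..<n} (\<lambda>_. M)) (\<lambda>x. g (x i)) \<longleftrightarrow> integrable M g"
    and "(\<integral>x. g (x i) \<partial>PiM {..<n} (\<lambda>_. M)) = (\<integral>x. g x \<partial>M)"
proof -
  have i: "i \<in> {..<n}" using assms by simp
  have d: "distr (PiM {..<n} (\<lambda>_. M)) M (\<lambda>\<omega>. \<omega> i) = M"
    using distr_PiM_component[of "{..<n}" "\<lambda>_. M" i] M i by simp
  have [measurable]: "(\<lambda>\<omega>. \<omega> i) \<in> PiM {..<n} (\<lambda>_. M) \<rightarrow>\<^sub>M M" using i by simp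
  have "integrable (distr (PiM {..<n} (\<lambda>_. M)) M (\<lambda>\<omega>. \<omega> i)) g \<longleftrightarrow> integrable (PiM {..<n} (\<lambda>_. M)) (\<lambda>x. g (x i))"
    by (rule integrable_distr_eq) measurable
  then show "integrable (PiM {..<n} (\<lambda>_. M)) (\<lambda>x. g (x i)) \<longleftrightarrow> integrable M g" by (simp add: d)
  have "(\<integral>x. g x \<partial>distr (PiM {..<n} (\<lambda>_. M)) M (\<lambda>\<omega>. \<omega> i)) = (\<integral>x. g (x i) \<partial>PiM {..<n} (\<lambda>_. M))"
    by (rule integral_distr) measurable
  then show "(\<integral>x. g (x i) \<partial>PiM {..<n} (\<lambda>_. M)) = (\<integral>x. g x \<partial>M)" by (simp add: d)
qed

lemma PiM_pair_integral:
  fixes g h :: "'a \<Rightarrow> real" and i j n :: nat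
  assumes M: "prob_space M" and ij: "i < n" "j < n" "i \<noteq> j" and g: "integrable M g" and h: "integrable M h"
  shows "integrable (PiM {..<n} (\<lambda>_. M)) (\<lambda>x. g (x i) * h (x j))"
    and "(\<integral>x. g (x i) * h (x j) \<partial>PiM {..<n} (\<lambda>_. M)) = (\<integral>x. g x \<partial>M) * (\<integral>x. h x \<partial>M)"
proof -
  interpret M: prob_space M by fact
  interpret P: product_sigma_finite "\<lambda>_. M" ..
  define F where "F l = (if l = i then g else if l = j then h else (\<lambda>_. 1))" for l
  have pick: "(\<Prod>l<n. G l) = G i * G j" if "\<And>l. l \<noteq> i \<Longrightarrow> l \<noteq> j \<Longrightarrow> G l = 1" for G :: "nat \<Rightarrow> real"
  proof -
    have "(\<Prod>l<n. G l) = (\<Prod>l\<in>{i, j}. G l)"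
      using ij that by (intro prod.mono_neutral_right) auto
    then show ?thesis using ij by simp
  qed
  have int: "integrable M (F l)" for l using g h by (simp add: F_def)
  have *: "(\<Prod>l<n. F l (x l)) = g (x i) * h (x j)" for x
    using ij by (subst pick) (auto simp: F_def)
  show "integrable (PiM {..<n} (\<lambda>_. M)) (\<lambda>x. g (x i) * h (x j))"
    using P.product_integrable_prod[of "{..<n}" F] int by (simp add: *)
  have "(\<integral>x. g (x i) * h (x j) \<partial>PiM {..<n} (\<lambda>_. M)) = (\<Prod>l<n. integral\<^sup>L M (F l))"
    using P.product_integral_prod[of "{..<n}" F] int by (simp add: *)
  also have "\<dots> = integral\<^sup>L M (F i) * integral\<^sup>L M (F j)"
    by (rule pick) (simp add: F_def M.prob_space)
  finally show "(\<integral>x. g (x i) * h (x j) \<partial>PiM {..<n} (\<lambda>_. M)) = (\<integral>x. g x \<partial>M) * (\<integral>x. h x \<partial>M)"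
    using ij by (simp add: F_def)
qed

text \<open>Off-diagonal products vanish by independence and centring. The function may vary with
  the index because the noise is combined with unequal weights.\<close>

lemma PiM_centred_sum_square:
  fixes g :: "nat \<Rightarrow> 'a \<Rightarrow> real"
  assumes M: "prob_space M" and [measurable]: "\<And>i. i < n \<Longrightarrow> g i \<in> borel_measurable M"
    and sq: "\<And>i. i < n \<Longrightarrow> integrable M (\<lambda>x. (g i x)\<^sup>2)" and mean: "\<And>i. i < n \<Longrightarrow> (\<integral>x. g i x \<partial>M) = 0"
  shows "integrable (PiM {..<n} (\<lambda>_. M)) (\<lambda>x. (\<Sum>i<n. g i (x i))\<^sup>2)"
    and "(\<integral>x. (\<Sum>i<n. g i (x i))\<^sup>2 \<partial>PiM {..<n} (\<lambda>_. M)) = (\<Sum>i<n. \<integral>x. (g i x)\<^sup>2 \<partial>M)"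
proof -
  interpret M: prob_space M by fact
  have int: "integrable M (g i)" if "i < n" for i
    using M.square_integrable_imp_integrable[OF _ sq[OF that]] that by simp
  have sum_sq: "(\<Sum>i<n. g i (x i))\<^sup>2 = (\<Sum>i<n. \<Sum>j<n. g i (x i) * g j (x j))" for x
    by (simp add: power2_eq_square sum_product)
  have *: "integrable (PiM {..<n} (\<lambda>_. M)) (\<lambda>x. g i (x i) * g j (x j)) \<and>
      (\<integral>x. g i (x i) * g j (x j) \<partial>PiM {..<n} (\<lambda>_. M)) = (if i = j then \<integral>x. (g i x)\<^sup>2 \<partial>M else 0)"
    if "i < n" "j < n" for i j
  proof (cases "i = j")
    case True
    then show ?thesis
      using PiM_component_integral[OF M that(1), of "\<lambda>x. (g i x)\<^sup>2"] sq[OF that(1)] that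
      by (simp add: power2_eq_square)
  next
    case False
    then show ?thesis
      using PiM_pair_integral[OF M that False int[OF that(1)] int[OF that(2)]] mean that by simp
  qed
  show "integrable (PiM {..<n} (\<lambda>_. M)) (\<lambda>x. (\<Sum>i<n. g i (x i))\<^sup>2)"
    unfolding sum_sq using * by (intro Bochner_Integration.integrable_sum) auto
  have "(\<integral>x. (\<Sum>i<n. g i (x i))\<^sup>2 \<partial>PiM {..<n} (\<lambda>_. M)) =
      (\<Sum>i<n. \<Sum>j<n. \<integral>x. g i (x i) * g j (x j) \<partial>PiM {..<n} (\<lambda>_. M))"
    unfolding sum_sq
  proof (subst Bochner_Integration.integral_sum)
    show "integrable (PiM {..<n} (\<lambda>_. M)) (\<lambda>x. \<Sum>j<n. g i (x i) * g j (x j))" if "i \<in> {..<n}" for i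
      using * that by (intro Bochner_Integration.integrable_sum) auto
    show "(\<Sum>i<n. \<integral>x. (\<Sum>j<n. g i (x i) * g j (x j)) \<partial>PiM {..<n} (\<lambda>_. M)) =
        (\<Sum>i<n. \<Sum>j<n. \<integral>x. g i (x i) * g j (x j) \<partial>PiM {..<n} (\<lambda>_. M))"
      using * by (intro sum.cong refl Bochner_Integration.integral_sum) auto
  qed
  also have "\<dots> = (\<Sum>i<n. \<Sum>j<n. if i = j then \<integral>x. (g i x)\<^sup>2 \<partial>M else 0)"
    using * by (intro sum.cong refl) simp
  finally show "(\<integral>x. (\<Sum>i<n. g i (x i))\<^sup>2 \<partial>PiM {..<n} (\<lambda>_. M)) = (\<Sum>i<n. \<integral>x. (g i x)\<^sup>2 \<partial>M)" by simp
qed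

lemma PiM_centred_mean_square:
  fixes g :: "'a \<Rightarrow> real" and n :: nat
  assumes M: "prob_space M" and g: "g \<in> borel_measurable M"
    and sq: "integrable M (\<lambda>x. (g x)\<^sup>2)" and mean: "(\<integral>x. g x \<partial>M) = 0"
  shows "integrable (PiM {..<n} (\<lambda>_. M)) (\<lambda>x. ((\<Sum>i<n. g (x i)) / n)\<^sup>2)"
    and "(\<integral>x. ((\<Sum>i<n. g (x i)) / n)\<^sup>2 \<partial>PiM {..<n} (\<lambda>_. M)) = (\<integral>x. (g x)\<^sup>2 \<partial>M) / n"
  using PiM_centred_sum_square[of M n "\<lambda>_. g"] assms
  by (simp_all add: power_divide) (simp add: power2_eq_square)

section \<open>Law of large numbers in mean\<close>

lemma truncation_L1:
  fixes X :: "'a \<Rightarrow> real"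
  assumes X: "integrable M X"
  shows "(\<lambda>m. \<integral>x. \<bar>X x - (if \<bar>X x\<bar> \<le> real m then X x else 0)\<bar> \<partial>M) \<longlonglongrightarrow> 0"
proof -
  have [measurable]: "X \<in> borel_measurable M" using X by simp
  have "(\<lambda>m. \<integral>x. \<bar>X x - (if \<bar>X x\<bar> \<le> real m then X x else 0)\<bar> \<partial>M) \<longlonglongrightarrow> (\<integral>x. 0 \<partial>M)"
  proof (rule integral_dominated_convergence[where w = "\<lambda>x. \<bar>X x\<bar>"])
    show "AE x in M. (\<lambda>m. \<bar>X x - (if \<bar>X x\<bar> \<le> real m then X x else 0)\<bar>) \<longlonglongrightarrow> 0"
    proof (rule AE_I2)
      fix x
      have "eventually (\<lambda>m. \<bar>X x - (if \<bar>X x\<bar> \<le> real m then X x else 0)\<bar> = 0) sequentially"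
        using eventually_ge_at_top[of "nat \<lceil>\<bar>X x\<bar>\<rceil>"] 
      proof eventually_elim
        case (elim m)
        then have "\<bar>X x\<bar> \<le> real m" by linarith
        then show ?case by simp
      qed
      then show "(\<lambda>m. \<bar>X x - (if \<bar>X x\<bar> \<le> real m then X x else 0)\<bar>) \<longlonglongrightarrow> 0"
        by (rule tendsto_eventually)
    qed
  qed (use X in auto)
  then show ?thesis by simp
qed

text \<open>Truncation at a fixed level leaves a small error in mean, uniformly in n, and the
  truncated variables have a variance, so their average has variance of order 1/n. Convergence in
  mean is the form that the expectation of \<open>design_defect\<close> requires.\<close>

lemma L1_law_of_large_numbers:
  fixes X :: "'a \<Rightarrow> real"
  assumes M: "prob_space M" and X: "integrable M X"
  shows "integrable (PiM {..<n} (\<lambda>_. M)) (\<lambda>x. \<bar>(\<Sum>i<n. X (x i)) / real n - (\<integral>x. X x \<partial>M)\<bar>)" (is "?int n")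
    and "(\<lambda>n. \<integral>x. \<bar>(\<Sum>i<n. X (x i)) / real n - (\<integral>x. X x \<partial>M)\<bar> \<partial>PiM {..<n} (\<lambda>_. M)) \<longlonglongrightarrow> 0"
proof -
  interpret M: prob_space M by fact
  have PP: "prob_space (PiM {..<n} (\<lambda>_. M))" for n :: nat by (intro prob_space_PiM M)
  have [measurable]: "X \<in> borel_measurable M" using X by simp
  show int: "?int n" for n
  proof -
    interpret P: prob_space "PiM {..<n} (\<lambda>_. M)" by (rule PP)
    show ?thesis
      using PiM_component_integral(1)[OF M, of _ n X] X
      by (intro integrable_abs Bochner_Integration.integrable_diff integrable_divide Bochner_Integration.integrable_sum) auto
  qed
  define L where "L n = (\<integral>x. \<bar>(\<Sum>i<n. X (x i)) / real n - (\<integral>x. X x \<partial>M)\<bar> \<partial>PiM {..<n} (\<lambda>_. M))" for n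
  have L0: "L n \<ge> 0" for n unfolding L_def by simp
  have "L \<longlonglongrightarrow> 0"
  proof (rule LIMSEQ_I)
    fix e :: real assume e: "e > 0"
    \<comment> \<open>With c = e / 8 there will be three errors of size c (truncation of the
      average, truncation of the mean, and the splitting of an absolute value) and a variance term
      that is eventually below c, in total less than e.\<close>
    from truncation_L1[OF X] have "eventually (\<lambda>m. (\<integral>x. \<bar>X x - (if \<bar>X x\<bar> \<le> real m then X x else 0)\<bar> \<partial>M) < e / 8) sequentially"
      using e by (intro order_tendstoD(2)) auto
    then obtain m :: nat where m: "(\<integral>x. \<bar>X x - (if \<bar>X x\<bar> \<le> real m then X x else 0)\<bar> \<partial>M) < e / 8"
      by (auto simp: eventually_sequentially)
    define T where "T x = (if \<bar>X x\<bar> \<le> real m then X x else 0)" for x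
    have [measurable]: "T \<in> borel_measurable M" unfolding T_def by measurable
    have T_le: "\<bar>T x\<bar> \<le> real m" for x by (simp add: T_def)
    have T_int: "integrable M T"
      using T_le by (intro M.integrable_const_bound[where B = "real m"]) auto
    define t where "t = (\<integral>x. T x \<partial>M)"
    define g where "g x = T x - t" for x
    have [measurable]: "g \<in> borel_measurable M" unfolding g_def by measurable
    have g_le: "\<bar>g x\<bar> \<le> real m + \<bar>t\<bar>" for x using T_le[of x] by (simp add: g_def)
    have g_sq: "integrable M (\<lambda>x. (g x)\<^sup>2)"
      using power_mono[OF g_le abs_ge_zero, where n = 2]
      by (intro M.integrable_const_bound[where B = "(real m + \<bar>t\<bar>)\<^sup>2"]) auto
    have g_mean: "(\<integral>x. g x \<partial>M) = 0"
      unfolding g_def using T_int by (simp add: t_def M.prob_space)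
    define D where "D x = \<bar>X x - T x\<bar>" for x
    have [measurable]: "D \<in> borel_measurable M" unfolding D_def by measurable
    have D_int: "integrable M D" unfolding D_def using X T_int by simp
    have D_e: "(\<integral>x. D x \<partial>M) < e / 8" using m by (simp add: D_def T_def)
    have tX: "\<bar>t - (\<integral>x. X x \<partial>M)\<bar> \<le> e / 8"
    proof -
      have "\<bar>t - (\<integral>x. X x \<partial>M)\<bar> = \<bar>\<integral>x. X x - T x \<partial>M\<bar>"
        using X T_int by (simp add: t_def abs_minus_commute)
      also have "\<dots> \<le> (\<integral>x. D x \<partial>M)" unfolding D_def by (rule integral_abs_bound)
      finally show ?thesis using D_e by simp
    qed
    define v where "v = (\<integral>x. (g x)\<^sup>2 \<partial>M)"
    define c where "c = e / 8"
    have c: "c > 0" using e by (simp add: c_def)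
    have Lb: "L n \<le> v / c / real n + 3 * c" if n: "n > 0" for n
    proof -
      interpret P: prob_space "PiM {..<n} (\<lambda>_. M)" by (rule PP)
      have i1: "integrable (PiM {..<n} (\<lambda>_. M)) (\<lambda>x. (\<Sum>i<n. D (x i)) / n)"
        using PiM_component_integral(1)[OF M, of _ n D] D_int
        by (intro integrable_divide Bochner_Integration.integrable_sum) auto
      note i2 = PiM_centred_mean_square[OF M _ g_sq g_mean, where n = n]
      have pt: "\<bar>(\<Sum>i<n. X (x i)) / real n - (\<integral>x. X x \<partial>M)\<bar> \<le>
          (\<Sum>i<n. D (x i)) / n + (((\<Sum>i<n. g (x i)) / n)\<^sup>2 / c + c) + c" for x
      proof -
        have eq: "(\<Sum>i<n. X (x i)) / real n - (\<integral>x. X x \<partial>M) =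
            (\<Sum>i<n. X (x i) - T (x i)) / n + (\<Sum>i<n. g (x i)) / n + (t - (\<integral>x. X x \<partial>M))"
          using n by (simp add: g_def sum_subtractf field_simps)
        have 1: "\<bar>(\<Sum>i<n. X (x i) - T (x i)) / n\<bar> \<le> (\<Sum>i<n. D (x i)) / n"
          unfolding D_def abs_divide by (simp add: divide_right_mono sum_abs)
        \<comment> \<open>Converts the second moment of the truncated average into a bound on its
          first absolute moment.\<close>
        have 2: "\<bar>y\<bar> \<le> y\<^sup>2 / c + c" for y
        proof (cases "\<bar>y\<bar> \<le> c")
          case False
          then have "\<bar>y\<bar> * c \<le> \<bar>y\<bar> * \<bar>y\<bar>" using c by (intro mult_left_mono) auto
          then have "\<bar>y\<bar> \<le> y\<^sup>2 / c" using c by (simp add: le_divide_eq power2_eq_square)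
          then show ?thesis using c by simp
        qed (use c in \<open>simp add: add_increasing\<close>)
        show ?thesis unfolding eq using 1 2[of "(\<Sum>i<n. g (x i)) / n"] tX unfolding c_def by linarith
      qed
      have "L n \<le> (\<integral>x. (\<Sum>i<n. D (x i)) / n + (((\<Sum>i<n. g (x i)) / n)\<^sup>2 / c + c) + c \<partial>PiM {..<n} (\<lambda>_. M))"
        unfolding L_def using i1 i2 int by (intro integral_mono pt) auto
      also have "\<dots> = (\<Sum>i<n. \<integral>x. D x \<partial>M) / n + v / n / c + 2 * c"
        using i1 i2 PiM_component_integral[OF M, of _ n D] D_int
        by (simp add: P.prob_space v_def Bochner_Integration.integral_sum)
      also have "(\<Sum>i<n. \<integral>x. D x \<partial>M) / n = (\<integral>x. D x \<partial>M)" using n by simp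
      finally show ?thesis using D_e by (simp add: c_def mult.commute)
    qed
    have "(\<lambda>n. v / c / real n) \<longlonglongrightarrow> 0" by (rule lim_const_over_n)
    then have "eventually (\<lambda>n. v / c / real n < c) sequentially"
      using c by (intro order_tendstoD(2)) auto
    then have "eventually (\<lambda>n. norm (L n - 0) < e) sequentially"
      using eventually_gt_at_top[of 0]
    proof eventually_elim
      case (elim n)
      with Lb[of n] have "L n < 4 * c" by linarith
      with L0[of n] e show ?case by (simp add: c_def)
    qed
    then show "\<exists>no. \<forall>n\<ge>no. norm (L n - 0) < e" by (simp add: eventually_sequentially)
  qed
  then show "(\<lambda>n. \<integral>x. \<bar>(\<Sum>i<n. X (x i)) / real n - (\<integral>x. X x \<partial>M)\<bar> \<partial>PiM {..<n} (\<lambda>_. M)) \<longlonglongrightarrow> 0"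
    unfolding L_def .
qed

section \<open>Empirical moments of the design\<close>

text \<open>Small when, empirically, \<open>U\<close> has second moment \<open>V\<close>, \<open>r\<close> vanishes in mean square, and the
  \<open>b j\<close> are orthonormal and orthogonal to \<open>U\<close>.\<close>

definition design_defect ::
  "nat \<Rightarrow> nat \<Rightarrow> ('a \<Rightarrow> real) \<Rightarrow> real \<Rightarrow> ('a \<Rightarrow> real) \<Rightarrow> (nat \<Rightarrow> 'a \<Rightarrow> real) \<Rightarrow> (nat \<Rightarrow> 'a) \<Rightarrow> real" where
  "design_defect n k U V r b x =
     \<bar>(\<Sum>i<n. (U (x i))\<^sup>2) / n - V\<bar> + (\<Sum>i<n. (r (x i))\<^sup>2) / n +
     (\<Sum>j<k. ((\<Sum>i<n. U (x i) * b j (x i)) / n)\<^sup>2) +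
     (\<Sum>j<k. \<Sum>p<k. ((\<Sum>i<n. b j (x i) * b p (x i)) / n - (if j = p then 1 else 0))\<^sup>2)"

lemma design_defect_ge:
  shows "\<bar>(\<Sum>i<n. (U (x i))\<^sup>2) / n - V\<bar> \<le> design_defect n k U V r b x"
    and "(\<Sum>i<n. (r (x i))\<^sup>2) / n \<le> design_defect n k U V r b x"
    and "(\<Sum>j<k. ((\<Sum>i<n. U (x i) * b j (x i)) / n)\<^sup>2) \<le> design_defect n k U V r b x"
    and "(\<Sum>j<k. \<Sum>p<k. ((\<Sum>i<n. b j (x i) * b p (x i)) / n - (if j = p then 1 else 0))\<^sup>2) \<le> design_defect n k U V r b x"
proof -
  have 1: "0 \<le> (\<Sum>i<n. (r (x i))\<^sup>2) / n" by (intro divide_nonneg_nonneg sum_nonneg) auto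
  have 2: "0 \<le> (\<Sum>j<k. ((\<Sum>i<n. U (x i) * b j (x i)) / n)\<^sup>2)" by (intro sum_nonneg) auto
  have 3: "0 \<le> (\<Sum>j<k. \<Sum>p<k. ((\<Sum>i<n. b j (x i) * b p (x i)) / n - (if j = p then 1 else 0))\<^sup>2)"
    by (intro sum_nonneg) auto
  show "\<bar>(\<Sum>i<n. (U (x i))\<^sup>2) / n - V\<bar> \<le> design_defect n k U V r b x"
    "(\<Sum>i<n. (r (x i))\<^sup>2) / n \<le> design_defect n k U V r b x"
    "(\<Sum>j<k. ((\<Sum>i<n. U (x i) * b j (x i)) / n)\<^sup>2) \<le> design_defect n k U V r b x"
    "(\<Sum>j<k. \<Sum>p<k. ((\<Sum>i<n. b j (x i) * b p (x i)) / n - (if j = p then 1 else 0))\<^sup>2) \<le> design_defect n k U V r b x"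
    using 1 2 3 unfolding design_defect_def by linarith+
qed

text \<open>The last two parts of the defect are sums of squares of averages of centred variables,
  so each expectation is a variance divided by n. Summing over the basis before integrating brings
  in the pointwise bound \<xi>^2 of the sum of squares, instead of a separate bound for each
  function.\<close>

lemma design_defect_expectation:
  fixes U r :: "'a \<Rightarrow> real" and b :: "nat \<Rightarrow> 'a \<Rightarrow> real" and n :: nat
  assumes M: "prob_space M" and n: "n > 0"
    and U[measurable]: "U \<in> borel_measurable M" and U2: "integrable M (\<lambda>x. (U x)\<^sup>2)"
    and r[measurable]: "r \<in> borel_measurable M" and r2: "integrable M (\<lambda>x. (r x)\<^sup>2)"
    and b[measurable]: "\<And>j. j < k \<Longrightarrow> b j \<in> borel_measurable M"
    and \<xi>: "AE x in M. (\<Sum>j<k. (b j x)\<^sup>2) \<le> \<xi>\<^sup>2"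
    and orth: "\<And>j p. j < k \<Longrightarrow> p < k \<Longrightarrow> (\<integral>x. b j x * b p x \<partial>M) = (if j = p then 1 else 0)"
    and Ub: "\<And>j. j < k \<Longrightarrow> (\<integral>x. U x * b j x \<partial>M) = 0"
  shows "integrable (PiM {..<n} (\<lambda>_. M)) (design_defect n k U (\<integral>x. (U x)\<^sup>2 \<partial>M) r b)"
    and "(\<integral>x. design_defect n k U (\<integral>x. (U x)\<^sup>2 \<partial>M) r b x \<partial>PiM {..<n} (\<lambda>_. M)) \<le>
      (\<integral>x. \<bar>(\<Sum>i<n. (U (x i))\<^sup>2) / real n - (\<integral>x. (U x)\<^sup>2 \<partial>M)\<bar> \<partial>PiM {..<n} (\<lambda>_. M)) +
      (\<integral>x. (r x)\<^sup>2 \<partial>M) + \<xi>\<^sup>2 * (\<integral>x. (U x)\<^sup>2 \<partial>M) / n + \<xi>\<^sup>2 * k / n"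
proof -
  interpret M: prob_space M by fact
  define V where "V = (\<integral>x. (U x)\<^sup>2 \<partial>M)"
  define P where "P = PiM {..<n} (\<lambda>_. M)"
  have bj: "AE x in M. (b j x)\<^sup>2 \<le> \<xi>\<^sup>2" if "j < k" for j
    using \<xi>
  proof eventually_elim
    case (elim x)
    have "(b j x)\<^sup>2 \<le> (\<Sum>j<k. (b j x)\<^sup>2)" using that by (intro member_le_sum) auto
    with elim show ?case by simp
  qed
  have int1: "integrable P (\<lambda>x. \<bar>(\<Sum>i<n. (U (x i))\<^sup>2) / real n - V\<bar>)"
    unfolding P_def V_def by (rule L1_law_of_large_numbers(1)[OF M U2])
  have int2: "integrable P (\<lambda>x. (\<Sum>i<n. (r (x i))\<^sup>2) / real n)"
    and val2: "(\<integral>x. (\<Sum>i<n. (r (x i))\<^sup>2) / real n \<partial>P) = (\<integral>x. (r x)\<^sup>2 \<partial>M)"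
  proof -
    have *: "integrable P (\<lambda>x. (r (x i))\<^sup>2)" "(\<integral>x. (r (x i))\<^sup>2 \<partial>P) = (\<integral>x. (r x)\<^sup>2 \<partial>M)" if "i < n" for i
      unfolding P_def using PiM_component_integral[OF M that, of "\<lambda>x. (r x)\<^sup>2"] r2 by auto
    then show "integrable P (\<lambda>x. (\<Sum>i<n. (r (x i))\<^sup>2) / real n)"
      by (intro integrable_divide Bochner_Integration.integrable_sum) auto
    show "(\<integral>x. (\<Sum>i<n. (r (x i))\<^sup>2) / real n \<partial>P) = (\<integral>x. (r x)\<^sup>2 \<partial>M)"
      using * n by (simp add: Bochner_Integration.integral_sum)
  qed
  have Ub2: "integrable M (\<lambda>x. (U x * b j x)\<^sup>2)" if "j < k" for j
  proof (rule Bochner_Integration.integrable_bound[where f = "\<lambda>x. \<xi>\<^sup>2 * (U x)\<^sup>2"])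
    show "AE x in M. norm ((U x * b j x)\<^sup>2) \<le> norm (\<xi>\<^sup>2 * (U x)\<^sup>2)"
      using bj[OF that] by eventually_elim (simp add: power_mult_distrib mult.commute[of "(U _)\<^sup>2"] mult_right_mono)
  qed (use U2 that in auto)
  note c3 = PiM_centred_mean_square[OF M _ Ub2 Ub, where n = n, folded P_def]
  have int3: "integrable P (\<lambda>x. \<Sum>j<k. ((\<Sum>i<n. U (x i) * b j (x i)) / n)\<^sup>2)"
    using c3 by (intro Bochner_Integration.integrable_sum) auto
  have val3: "(\<integral>x. (\<Sum>j<k. ((\<Sum>i<n. U (x i) * b j (x i)) / n)\<^sup>2) \<partial>P) \<le> \<xi>\<^sup>2 * V / n"
  proof -
    have "(\<integral>x. (\<Sum>j<k. ((\<Sum>i<n. U (x i) * b j (x i)) / n)\<^sup>2) \<partial>P) = (\<Sum>j<k. (\<integral>x. (U x * b j x)\<^sup>2 \<partial>M) / n)"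
      using c3 by (subst Bochner_Integration.integral_sum) auto
    also have "\<dots> = (\<integral>x. (\<Sum>j<k. (U x * b j x)\<^sup>2) \<partial>M) / n"
      using Ub2 by (subst Bochner_Integration.integral_sum) (auto simp: sum_divide_distrib)
    also have "(\<integral>x. (\<Sum>j<k. (U x * b j x)\<^sup>2) \<partial>M) \<le> (\<integral>x. \<xi>\<^sup>2 * (U x)\<^sup>2 \<partial>M)"
    proof (rule integral_mono_AE)
      show "AE x in M. (\<Sum>j<k. (U x * b j x)\<^sup>2) \<le> \<xi>\<^sup>2 * (U x)\<^sup>2"
        using \<xi> by eventually_elim
          (simp add: power_mult_distrib sum_distrib_left[symmetric] mult.commute[of "\<xi>\<^sup>2"] mult_left_mono)
    qed (use U2 Ub2 in auto)
    also have "\<dots> = \<xi>\<^sup>2 * V" by (simp add: V_def)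
    finally show ?thesis by (simp add: divide_right_mono)
  qed
  define E where "E j p x = b j x * b p x - (if j = p then 1 else 0)" for j p x
  have [measurable]: "E j p \<in> borel_measurable M" if "j < k" "p < k" for j p
    using that unfolding E_def by measurable
  have bb: "integrable M (\<lambda>x. (b j x * b p x)\<^sup>2)" if "j < k" "p < k" for j p
  proof (rule M.integrable_const_bound[where B = "\<xi>\<^sup>2 * \<xi>\<^sup>2"])
    show "AE x in M. norm ((b j x * b p x)\<^sup>2) \<le> \<xi>\<^sup>2 * \<xi>\<^sup>2"
      using bj[OF that(1)] bj[OF that(2)]
    proof eventually_elim
      case (elim x)
      then have "(b j x)\<^sup>2 * (b p x)\<^sup>2 \<le> \<xi>\<^sup>2 * \<xi>\<^sup>2" by (intro mult_mono) auto
      then show ?case by (simp add: power_mult_distrib)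
    qed
  qed (use that in measurable)
  have bb1: "integrable M (\<lambda>x. b j x * b p x)" if "j < k" "p < k" for j p
    using M.square_integrable_imp_integrable[OF _ bb[OF that]] that by simp
  have E_sq: "(E j p x)\<^sup>2 = (b j x * b p x)\<^sup>2 - 2 * (if j = p then 1 else 0) * (b j x * b p x) + (if j = p then 1 else 0)" for j p x
    by (simp add: E_def power2_eq_square algebra_simps)
  have E2: "integrable M (\<lambda>x. (E j p x)\<^sup>2)" if "j < k" "p < k" for j p
    unfolding E_sq using bb[OF that] bb1[OF that] by auto
  have E2_le: "(\<integral>x. (E j p x)\<^sup>2 \<partial>M) \<le> (\<integral>x. (b j x * b p x)\<^sup>2 \<partial>M)" if "j < k" "p < k" for j p
    unfolding E_sq using bb[OF that] bb1[OF that] orth[OF that] by (auto simp: M.prob_space)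
  have E0: "(\<integral>x. E j p x \<partial>M) = 0" if "j < k" "p < k" for j p
    unfolding E_def using bb1[OF that] orth[OF that] by (auto simp: M.prob_space)
  have avgE: "(\<Sum>i<n. b j (x i) * b p (x i)) / n - (if j = p then 1 else 0) = (\<Sum>i<n. E j p (x i)) / n" for j p x
    using n by (simp add: E_def sum_subtractf diff_divide_distrib)
  note c4 = PiM_centred_mean_square[OF M _ E2 E0, where n = n, folded P_def]
  have int4: "integrable P (\<lambda>x. \<Sum>j<k. \<Sum>p<k. ((\<Sum>i<n. b j (x i) * b p (x i)) / n - (if j = p then 1 else 0))\<^sup>2)"
    unfolding avgE using c4 by (intro Bochner_Integration.integrable_sum) auto
  have val4: "(\<integral>x. (\<Sum>j<k. \<Sum>p<k. ((\<Sum>i<n. b j (x i) * b p (x i)) / n - (if j = p then 1 else 0))\<^sup>2) \<partial>P) \<le> \<xi>\<^sup>2 * k / n"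
  proof -
    have "(\<integral>x. (\<Sum>j<k. \<Sum>p<k. ((\<Sum>i<n. b j (x i) * b p (x i)) / n - (if j = p then 1 else 0))\<^sup>2) \<partial>P)
        = (\<Sum>j<k. \<Sum>p<k. (\<integral>x. (E j p x)\<^sup>2 \<partial>M) / n)"
      unfolding avgE
    proof (subst Bochner_Integration.integral_sum)
      show "integrable P (\<lambda>x. \<Sum>p<k. ((\<Sum>i<n. E j p (x i)) / n)\<^sup>2)" if "j \<in> {..<k}" for j
        using c4 that by (intro Bochner_Integration.integrable_sum) auto
      show "(\<Sum>j<k. \<integral>x. (\<Sum>p<k. ((\<Sum>i<n. E j p (x i)) / n)\<^sup>2) \<partial>P) = (\<Sum>j<k. \<Sum>p<k. (\<integral>x. (E j p x)\<^sup>2 \<partial>M) / n)"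
        using c4 by (intro sum.cong refl, subst Bochner_Integration.integral_sum) auto
    qed
    also have "\<dots> \<le> (\<Sum>j<k. \<Sum>p<k. (\<integral>x. (b j x * b p x)\<^sup>2 \<partial>M) / n)"
      using E2_le by (intro sum_mono divide_right_mono) auto
    also have "\<dots> = (\<integral>x. (\<Sum>j<k. \<Sum>p<k. (b j x * b p x)\<^sup>2) \<partial>M) / n"
    proof -
      have "(\<integral>x. (\<Sum>j<k. \<Sum>p<k. (b j x * b p x)\<^sup>2) \<partial>M) = (\<Sum>j<k. \<integral>x. (\<Sum>p<k. (b j x * b p x)\<^sup>2) \<partial>M)"
        using bb by (intro Bochner_Integration.integral_sum Bochner_Integration.integrable_sum) auto
      also have "\<dots> = (\<Sum>j<k. \<Sum>p<k. \<integral>x. (b j x * b p x)\<^sup>2 \<partial>M)"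
        using bb by (intro sum.cong refl Bochner_Integration.integral_sum) auto
      finally show ?thesis by (simp add: sum_divide_distrib)
    qed
    \<comment> \<open>Only one of the two sums of squares is replaced by \<xi>^2; the other
      integrates to k by orthonormality.\<close>
    also have "(\<integral>x. (\<Sum>j<k. \<Sum>p<k. (b j x * b p x)\<^sup>2) \<partial>M) \<le> (\<integral>x. \<xi>\<^sup>2 * (\<Sum>j<k. b j x * b j x) \<partial>M)"
    proof (rule integral_mono_AE)
      show "AE x in M. (\<Sum>j<k. \<Sum>p<k. (b j x * b p x)\<^sup>2) \<le> \<xi>\<^sup>2 * (\<Sum>j<k. b j x * b j x)"
        using \<xi>
      proof eventually_elim
        case (elim x)
        have "(\<Sum>j<k. \<Sum>p<k. (b j x * b p x)\<^sup>2) = (\<Sum>j<k. (b j x)\<^sup>2) * (\<Sum>j<k. (b j x)\<^sup>2)"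
          by (simp add: sum_product power_mult_distrib)
        also have "\<dots> \<le> \<xi>\<^sup>2 * (\<Sum>j<k. (b j x)\<^sup>2)"
          using elim by (intro mult_right_mono sum_nonneg) auto
        finally show ?case by (simp add: power2_eq_square)
      qed
      show "integrable M (\<lambda>x. \<Sum>j<k. \<Sum>p<k. (b j x * b p x)\<^sup>2)"
        using bb by (intro Bochner_Integration.integrable_sum) auto
      show "integrable M (\<lambda>x. \<xi>\<^sup>2 * (\<Sum>j<k. b j x * b j x))"
        using bb1 by (intro integrable_mult_right Bochner_Integration.integrable_sum) auto
    qed
    also have "\<dots> = \<xi>\<^sup>2 * (\<Sum>j<k. \<integral>x. b j x * b j x \<partial>M)"
      using bb1 by (simp add: Bochner_Integration.integral_sum)
    also have "\<dots> = \<xi>\<^sup>2 * k" using orth by simp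
    finally show ?thesis by (simp add: divide_right_mono)
  qed
  show "integrable (PiM {..<n} (\<lambda>_. M)) (design_defect n k U (\<integral>x. (U x)\<^sup>2 \<partial>M) r b)"
    unfolding design_defect_def[abs_def] P_def[symmetric] V_def[symmetric]
    by (intro Bochner_Integration.integrable_add int1 int2 int3 int4)
  have "(\<integral>x. design_defect n k U V r b x \<partial>P) =
      (\<integral>x. \<bar>(\<Sum>i<n. (U (x i))\<^sup>2) / real n - V\<bar> \<partial>P) + (\<integral>x. (\<Sum>i<n. (r (x i))\<^sup>2) / real n \<partial>P) +
      (\<integral>x. (\<Sum>j<k. ((\<Sum>i<n. U (x i) * b j (x i)) / n)\<^sup>2) \<partial>P) +
      (\<integral>x. (\<Sum>j<k. \<Sum>p<k. ((\<Sum>i<n. b j (x i) * b p (x i)) / n - (if j = p then 1 else 0))\<^sup>2) \<partial>P)"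
    unfolding design_defect_def
    by (simp only: Bochner_Integration.integral_add Bochner_Integration.integrable_add int1 int2 int3 int4)
  then show "(\<integral>x. design_defect n k U (\<integral>x. (U x)\<^sup>2 \<partial>M) r b x \<partial>PiM {..<n} (\<lambda>_. M)) \<le>
      (\<integral>x. \<bar>(\<Sum>i<n. (U (x i))\<^sup>2) / real n - (\<integral>x. (U x)\<^sup>2 \<partial>M)\<bar> \<partial>PiM {..<n} (\<lambda>_. M)) +
      (\<integral>x. (r x)\<^sup>2 \<partial>M) + \<xi>\<^sup>2 * (\<integral>x. (U x)\<^sup>2 \<partial>M) / n + \<xi>\<^sup>2 * k / n"
    using val2 val3 val4 unfolding P_def[symmetric] V_def[symmetric] by linarith
qed

text \<open>Both residual bounds are used with \<kappa> = \<epsilon>. The threshold \<epsilon>^2 for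
  the defect makes the dangerous term, the mean square of \<open>r\<close> divided by \<epsilon>, at
  most \<epsilon>, and \<epsilon> at most 1/4 secures the Gram condition. The number 10 leaves room
  above the collected multiples of \<epsilon>.\<close>

lemma residual_norm_close:
  fixes w :: "nat \<Rightarrow> real" and x :: "nat \<Rightarrow> 'a"
  assumes n: "n > 0" and V: "V > 0"
    and w: "\<And>i. i < n \<Longrightarrow> w i = U (x i) + r (x i) + (\<Sum>j<k. b j (x i) * \<gamma>0 j)"
    and \<epsilon>: "0 < \<epsilon>" "\<epsilon> \<le> 1 / 4" and H: "design_defect n k U V r b x \<le> \<epsilon>\<^sup>2"
    and Q: "Q = (\<Sum>i<n. (w i - (\<Sum>j<k. b j (x i) * \<gamma>w j))\<^sup>2)"
    and Qmin: "\<And>\<gamma>. Q \<le> (\<Sum>i<n. (w i - (\<Sum>j<k. b j (x i) * \<gamma> j))\<^sup>2)"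
  shows "\<bar>Q / n - V\<bar> \<le> \<epsilon> * (V + 10)"
proof -
  define S where "S = (\<Sum>i<n. (U (x i))\<^sup>2) / n"
  define R where "R = (\<Sum>i<n. (r (x i))\<^sup>2) / n"
  define v2 where "v2 = (\<Sum>j<k. ((\<Sum>i<n. U (x i) * b j (x i)) / n)\<^sup>2)"
  have "\<epsilon>\<^sup>2 \<le> \<epsilon>"
    using \<epsilon> mult_left_mono[of \<epsilon> 1 \<epsilon>] by (auto simp: power2_eq_square)
  then have \<epsilon>2: "\<epsilon>\<^sup>2 \<le> \<epsilon>" "\<epsilon>\<^sup>2 \<le> 1 / 4" using \<epsilon> by linarith+
  have S: "\<bar>S - V\<bar> \<le> \<epsilon>\<^sup>2" and R: "R \<le> \<epsilon>\<^sup>2" and v2: "v2 \<le> \<epsilon>\<^sup>2"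
    and F: "(\<Sum>j<k. \<Sum>p<k. ((\<Sum>i<n. b j (x i) * b p (x i)) / n - (if j = p then 1 else 0))\<^sup>2) \<le> 1 / 4"
    using design_defect_ge[where n = n and U = U and x = x and V = V and k = k and r = r and b = b] H \<epsilon>2 unfolding S_def R_def v2_def by linarith+
  have S0: "S \<ge> 0" unfolding S_def by (intro divide_nonneg_nonneg sum_nonneg) auto
  have lower: "(1 - \<epsilon>) * S - (1 + 1 / \<epsilon>) * R - 4 * v2 \<le> Q / n"
    unfolding Q S_def R_def v2_def
    by (rule residual_norm_lower_bound[where U = "\<lambda>i. U (x i)" and r = "\<lambda>i. r (x i)" and b = "\<lambda>j i. b j (x i)", OF n w F \<epsilon>(1)])
  have "Q / n \<le> (\<Sum>i<n. (w i - (\<Sum>j<k. b j (x i) * \<gamma>0 j))\<^sup>2) / n"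
    by (intro divide_right_mono Qmin) simp
  also have "\<dots> = (\<Sum>i<n. (U (x i) + r (x i))\<^sup>2) / n" by (simp add: w)
  also have "\<dots> \<le> (1 + \<epsilon>) * S + (1 + 1 / \<epsilon>) * R"
    unfolding S_def R_def by (rule residual_norm_upper_bound[OF \<epsilon>(1)])
  finally have upper: "Q / n \<le> (1 + \<epsilon>) * S + (1 + 1 / \<epsilon>) * R" .
  have "(1 + 1 / \<epsilon>) * R \<le> (1 + 1 / \<epsilon>) * \<epsilon>\<^sup>2" using R \<epsilon> by (intro mult_left_mono) auto
  also have "\<dots> = \<epsilon>\<^sup>2 + \<epsilon>" using \<epsilon> by (simp add: field_simps power2_eq_square)
  finally have R': "(1 + 1 / \<epsilon>) * R \<le> 2 * \<epsilon>" using \<epsilon>2 by simp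
  have "\<epsilon> * S \<le> \<epsilon> * (V + 1)" using S \<epsilon>2 \<epsilon> by (intro mult_left_mono) auto
  with lower upper R' S v2 \<epsilon>2 show ?thesis
    unfolding distrib_right distrib_left left_diff_distrib abs_le_iff by linarith
qed

section \<open>The noise and the regression on the design\<close>

lemma char_centred_normal:
  assumes "s > 0"
  shows "char (density lborel (\<lambda>x. ennreal (normal_density 0 s x))) t = exp (- (s\<^sup>2 * t\<^sup>2) / 2)"
proof -
  interpret prob_space std_normal_distribution by (rule prob_space_normal_density) simp
  have "distributed std_normal_distribution lborel (\<lambda>x. x) std_normal_density"
    unfolding distributed_def by (auto intro!: distr_id2)
  from normal_density_affine[OF this, of s 0] assms
  have "distributed std_normal_distribution lborel (\<lambda>x. s * x) (normal_density 0 s)" by simp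
  then have "density lborel (\<lambda>x. ennreal (normal_density 0 s x)) = distr std_normal_distribution lborel (\<lambda>x. s * x)"
    by (simp add: distributed_def)
  then have "char (density lborel (\<lambda>x. ennreal (normal_density 0 s x))) t = (CLINT x|std_normal_distribution. iexp (t * (s * x)))"
    by (simp add: char_def integral_distr)
  also have "\<dots> = char std_normal_distribution (t * s)" by (simp add: char_def mult.assoc)
  also have "\<dots> = exp (- (s\<^sup>2 * t\<^sup>2) / 2)"
    by (simp add: char_std_normal_distribution power_mult_distrib mult.commute)
  finally show ?thesis .
qed

lemma real_distribution_centred_normal:
  "s > 0 \<Longrightarrow> real_distribution (density lborel (\<lambda>x. ennreal (normal_density 0 s x)))"
  unfolding real_distribution_def real_distribution_axioms_def by (simp add: prob_space_normal_density)

lemma noise_moments: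
  assumes "\<sigma> > 0"
  shows "integrable (noise_law \<sigma>) (\<lambda>e. e\<^sup>2)" "(\<integral>e. e\<^sup>2 \<partial>noise_law \<sigma>) = \<sigma>\<^sup>2" "(\<integral>e. e \<partial>noise_law \<sigma>) = 0"
proof -
  show "integrable (noise_law \<sigma>) (\<lambda>e. e\<^sup>2)"
    unfolding noise_law_def using integrable_normal_moment[OF assms, of 0 2]
    by (subst integrable_density) auto
  show "(\<integral>e. e\<^sup>2 \<partial>noise_law \<sigma>) = \<sigma>\<^sup>2"
    unfolding noise_law_def using integral_normal_moment_even[OF assms, of 0 1]
    by (subst integral_density) (auto simp: eval_nat_numeral)
  show "(\<integral>e. e \<partial>noise_law \<sigma>) = 0"
    unfolding noise_law_def using integral_normal_moment_nz_1[OF assms, of 0]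
    by (subst integral_density) auto
qed

lemma noise_linear_combination_char:
  fixes c :: "nat \<Rightarrow> real" and n :: nat
  assumes \<sigma>: "\<sigma> > 0"
  shows "(CLINT e|PiM {..<n} (\<lambda>_. noise_law \<sigma>). iexp (t * (\<Sum>i<n. c i * e i))) = exp (- (t\<^sup>2 * \<sigma>\<^sup>2 * (\<Sum>i<n. (c i)\<^sup>2)) / 2)"
proof -
  interpret N: prob_space "noise_law \<sigma>" by (rule prob_space_noise_law[OF \<sigma>])
  interpret P: product_sigma_finite "\<lambda>_. noise_law \<sigma>" ..
  have int: "integrable (noise_law \<sigma>) (\<lambda>e. iexp (t * (c i * e)))" for i
    by (intro N.integrable_const_bound[where B = 1]) auto
  have "iexp (t * (\<Sum>i<n. c i * e i)) = (\<Prod>i<n. iexp (t * (c i * e i)))" for e :: "nat \<Rightarrow> real"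
    by (simp add: exp_sum[symmetric] sum_distrib_left)
  then have "(CLINT e|PiM {..<n} (\<lambda>_. noise_law \<sigma>). iexp (t * (\<Sum>i<n. c i * e i))) =
      (\<Prod>i<n. CLINT e|noise_law \<sigma>. iexp (t * (c i * e)))"
    using P.product_integral_prod[of "{..<n}" "\<lambda>i e. iexp (t * (c i * e))"] int by simp
  also have "\<dots> = (\<Prod>i<n. complex_of_real (exp (- (\<sigma>\<^sup>2 * (t * c i)\<^sup>2) / 2)))"
    using char_centred_normal[OF \<sigma>, of "t * c _"]
    by (simp add: char_def noise_law_def mult.assoc)
  also have "\<dots> = complex_of_real (exp (\<Sum>i<n. - (\<sigma>\<^sup>2 * (t * c i)\<^sup>2) / 2))"
    by (simp add: exp_sum)
  also have "(\<Sum>i<n. - (\<sigma>\<^sup>2 * (t * c i)\<^sup>2) / 2) = - (t\<^sup>2 * \<sigma>\<^sup>2 * (\<Sum>i<n. (c i)\<^sup>2)) / 2"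
    by (simp add: sum_distrib_left sum_negf sum_divide_distrib power_mult_distrib mult_ac)
  finally show ?thesis by simp
qed

lemma noise_linear_combination_square:
  fixes c :: "nat \<Rightarrow> real" and n :: nat
  assumes \<sigma>: "\<sigma> > 0"
  shows "integrable (PiM {..<n} (\<lambda>_. noise_law \<sigma>)) (\<lambda>e. (\<Sum>i<n. c i * e i)\<^sup>2)"
    and "(\<integral>e. (\<Sum>i<n. c i * e i)\<^sup>2 \<partial>PiM {..<n} (\<lambda>_. noise_law \<sigma>)) = \<sigma>\<^sup>2 * (\<Sum>i<n. (c i)\<^sup>2)"
  using PiM_centred_sum_square[OF prob_space_noise_law[OF \<sigma>], of n "\<lambda>i e. c i * e"] noise_moments[OF \<sigma>]
  by (simp_all add: power_mult_distrib sum_distrib_left mult.commute)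

lemma norm_iexp_diff_le: "norm (iexp a - iexp b) \<le> \<bar>a - b\<bar>"
proof -
  have "iexp a - iexp b = iexp b * (iexp (a - b) - 1)"
    by (simp add: exp_diff algebra_simps)
  then have "norm (iexp a - iexp b) = norm (iexp (a - b) - 1)" by (simp add: norm_mult)
  also have "\<dots> \<le> \<bar>a - b\<bar>" using iexp_approx1[of "a - b" 0] by simp
  finally show ?thesis .
qed

text \<open>The event on which \<open>D\<close> may fail to be linear in the noise is controlled by Chebyshev's
  inequality.\<close>

lemma char_close_to_normal:
  fixes c :: "nat \<Rightarrow> real" and n :: nat
  assumes \<sigma>: "\<sigma> > 0" and \<rho>: "\<rho> > 0"
    and D[measurable]: "D \<in> borel_measurable (PiM {..<n} (\<lambda>_. noise_law \<sigma>))"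
    and D_eq: "\<And>e. e \<in> space (PiM {..<n} (\<lambda>_. noise_law \<sigma>)) \<Longrightarrow> \<bar>\<Sum>i<n. c i * e i\<bar> < \<rho> \<Longrightarrow> D e = a + (\<Sum>i<n. c i * e i)"
  shows "norm ((CLINT e|PiM {..<n} (\<lambda>_. noise_law \<sigma>). iexp (t * D e)) - exp (- (t\<^sup>2 * \<sigma>\<^sup>2 * (\<Sum>i<n. (c i)\<^sup>2)) / 2))
    \<le> \<bar>t * a\<bar> + 2 * (\<sigma>\<^sup>2 * (\<Sum>i<n. (c i)\<^sup>2)) / \<rho>\<^sup>2"
proof -
  define P where "P = PiM {..<n} (\<lambda>_. noise_law \<sigma>)"
  interpret P: prob_space P unfolding P_def by (intro prob_space_PiM prob_space_noise_law \<sigma>)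
  define L where "L e = (\<Sum>i<n. c i * e i)" for e :: "nat \<Rightarrow> real"
  note D[folded P_def, measurable]
  have [measurable]: "L \<in> borel_measurable P" unfolding P_def L_def by measurable
  have i1: "integrable P (\<lambda>e. iexp (t * D e))" by (intro P.integrable_const_bound[where B = 1]) auto
  have i2: "integrable P (\<lambda>e. iexp (t * L e))" by (intro P.integrable_const_bound[where B = 1]) auto
  have i3: "integrable P (\<lambda>e. \<bar>t * a\<bar> + 2 * (L e)\<^sup>2 / \<rho>\<^sup>2)"
  proof -
    have "integrable P (\<lambda>e. (L e)\<^sup>2)"
      using noise_linear_combination_square(1)[OF \<sigma>, of n c] unfolding P_def L_def .
    then show ?thesis by simp
  qed
  have "norm ((CLINT e|P. iexp (t * D e)) - (CLINT e|P. iexp (t * L e))) = norm (CLINT e|P. iexp (t * D e) - iexp (t * L e))"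
    using i1 i2 by simp
  also have "\<dots> \<le> (\<integral>e. norm (iexp (t * D e) - iexp (t * L e)) \<partial>P)" by (rule integral_norm_bound)
  also have "\<dots> \<le> (\<integral>e. \<bar>t * a\<bar> + 2 * (L e)\<^sup>2 / \<rho>\<^sup>2 \<partial>P)"
  proof (rule integral_mono)
    show "integrable P (\<lambda>e. norm (iexp (t * D e) - iexp (t * L e)))" using i1 i2 by simp
    fix e assume e: "e \<in> space P"
    show "norm (iexp (t * D e) - iexp (t * L e)) \<le> \<bar>t * a\<bar> + 2 * (L e)\<^sup>2 / \<rho>\<^sup>2"
    proof (cases "\<bar>L e\<bar> < \<rho>")
      case True
      then have "D e = a + L e" using D_eq e unfolding P_def L_def by blast
      then have "\<bar>t * D e - t * L e\<bar> = \<bar>t * a\<bar>" by (simp add: algebra_simps)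
      then have "norm (iexp (t * D e) - iexp (t * L e)) \<le> \<bar>t * a\<bar>"
        using norm_iexp_diff_le[of "t * D e" "t * L e"] by linarith
      then show ?thesis by (simp add: add_increasing2)
    next
      case False
      then have "\<rho>\<^sup>2 \<le> (L e)\<^sup>2" using \<rho> by (intro abs_le_square_iff[THEN iffD1]) auto
      then have "2 \<le> 2 * (L e)\<^sup>2 / \<rho>\<^sup>2" using \<rho> by (simp add: le_divide_eq)
      moreover have "norm (iexp (t * D e) - iexp (t * L e)) \<le> 2"
        using norm_triangle_ineq4[of "iexp (t * D e)" "iexp (t * L e)"] by simp
      ultimately show ?thesis by linarith
    qed
  qed (rule i3)
  also have "\<dots> = \<bar>t * a\<bar> + 2 * (\<sigma>\<^sup>2 * (\<Sum>i<n. (c i)\<^sup>2)) / \<rho>\<^sup>2"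
    using noise_linear_combination_square[OF \<sigma>, of n c] unfolding P_def[symmetric] L_def[symmetric]
    by (simp add: P.prob_space)
  finally show ?thesis
    using noise_linear_combination_char[OF \<sigma>, of n t c] unfolding P_def L_def by simp
qed

section \<open>The design as a marginal law, and the regression on it\<close>

lemma plm_law_design_marginal:
  assumes f: "joint_density f" and \<sigma>: "\<sigma> > 0" and \<eta>: "\<eta> \<in> borel_measurable borel"
  shows "distr (plm_law \<sigma> f \<theta> \<eta>) borel (\<lambda>x. (W_of x, Z_of x)) = design_law f"
proof -
  interpret N: prob_space "noise_law \<sigma>" by (rule prob_space_noise_law[OF \<sigma>])
  have "distr (plm_law \<sigma> f \<theta> \<eta>) borel (\<lambda>x. (W_of x, Z_of x)) =
      distr (design_law f \<Otimes>\<^sub>M noise_law \<sigma>) borel ((\<lambda>x. (W_of x, Z_of x)) \<circ> (\<lambda>(u, e). observe \<theta> \<eta> u e))"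
    unfolding plm_law_eq_distr[OF assms]
  proof (rule distr_distr)
    show "(\<lambda>x. (W_of x, Z_of x)) \<in> borel \<rightarrow>\<^sub>M borel" by (simp add: borel_prod[symmetric])
  qed (rule observe_measurable_design_noise[OF \<eta> refl])
  also have "(\<lambda>x. (W_of x, Z_of x)) \<circ> (\<lambda>(u, e). observe \<theta> \<eta> u e) = fst"
    by (auto simp: fun_eq_iff observe_def)
  also have "distr (design_law f \<Otimes>\<^sub>M noise_law \<sigma>) borel fst = distr (design_law f \<Otimes>\<^sub>M noise_law \<sigma>) (design_law f) fst"
    by (rule distr_cong) auto
  also have "\<dots> = design_law f" by (rule N.distr_pair_fst)
  finally show ?thesis .
qed

lemma plm_law_design_integral:
  fixes g :: "real \<times> real \<Rightarrow> real"
  assumes "joint_density f" "\<sigma> > 0" "\<eta> \<in> borel_measurable borel" and [measurable]: "g \<in> borel_measurable borel"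
  shows "integrable (plm_law \<sigma> f \<theta> \<eta>) (\<lambda>x. g (W_of x, Z_of x)) \<longleftrightarrow> integrable (design_law f) g"
    and "(\<integral>x. g (W_of x, Z_of x) \<partial>plm_law \<sigma> f \<theta> \<eta>) = (\<integral>u. g u \<partial>design_law f)"
proof -
  have [measurable]: "(\<lambda>x. (W_of x, Z_of x)) \<in> plm_law \<sigma> f \<theta> \<eta> \<rightarrow>\<^sub>M borel"
    by (simp add: borel_prod[symmetric] plm_law_def)
  show "integrable (plm_law \<sigma> f \<theta> \<eta>) (\<lambda>x. g (W_of x, Z_of x)) \<longleftrightarrow> integrable (design_law f) g"
    unfolding plm_law_design_marginal[OF assms(1-3), of \<theta>, symmetric]
    by (subst integrable_distr_eq) auto
  show "(\<integral>x. g (W_of x, Z_of x) \<partial>plm_law \<sigma> f \<theta> \<eta>) = (\<integral>u. g u \<partial>design_law f)"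
    unfolding plm_law_design_marginal[OF assms(1-3), of \<theta>, symmetric]
    by (subst integral_distr) auto
qed

lemma Z_law_integral:
  fixes g :: "real \<Rightarrow> real"
  assumes "joint_density f" "\<sigma> > 0" "\<eta> \<in> borel_measurable borel" and [measurable]: "g \<in> borel_measurable borel"
  shows "(\<integral>z. g z \<partial>Z_law (plm_law \<sigma> f \<theta> \<eta>)) = (\<integral>u. g (snd u) \<partial>design_law f)"
proof -
  have [measurable]: "Z_of \<in> plm_law \<sigma> f \<theta> \<eta> \<rightarrow>\<^sub>M borel"
    by (simp add: borel_prod[symmetric] plm_law_def)
  have "(\<integral>z. g z \<partial>Z_law (plm_law \<sigma> f \<theta> \<eta>)) = (\<integral>x. g (Z_of x) \<partial>plm_law \<sigma> f \<theta> \<eta>)"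
    unfolding Z_law_def by (subst integral_distr) auto
  also have "\<dots> = (\<integral>u. g (snd u) \<partial>design_law f)"
    using plm_law_design_integral(2)[OF assms(1-3), of "\<lambda>u. g (snd u)"] by (simp add: borel_prod[symmetric])
  finally show ?thesis .
qed

text \<open>Positivity of \<open>f\<close> makes maximum likelihood least squares. The endpoint 1 is
  a null set and must be left out: the half-open indicators that form the splines of degree 0 all
  vanish there, so that no approximation is possible at that point.\<close>

lemma AE_design_law:
  assumes f: "joint_density f"
  shows "AE u in design_law f. f u > 0 \<and> snd u \<in> {0..<1}"
proof -
  have [measurable]: "f \<in> borel_measurable borel" using f by (simp add: joint_density_def)
  have "UNIV \<times> {1 :: real} \<in> null_sets (lborel \<Otimes>\<^sub>M (lborel :: real measure))"
    by (auto simp: null_sets_def lborel.emeasure_pair_measure_Times)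
  then have "UNIV \<times> {1} \<in> null_sets (lborel :: (real \<times> real) measure)" by (simp add: lborel_prod)
  then have "AE u in (lborel :: (real \<times> real) measure). u \<notin> UNIV \<times> {1}" by (rule AE_not_in)
  then have "AE u in lborel. 0 < ennreal (f u) \<longrightarrow> f u > 0 \<and> snd u \<in> {0..<1}"
  proof eventually_elim
    case (elim u)
    show ?case
    proof
      assume "0 < ennreal (f u)"
      then have "f u > 0" by simp
      moreover from this have "snd u \<in> {0..1}"
        using f unfolding joint_density_def by (metis less_irrefl prod.collapse)
      ultimately show "f u > 0 \<and> snd u \<in> {0..<1}" using elim by (cases u) auto
    qed
  qed
  then show ?thesis unfolding design_law_def by (subst AE_density) auto
qed

text \<open>Conditional Jensen makes \<open>b0\<close> square integrable, and the defining property
  of the conditional expectation is orthogonality of W - E(W | Z) to functions of Z. Everything is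
  moved to the design law, on which the empirical moments live.\<close>

lemma design_law_regression:
  assumes f: "joint_density f" and \<sigma>: "\<sigma> > 0" and \<eta>: "\<eta> \<in> borel_measurable borel"
    and reg: "regression_W_Z (plm_law \<sigma> f \<theta> \<eta>) b0"
    and W2: "integrable (design_law f) (\<lambda>u. (fst u)\<^sup>2)"
  shows "integrable (design_law f) (\<lambda>u. (b0 (snd u))\<^sup>2)"
    and "\<And>h. h \<in> borel_measurable borel \<Longrightarrow> integrable (design_law f) (\<lambda>u. (h (snd u))\<^sup>2) \<Longrightarrow>
      integrable (design_law f) (\<lambda>u. (fst u - b0 (snd u)) * h (snd u)) \<and>
      (\<integral>u. (fst u - b0 (snd u)) * h (snd u) \<partial>design_law f) = 0"
    and "integrable (design_law f) (\<lambda>u. (fst u - b0 (snd u))\<^sup>2)"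
    and "plm_information \<sigma> (plm_law \<sigma> f \<theta> \<eta>) = (\<integral>u. (fst u - b0 (snd u))\<^sup>2 \<partial>design_law f) / \<sigma>\<^sup>2"
proof -
  define P where "P = plm_law \<sigma> f \<theta> \<eta>"
  interpret P: prob_space P unfolding P_def by (rule prob_space_plm_law[OF f \<sigma> \<eta>])
  interpret D: prob_space "design_law f" by (rule prob_space_design_law[OF f])
  have [measurable]: "W_of \<in> borel_measurable P" "Z_of \<in> borel_measurable P"
    by (simp_all add: P_def plm_law_def borel_prod[symmetric])
  have [measurable]: "Z_of \<in> Z_algebra \<rightarrow>\<^sub>M borel"
    unfolding Z_algebra_def by (rule measurable_vimage_algebra1) simp
  have [measurable]: "b0 \<in> borel_measurable borel"
    and b0: "AE x in P. real_cond_exp P Z_algebra W_of x = b0 (Z_of x)"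
    using reg unfolding regression_W_Z_def P_def[symmetric] by blast+
  have meas_design[measurable]: "fst \<in> borel_measurable (design_law f)" "snd \<in> borel_measurable (design_law f)"
    by (simp_all add: design_law_def borel_prod[symmetric])
  have meas2[measurable]: "(\<lambda>u. h (snd u)) \<in> borel_measurable (borel :: (real \<times> real) measure)"
    "(\<lambda>u. fst u) \<in> borel_measurable (borel :: (real \<times> real) measure)"
    if [measurable]: "h \<in> borel_measurable borel" for h :: "real \<Rightarrow> real"
    unfolding borel_prod[symmetric] by measurable
  have sub: "subalgebra P Z_algebra"
  proof -
    have "sets Z_algebra \<subseteq> sets P"
      unfolding Z_algebra_def
    proof (rule sets_image_in_sets)
      show "space P = UNIV" by (simp add: P_def plm_law_def)
    qed measurable
    then show ?thesis by (simp add: subalgebra_def Z_algebra_def P_def plm_law_def)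
  qed
  interpret S: finite_measure_subalgebra P Z_algebra by unfold_locales (rule sub)
  note transfer = plm_law_design_integral[OF f \<sigma> \<eta>, of _ \<theta>, folded P_def]
  have W2P: "integrable P (\<lambda>x. (W_of x)\<^sup>2)"
    using transfer(1)[of "\<lambda>u. (fst u)\<^sup>2"] W2 by simp
  have WP: "integrable P W_of" by (rule P.square_integrable_imp_integrable[OF _ W2P]) simp
  have R2: "integrable P (\<lambda>x. (real_cond_exp P Z_algebra W_of x)\<^sup>2)"
  proof (rule Bochner_Integration.integrable_bound)
    show "integrable P (real_cond_exp P Z_algebra (\<lambda>x. (W_of x)\<^sup>2))" by (rule S.real_cond_exp_int(1)[OF W2P])
    have "AE x in P. (real_cond_exp P Z_algebra W_of x)\<^sup>2 \<le> real_cond_exp P Z_algebra (\<lambda>x. (W_of x)\<^sup>2) x"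
      by (rule S.real_cond_exp_jensens_inequality(2)[where I = UNIV]) (auto simp: WP W2P convex_power2)
    then show "AE x in P. norm ((real_cond_exp P Z_algebra W_of x)\<^sup>2) \<le> norm (real_cond_exp P Z_algebra (\<lambda>x. (W_of x)\<^sup>2) x)"
      by eventually_elim simp
  qed measurable
  have b02P: "integrable P (\<lambda>x. (b0 (Z_of x))\<^sup>2)"
    by (rule integrable_cong_AE_imp[OF R2]) (use b0 in \<open>auto elim: eventually_mono\<close>)
  show b02: "integrable (design_law f) (\<lambda>u. (b0 (snd u))\<^sup>2)"
    using transfer(1)[of "\<lambda>u. (b0 (snd u))\<^sup>2"] b02P by simp
  have prod_int: "integrable M (\<lambda>x. g x * h x)"
    if [measurable]: "g \<in> borel_measurable M" "h \<in> borel_measurable M" and "integrable M (\<lambda>x. (g x)\<^sup>2)" "integrable M (\<lambda>x. (h x)\<^sup>2)"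
    for g h :: "'b \<Rightarrow> real" and M
  proof (rule Bochner_Integration.integrable_bound[where f = "\<lambda>x. (g x)\<^sup>2 + (h x)\<^sup>2"])
    have "\<bar>g x * h x\<bar> \<le> (g x)\<^sup>2 + (h x)\<^sup>2" for x
      using zero_le_power2[of "g x - h x"] zero_le_power2[of "g x + h x"] zero_le_power2[of "g x"] zero_le_power2[of "h x"]
      unfolding power2_sum power2_diff by linarith
    then show "AE x in M. norm (g x * h x) \<le> norm ((g x)\<^sup>2 + (h x)\<^sup>2)" by simp
  qed (use that in auto)
  show orth: "integrable (design_law f) (\<lambda>u. (fst u - b0 (snd u)) * h (snd u)) \<and>
      (\<integral>u. (fst u - b0 (snd u)) * h (snd u) \<partial>design_law f) = 0"
    if [measurable]: "h \<in> borel_measurable borel" and h2: "integrable (design_law f) (\<lambda>u. (h (snd u))\<^sup>2)" for h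
  proof -
    have h2P: "integrable P (\<lambda>x. (h (Z_of x))\<^sup>2)"
      using transfer(1)[of "\<lambda>u. (h (snd u))\<^sup>2"] h2 by simp
    have hW: "integrable P (\<lambda>x. h (Z_of x) * W_of x)" using h2P W2P by (intro prod_int) auto
    have hb: "integrable P (\<lambda>x. h (Z_of x) * b0 (Z_of x))" using h2P b02P by (intro prod_int) auto
    have hD: "integrable (design_law f) (\<lambda>u. h (snd u) * fst u)" "integrable (design_law f) (\<lambda>u. h (snd u) * b0 (snd u))"
      using hW hb transfer(1)[of "\<lambda>u. h (snd u) * fst u"] transfer(1)[of "\<lambda>u. h (snd u) * b0 (snd u)"] by simp_all
    have "(\<integral>x. h (Z_of x) * b0 (Z_of x) \<partial>P) = (\<integral>x. h (Z_of x) * real_cond_exp P Z_algebra W_of x \<partial>P)"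
      by (rule integral_cong_AE) (use b0 in \<open>auto elim: eventually_mono\<close>)
    also have "\<dots> = (\<integral>x. h (Z_of x) * W_of x \<partial>P)"
      by (rule S.real_cond_exp_intg(2)[OF hW]) auto
    finally have "(\<integral>u. h (snd u) * b0 (snd u) \<partial>design_law f) = (\<integral>u. h (snd u) * fst u \<partial>design_law f)"
      using transfer(2)[of "\<lambda>u. h (snd u) * fst u"] transfer(2)[of "\<lambda>u. h (snd u) * b0 (snd u)"] by simp
    moreover have "(fst u - b0 (snd u)) * h (snd u) = h (snd u) * fst u - h (snd u) * b0 (snd u)" for u :: "real \<times> real"
      by (simp add: algebra_simps)
    ultimately show ?thesis using hD by simp
  qed
  \<comment> \<open>Orthogonality to \<open>b0\<close> itself removes the last term in the integral,
    which turns the information into the mean square of W - E(W | Z), divided by \<sigma>^2.\<close>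
  have Ueq: "(fst u - b0 (snd u))\<^sup>2 = (fst u)\<^sup>2 - (b0 (snd u))\<^sup>2 - 2 * ((fst u - b0 (snd u)) * b0 (snd u))" for u
    by (simp add: power2_eq_square algebra_simps)
  show "integrable (design_law f) (\<lambda>u. (fst u - b0 (snd u))\<^sup>2)"
    unfolding Ueq using W2 b02 orth[of b0] by simp
  have "(\<integral>x. (W_of x)\<^sup>2 - (real_cond_exp P Z_algebra W_of x)\<^sup>2 \<partial>P) = (\<integral>x. (W_of x)\<^sup>2 - (b0 (Z_of x))\<^sup>2 \<partial>P)"
    by (rule integral_cong_AE) (use b0 in \<open>auto elim: eventually_mono\<close>)
  also have "\<dots> = (\<integral>u. (fst u)\<^sup>2 - (b0 (snd u))\<^sup>2 \<partial>design_law f)"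
    using transfer(2)[of "\<lambda>u. (fst u)\<^sup>2 - (b0 (snd u))\<^sup>2"] by simp
  also have "\<dots> = (\<integral>u. (fst u - b0 (snd u))\<^sup>2 \<partial>design_law f)"
    unfolding Ueq using W2 b02 orth[of b0] by simp
  finally show "plm_information \<sigma> (plm_law \<sigma> f \<theta> \<eta>) = (\<integral>u. (fst u - b0 (snd u))\<^sup>2 \<partial>design_law f) / \<sigma>\<^sup>2"
    unfolding plm_information_def P_def by simp
qed

section \<open>The estimator for a fixed design\<close>

text \<open>If the unconstrained least squares value of \<theta> lies in \<Theta>, it also solves
  the constrained problem, so a maximiser exists. The quadratic gap with \<open>Q > 0\<close> shows
  that all maximisers share this value, though perhaps not \<gamma>; hence any selection
  \<open>T n\<close> returns it. The spline \<open>\<gamma>g\<close> is free, because the weights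
  annihilate the columns.\<close>

lemma mle_eq_weighted_sum:
  fixes u :: "nat \<Rightarrow> real \<times> real" and n :: nat
  assumes T: "mle_theta_sequence \<Theta> \<sigma> f K B T" and \<sigma>: "\<sigma> > 0" and n: "K n = k" "B n = \<beta>"
    and pos: "\<And>i. i < n \<Longrightarrow> f (u i) > 0" and Q: "Q > 0"
    and c\<beta>: "\<And>j. j < k \<Longrightarrow> (\<Sum>i<n. c i * \<beta> j (snd (u i))) = 0"
    and cw: "(\<Sum>i<n. c i * fst (u i)) = 1"
    and ls: "\<And>y. \<exists>\<gamma>h. \<forall>\<theta> \<gamma>.
        (\<Sum>i<n. (y i - (\<Sum>j<k. \<beta> j (snd (u i)) * \<gamma>h j) - (\<Sum>i<n. c i * y i) * fst (u i))\<^sup>2) + (\<theta> - (\<Sum>i<n. c i * y i))\<^sup>2 * Q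
        \<le> (\<Sum>i<n. (y i - (\<Sum>j<k. \<beta> j (snd (u i)) * \<gamma> j) - \<theta> * fst (u i))\<^sup>2)"
    and th: "\<theta> + (\<Sum>i<n. c i * (\<eta> (snd (u i)) - series_fun k \<beta> \<gamma>g (snd (u i)))) + (\<Sum>i<n. c i * e i) \<in> \<Theta>"
  shows "T n (\<lambda>i\<in>{..<n}. observe \<theta> \<eta> (u i) (e i)) =
    \<theta> + (\<Sum>i<n. c i * (\<eta> (snd (u i)) - series_fun k \<beta> \<gamma>g (snd (u i)))) + (\<Sum>i<n. c i * e i)"
proof -
  define x where "x = (\<lambda>i\<in>{..<n}. observe \<theta> \<eta> (u i) (e i))"
  define y where "y i = \<eta> (snd (u i)) + \<theta> * fst (u i) + e i" for i
  define th where "th = \<theta> + (\<Sum>i<n. c i * (\<eta> (snd (u i)) - series_fun k \<beta> \<gamma>g (snd (u i)))) + (\<Sum>i<n. c i * e i)"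
  have th_\<Theta>: "th \<in> \<Theta>" using th by (simp add: th_def)
  have xi: "W_of (x i) = fst (u i)" "Y_of (x i) = y i" "Z_of (x i) = snd (u i)" if "i < n" for i
    using that by (simp_all add: x_def observe_def y_def)
  have cg: "(\<Sum>i<n. c i * series_fun k \<beta> \<gamma>g (snd (u i))) = 0"
    unfolding series_fun_def by (rule sum_mult_comb_eq_0) (rule c\<beta>)
  have "(\<Sum>i<n. c i * y i) = \<theta> * (\<Sum>i<n. c i * fst (u i)) + (\<Sum>i<n. c i * \<eta> (snd (u i))) + (\<Sum>i<n. c i * e i)"
    by (simp add: y_def distrib_left sum.distrib sum_distrib_left mult_ac)
  then have cy: "(\<Sum>i<n. c i * y i) = th"
    using cg by (simp add: cw th_def right_diff_distrib sum_subtractf)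
  have SS: "sum_of_squares k \<beta> n x t g = (\<Sum>i<n. (y i - (\<Sum>j<k. \<beta> j (snd (u i)) * g j) - t * fst (u i))\<^sup>2)" for t g
    unfolding sum_of_squares_def series_fun_def by (intro sum.cong refl) (simp add: xi)
  obtain \<gamma>h where \<gamma>h: "sum_of_squares k \<beta> n x th \<gamma>h + (t - th)\<^sup>2 * Q \<le> sum_of_squares k \<beta> n x t g" for t g
    using ls[of y] unfolding cy SS by blast
  have pos': "f (W_of (x i), Z_of (x i)) > 0" if "i < n" for i
    using pos[OF that] by (simp add: xi[OF that])
  note mle = is_mle_iff_least_squares[where x = x and f = f, OF \<sigma> pos']
  have "sum_of_squares k \<beta> n x th \<gamma>h \<le> sum_of_squares k \<beta> n x t g" for t g
    using \<gamma>h[of t g] Q by (smt (verit) mult_nonneg_nonneg zero_le_power2)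
  then have "is_mle \<Theta> \<sigma> f k \<beta> n x th \<gamma>h" using th_\<Theta> by (simp add: mle)
  moreover have "x \<in> space (PiM {..<n} (\<lambda>_. borel :: obs measure))"
    by (auto simp: x_def space_PiM)
  ultimately obtain g where "is_mle \<Theta> \<sigma> f k \<beta> n x (T n x) g"
    using T unfolding mle_theta_sequence_def n[symmetric] by blast
  then have "sum_of_squares k \<beta> n x (T n x) g \<le> sum_of_squares k \<beta> n x th \<gamma>h"
    using th_\<Theta> by (simp add: mle)
  with \<gamma>h[of "T n x" g] have "(T n x - th)\<^sup>2 * Q \<le> 0" by linarith
  with Q have "T n x = th" by (simp add: mult_le_0_iff)
  then show ?thesis by (simp add: x_def th_def)
qed

text \<open>For a design with small defect, q = Q / n is at least V / 2, so the weights have sum of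
  squares at most 2 / (V n) and, by Cauchy--Schwarz, the bias is at most h sqrt (2 / V). The
  assumption \<open>near\<close> spends half of the radius \<open>r0\<close> on drift and bias and
  leaves the other half for the noise.\<close>

lemma conditional_char_bound:
  fixes u :: "nat \<Rightarrow> real \<times> real" and n :: nat
  assumes T: "mle_theta_sequence \<Theta> \<sigma> f K B T" and \<sigma>: "\<sigma> > 0" and n: "n > 0" "K n = k" "B n = \<beta>"
    and pos: "\<And>i. i < n \<Longrightarrow> f (u i) > 0" and z: "\<And>i. i < n \<Longrightarrow> snd (u i) \<in> {0..<1}"
    and V: "V > 0" and \<epsilon>: "0 < \<epsilon>" "\<epsilon> \<le> 1 / 4" "\<epsilon> * (V + 10) \<le> V / 2"
    and H: "design_defect n k U V r (\<lambda>j u. \<beta> j (snd u)) u \<le> \<epsilon>\<^sup>2"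
    and w: "\<And>v. fst v = U v + r v + (\<Sum>j<k. \<beta> j (snd v) * \<gamma>0 j)"
    and h: "\<And>z. z \<in> {0..<1} \<Longrightarrow> \<bar>\<eta> z - series_fun k \<beta> \<gamma>g z\<bar> \<le> h"
    and \<Theta>: "r0 > 0" "\<And>\<theta>'. \<bar>\<theta>' - \<theta>0\<bar> < r0 \<Longrightarrow> \<theta>' \<in> \<Theta>"
    and near: "\<bar>\<theta> - \<theta>0\<bar> + h * sqrt (2 / V) \<le> r0 / 2"
    and meas: "(\<lambda>e. T n (\<lambda>i\<in>{..<n}. observe \<theta> \<eta> (u i) (e i))) \<in> borel_measurable (PiM {..<n} (\<lambda>_. noise_law \<sigma>))"
  shows "\<exists>q. \<bar>q - V\<bar> \<le> \<epsilon> * (V + 10) \<and>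
    norm ((CLINT e|PiM {..<n} (\<lambda>_. noise_law \<sigma>). iexp (t * (sqrt n * (T n (\<lambda>i\<in>{..<n}. observe \<theta> \<eta> (u i) (e i)) - \<theta>))))
      - exp (- (t\<^sup>2 * \<sigma>\<^sup>2 / q) / 2))
    \<le> \<bar>t\<bar> * (sqrt n * h * sqrt (2 / V)) + 16 * \<sigma>\<^sup>2 / (V * n * r0\<^sup>2)"
proof -
  obtain \<gamma>w Q where Q: "Q = (\<Sum>i<n. (fst (u i) - (\<Sum>j<k. \<beta> j (snd (u i)) * \<gamma>w j))\<^sup>2)"
    and Qmin: "\<forall>\<gamma>. Q \<le> (\<Sum>i<n. (fst (u i) - (\<Sum>j<k. \<beta> j (snd (u i)) * \<gamma> j))\<^sup>2)"
    and weights: "Q > 0 \<longrightarrow> (\<exists>c. (\<forall>j<k. (\<Sum>i<n. c i * \<beta> j (snd (u i))) = 0) \<and> (\<Sum>i<n. c i * fst (u i)) = 1 \<and> (\<Sum>i<n. (c i)\<^sup>2) = 1 / Q \<and>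
      (\<forall>y. \<exists>\<gamma>h. \<forall>\<theta> \<gamma>.
        (\<Sum>i<n. (y i - (\<Sum>j<k. \<beta> j (snd (u i)) * \<gamma>h j) - (\<Sum>i<n. c i * y i) * fst (u i))\<^sup>2) + (\<theta> - (\<Sum>i<n. c i * y i))\<^sup>2 * Q
        \<le> (\<Sum>i<n. (y i - (\<Sum>j<k. \<beta> j (snd (u i)) * \<gamma> j) - \<theta> * fst (u i))\<^sup>2)))"
    by (rule least_squares_weights[where w = "\<lambda>i. fst (u i)" and b = "\<lambda>j i. \<beta> j (snd (u i))" and n = n and k = k])
  define q where "q = Q / n"
  have qV: "\<bar>q - V\<bar> \<le> \<epsilon> * (V + 10)"
    unfolding q_def
    by (rule residual_norm_close[where x = u and b = "\<lambda>j u. \<beta> j (snd u)", OF n(1) V w \<epsilon>(1,2) H Q spec[OF Qmin]])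
  then have q: "q \<ge> V / 2" using \<epsilon>(3) by linarith
  then have q0: "q > 0" using V by linarith
  then have Q0: "Q > 0" using n(1) by (simp add: q_def zero_less_divide_iff)
  obtain c where c\<beta>: "\<And>j. j < k \<Longrightarrow> (\<Sum>i<n. c i * \<beta> j (snd (u i))) = 0" and cw: "(\<Sum>i<n. c i * fst (u i)) = 1"
    and c2: "(\<Sum>i<n. (c i)\<^sup>2) = 1 / Q"
    and ls: "\<And>y. \<exists>\<gamma>h. \<forall>\<theta> \<gamma>.
        (\<Sum>i<n. (y i - (\<Sum>j<k. \<beta> j (snd (u i)) * \<gamma>h j) - (\<Sum>i<n. c i * y i) * fst (u i))\<^sup>2) + (\<theta> - (\<Sum>i<n. c i * y i))\<^sup>2 * Q
        \<le> (\<Sum>i<n. (y i - (\<Sum>j<k. \<beta> j (snd (u i)) * \<gamma> j) - \<theta> * fst (u i))\<^sup>2)"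
    using weights Q0 by blast
  define d where "d i = \<eta> (snd (u i)) - series_fun k \<beta> \<gamma>g (snd (u i))" for i
  define a where "a = (\<Sum>i<n. c i * d i)"
  have h0: "h \<ge> 0" using h[of 0] by (smt (verit) atLeastLessThan_iff)
  have a: "\<bar>a\<bar> \<le> h * sqrt (2 / V)"
  proof -
    have "a\<^sup>2 \<le> (\<Sum>i<n. (c i)\<^sup>2) * (\<Sum>i<n. (d i)\<^sup>2)" unfolding a_def by (rule Cauchy_Schwarz_ineq_sum)
    also have "\<dots> \<le> (\<Sum>i<n. (c i)\<^sup>2) * (\<Sum>i<n. h\<^sup>2)"
      using h z by (intro mult_left_mono sum_mono sum_nonneg) (auto simp: d_def abs_le_square_iff[symmetric] h0)
    also have "\<dots> = h\<^sup>2 / q" by (simp add: c2 q_def)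
    also have "\<dots> \<le> h\<^sup>2 / (V / 2)" using q V by (intro divide_left_mono) auto
    also have "\<dots> = (h * sqrt (2 / V))\<^sup>2" using V by (simp add: power_mult_distrib)
    finally show ?thesis using h0 V by (simp add: abs_le_square_iff[symmetric])
  qed
  have sn: "sqrt n > 0" using n(1) by simp
  define D where "D e = sqrt n * (T n (\<lambda>i\<in>{..<n}. observe \<theta> \<eta> (u i) (e i)) - \<theta>)" for e
  have Dm: "D \<in> borel_measurable (PiM {..<n} (\<lambda>_. noise_law \<sigma>))" unfolding D_def using meas by measurable
  have D_eq: "D e = sqrt n * a + (\<Sum>i<n. (sqrt n * c i) * e i)"
    if "\<bar>\<Sum>i<n. (sqrt n * c i) * e i\<bar> < sqrt n * (r0 / 2)" for e
  proof -
    have eq: "(\<Sum>i<n. (sqrt n * c i) * e i) = sqrt n * (\<Sum>i<n. c i * e i)"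
      by (simp add: sum_distrib_left mult.assoc)
    with that have "sqrt n * \<bar>\<Sum>i<n. c i * e i\<bar> < sqrt n * (r0 / 2)"
      using sn by (simp add: abs_mult)
    then have "\<bar>\<Sum>i<n. c i * e i\<bar> < r0 / 2" using sn by (simp only: mult_less_cancel_left_pos)
    then have "\<bar>\<theta> + a + (\<Sum>i<n. c i * e i) - \<theta>0\<bar> < r0" using near a by linarith
    then have "T n (\<lambda>i\<in>{..<n}. observe \<theta> \<eta> (u i) (e i)) = \<theta> + a + (\<Sum>i<n. c i * e i)"
      unfolding a_def d_def using \<Theta>(2)
      by (intro mle_eq_weighted_sum[OF T \<sigma> n(2,3) pos Q0 c\<beta> cw ls]) auto
    then show ?thesis unfolding D_def eq by (simp add: algebra_simps)
  qed
  have c2': "(\<Sum>i<n. (sqrt n * c i)\<^sup>2) = 1 / q"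
    by (simp add: power_mult_distrib sum_distrib_left[symmetric] c2 q_def)
  \<comment> \<open>The radius is sqrt n r0 / 2 and the noise term has variance \<sigma>^2 / q, at
    most 2 \<sigma>^2 / V; together with the factor 2 for a failure this gives the constant
    16.\<close>
  have "norm ((CLINT e|PiM {..<n} (\<lambda>_. noise_law \<sigma>). iexp (t * D e)) - exp (- (t\<^sup>2 * \<sigma>\<^sup>2 * (\<Sum>i<n. (sqrt n * c i)\<^sup>2)) / 2))
      \<le> \<bar>t * (sqrt n * a)\<bar> + 2 * (\<sigma>\<^sup>2 * (\<Sum>i<n. (sqrt n * c i)\<^sup>2)) / (sqrt n * (r0 / 2))\<^sup>2"
    using sn \<Theta>(1) D_eq by (intro char_close_to_normal[OF \<sigma> _ Dm]) auto
  also have "\<bar>t * (sqrt n * a)\<bar> \<le> \<bar>t\<bar> * (sqrt n * h * sqrt (2 / V))"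
    unfolding abs_mult using a sn by (simp add: mult_left_mono mult.assoc)
  also have "2 * (\<sigma>\<^sup>2 * (\<Sum>i<n. (sqrt n * c i)\<^sup>2)) / (sqrt n * (r0 / 2))\<^sup>2 = 8 * \<sigma>\<^sup>2 / (n * r0\<^sup>2) * (1 / q)"
    using n(1) \<Theta>(1) unfolding c2' by (simp add: power_mult_distrib power_divide field_simps)
  also have "\<dots> \<le> 8 * \<sigma>\<^sup>2 / (n * r0\<^sup>2) * (1 / (V / 2))"
    using q V by (intro mult_left_mono divide_left_mono) auto
  also have "\<dots> = 16 * \<sigma>\<^sup>2 / (V * n * r0\<^sup>2)" by simp
  finally have "norm ((CLINT e|PiM {..<n} (\<lambda>_. noise_law \<sigma>). iexp (t * D e)) - exp (- (t\<^sup>2 * \<sigma>\<^sup>2 / q) / 2))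
      \<le> \<bar>t\<bar> * (sqrt n * h * sqrt (2 / V)) + 16 * \<sigma>\<^sup>2 / (V * n * r0\<^sup>2)"
    unfolding c2' by simp
  with qV show ?thesis unfolding D_def by blast
qed

section \<open>The characteristic function of the estimator\<close>

text \<open>Averages the conditional bound over the design by Fubini's theorem. The number \<omega>
  is a modulus of continuity of the normal characteristic function in its variance parameter: it
  pays for replacing the random q by V.\<close>

lemma char_local_law_bound:
  fixes n :: nat
  assumes T: "mle_theta_sequence \<Theta> \<sigma> f K B T" and \<sigma>: "\<sigma> > 0" and f: "joint_density f"
    and n: "n > 0" "K n = k" "B n = \<beta>" and \<eta>: "\<eta> \<in> borel_measurable borel"
    and V: "V > 0" and \<epsilon>: "0 < \<epsilon>" "\<epsilon> \<le> 1 / 4" "\<epsilon> * (V + 10) \<le> V / 2"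
    and H: "integrable (PiM {..<n} (\<lambda>_. design_law f)) (design_defect n k U V r (\<lambda>j u. \<beta> j (snd u)))"
    and w: "\<And>v. fst v = U v + r v + (\<Sum>j<k. \<beta> j (snd v) * \<gamma>0 j)"
    and h: "\<And>z. z \<in> {0..<1} \<Longrightarrow> \<bar>\<eta> z - series_fun k \<beta> \<gamma>g z\<bar> \<le> h"
    and \<Theta>: "r0 > 0" "\<And>\<theta>'. \<bar>\<theta>' - \<theta>0\<bar> < r0 \<Longrightarrow> \<theta>' \<in> \<Theta>"
    and near: "\<bar>\<theta> - \<theta>0\<bar> + h * sqrt (2 / V) \<le> r0 / 2"
    and \<omega>: "\<And>q. \<bar>q - V\<bar> \<le> \<epsilon> * (V + 10) \<Longrightarrow> \<bar>exp (- (t\<^sup>2 * \<sigma>\<^sup>2 / q) / 2) - exp (- (t\<^sup>2 * \<sigma>\<^sup>2 / V) / 2)\<bar> \<le> \<omega>"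
  shows "norm (char (distr (PiM {..<n} (\<lambda>_. plm_law \<sigma> f \<theta> \<eta>)) borel (\<lambda>x. sqrt n * (T n x - \<theta>))) t
      - exp (- (t\<^sup>2 * \<sigma>\<^sup>2 / V) / 2))
    \<le> \<omega> + \<bar>t\<bar> * (sqrt n * h * sqrt (2 / V)) + 16 * \<sigma>\<^sup>2 / (V * n * r0\<^sup>2) +
      2 * (\<integral>u. design_defect n k U V r (\<lambda>j u. \<beta> j (snd u)) u \<partial>PiM {..<n} (\<lambda>_. design_law f)) / \<epsilon>\<^sup>2"
proof -
  define DP where "DP = PiM {..<n} (\<lambda>_. design_law f)"
  define NP where "NP = PiM {..<n} (\<lambda>_. noise_law \<sigma>)"
  define LP where "LP = PiM {..<n} (\<lambda>_. plm_law \<sigma> f \<theta> \<eta>)"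
  interpret DP: prob_space DP unfolding DP_def by (intro prob_space_PiM prob_space_design_law f)
  interpret NP: prob_space NP unfolding NP_def by (intro prob_space_PiM prob_space_noise_law \<sigma>)
  interpret pair_prob_space DP NP ..
  define S where "S u e = (\<lambda>i\<in>{..<n}. observe \<theta> \<eta> (u i) (e i))" for u and e :: "nat \<Rightarrow> real"
  have S[measurable]: "(\<lambda>(u, e). S u e) \<in> (DP \<Otimes>\<^sub>M NP) \<rightarrow>\<^sub>M LP"
    unfolding S_def DP_def NP_def LP_def by (rule observe_sample_measurable[OF \<eta>])
  have LP: "LP = distr (DP \<Otimes>\<^sub>M NP) LP (\<lambda>(u, e). S u e)"
    unfolding S_def DP_def NP_def LP_def by (rule PiM_plm_law_eq_distr[OF f \<sigma> \<eta>])
  have Tm[measurable]: "T n \<in> borel_measurable LP"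
  proof -
    have "sets LP = sets (PiM {..<n} (\<lambda>_. borel))" unfolding LP_def by (intro sets_PiM_cong) auto
    then show ?thesis using T by (simp add: mle_theta_sequence_def measurable_cong_sets[of LP])
  qed
  define D where "D u e = sqrt n * (T n (S u e) - \<theta>)" for u e
  have TS[measurable]: "(\<lambda>(u, e). T n (S u e)) \<in> borel_measurable (DP \<Otimes>\<^sub>M NP)"
    using measurable_compose[OF S Tm] by (simp add: case_prod_unfold)
  have D[measurable]: "(\<lambda>(u, e). D u e) \<in> borel_measurable (DP \<Otimes>\<^sub>M NP)"
    unfolding D_def using TS by (simp add: case_prod_unfold)
  define I where "I u = (CLINT e|NP. iexp (t * D u e))" for u
  define \<phi> where "\<phi> = exp (- (t\<^sup>2 * \<sigma>\<^sup>2 / V) / 2)"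
  have int: "integrable (DP \<Otimes>\<^sub>M NP) (\<lambda>x. iexp (t * (case x of (u, e) \<Rightarrow> D u e)))"
    by (intro P.integrable_const_bound[where B = 1]) auto
  have "char (distr LP borel (\<lambda>x. sqrt n * (T n x - \<theta>))) t = (CLINT x|LP. iexp (t * (sqrt n * (T n x - \<theta>))))"
    by (simp add: char_def integral_distr)
  also have "\<dots> = (CLINT x|(DP \<Otimes>\<^sub>M NP). iexp (t * (sqrt n * (T n (case x of (u, e) \<Rightarrow> S u e) - \<theta>))))"
    by (subst LP) (rule integral_distr; measurable)
  also have "\<dots> = (CLINT x|(DP \<Otimes>\<^sub>M NP). iexp (t * (case x of (u, e) \<Rightarrow> D u e)))"
    by (simp add: D_def case_prod_unfold)
  also have "\<dots> = (CLINT u|DP. I u)"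
    using integral_fst'[OF int] by (simp add: I_def)
  finally have char_eq: "char (distr LP borel (\<lambda>x. sqrt n * (T n x - \<theta>))) t = (CLINT u|DP. I u)" .
  have I_int: "integrable DP I"
    using integrable_fst'[OF int] unfolding I_def[abs_def] by (simp only: prod.case)
  have I_le: "norm (I u) \<le> 1" if "u \<in> space DP" for u
  proof -
    have "norm (I u) \<le> (\<integral>e. norm (iexp (t * D u e)) \<partial>NP)" unfolding I_def by (rule integral_norm_bound)
    then show ?thesis by (simp add: NP.prob_space)
  qed
  have \<phi>: "0 \<le> \<phi>" "\<phi> \<le> 1" using V \<sigma> by (simp_all add: \<phi>_def)
  have \<omega>0: "\<omega> \<ge> 0" using \<omega>[of V] V \<epsilon> by simp
  have h0: "h \<ge> 0" using h[of 0] by (smt (verit) atLeastLessThan_iff)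
  define H where "H = design_defect n k U V r (\<lambda>j u. \<beta> j (snd u))"
  define A where "A = \<omega> + \<bar>t\<bar> * (sqrt n * h * sqrt (2 / V)) + 16 * \<sigma>\<^sup>2 / (V * n * r0\<^sup>2)"
  have A0: "A \<ge> 0" using \<omega>0 h0 V by (simp add: A_def)
  have H_int: "integrable DP H" using H unfolding DP_def H_def .
  have H0: "H u \<ge> 0" for u unfolding H_def using design_defect_ge(1) abs_ge_zero by (rule order.trans[rotated])
  have good: "AE u in DP. \<forall>i<n. f (u i) > 0 \<and> snd (u i) \<in> {0..<1}"
  proof -
    have "AE u in DP. f (u i) > 0 \<and> snd (u i) \<in> {0..<1}" if "i < n" for i
      unfolding DP_def using that
      by (intro AE_PiM_component prob_space_design_law f AE_design_law) auto
    then have "AE u in DP. \<forall>i\<in>{..<n}. f (u i) > 0 \<and> snd (u i) \<in> {0..<1}"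
      by (intro AE_finite_allI) auto
    then show ?thesis by eventually_elim auto
  qed
  \<comment> \<open>Good designs cost \<open>A\<close>. On a bad design the trivial bound 2 is
    dominated by the defect term, so one inequality holds almost everywhere and only the mean of the
    defect remains after integration.\<close>
  have bound: "AE u in DP. norm (I u - \<phi>) \<le> A + 2 * H u / \<epsilon>\<^sup>2"
    using good AE_space
  proof eventually_elim
    case (elim u)
    show ?case
    proof (cases "H u \<le> \<epsilon>\<^sup>2")
      case True
      have "(\<lambda>e. T n (S u e)) \<in> borel_measurable NP"
        using measurable_compose[OF measurable_Pair1'[OF elim(2)] TS] by simp
      then obtain q where q: "\<bar>q - V\<bar> \<le> \<epsilon> * (V + 10)"
        and Iq: "norm (I u - exp (- (t\<^sup>2 * \<sigma>\<^sup>2 / q) / 2)) \<le> \<bar>t\<bar> * (sqrt n * h * sqrt (2 / V)) + 16 * \<sigma>\<^sup>2 / (V * n * r0\<^sup>2)"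
        using conditional_char_bound[OF T \<sigma> n _ _ V \<epsilon> True[unfolded H_def] w h \<Theta> near, of t] elim(1)
        unfolding I_def D_def S_def NP_def by auto
      have "norm (complex_of_real (exp (- (t\<^sup>2 * \<sigma>\<^sup>2 / q) / 2)) - \<phi>) \<le> \<omega>"
        using \<omega>[OF q] unfolding \<phi>_def of_real_diff[symmetric] norm_of_real .
      with Iq have "norm (I u - \<phi>) \<le> A"
        unfolding A_def using norm_triangle_ineq[of "I u - exp (- (t\<^sup>2 * \<sigma>\<^sup>2 / q) / 2)" "exp (- (t\<^sup>2 * \<sigma>\<^sup>2 / q) / 2) - \<phi>"] by simp
      moreover have "0 \<le> 2 * H u / \<epsilon>\<^sup>2" using H0 by simp
      ultimately show ?thesis by linarith
    next
      case False
      then have "2 \<le> 2 * H u / \<epsilon>\<^sup>2" using \<epsilon>(1) by (simp add: le_divide_eq)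
      moreover have "norm (I u - \<phi>) \<le> 2"
        using norm_triangle_ineq4[of "I u" "complex_of_real \<phi>"] I_le[OF elim(2)] \<phi> by simp
      ultimately show ?thesis using A0 by linarith
    qed
  qed
  have "norm ((CLINT u|DP. I u) - \<phi>) = norm (CLINT u|DP. I u - \<phi>)"
    using I_int by (simp add: DP.prob_space)
  also have "\<dots> \<le> (\<integral>u. norm (I u - \<phi>) \<partial>DP)" by (rule integral_norm_bound)
  also have "\<dots> \<le> (\<integral>u. A + 2 * H u / \<epsilon>\<^sup>2 \<partial>DP)"
    using I_int H_int bound by (intro integral_mono_AE) auto
  also have "\<dots> = A + 2 * (\<integral>u. H u \<partial>DP) / \<epsilon>\<^sup>2"
    using H_int by (simp add: DP.prob_space)
  finally show ?thesis
    unfolding char_eq[unfolded LP_def] A_def \<phi>_def H_def DP_def .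
qed

section \<open>Spline approximation inside the models, and values off the unit interval\<close>

lemma smooth_series_approximation:
  assumes "cont_diff_on s {0..1} g" "s \<le> l + 1"
  obtains K where "K \<ge> 0" and "\<And>N Q \<beta>. N \<ge> 1 \<Longrightarrow> orthonormal_bsplines l N Q \<beta> \<Longrightarrow> finite_measure Q \<Longrightarrow> sets Q = sets borel \<Longrightarrow>
    \<exists>\<gamma>. \<forall>z\<in>{0..<1}. \<bar>g z - series_fun (N + l) \<beta> \<gamma> z\<bar> \<le> K / real N ^ s"
proof -
  obtain K where K: "K \<ge> 0" and approx: "\<And>N. N \<ge> 1 \<Longrightarrow>
    \<exists>\<gamma>. \<forall>z\<in>{0..<1}. \<bar>g z - (\<Sum>j<N + l. \<gamma> j * bspline (spline_knots l N) l j z)\<bar> \<le> K / real N ^ s"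
    using spline_approximation[OF assms] by blast
  show thesis
  proof (rule that[OF K])
    fix N Q \<beta> assume *: "N \<ge> 1" "orthonormal_bsplines l N Q \<beta>" "finite_measure Q" "sets Q = sets borel"
    obtain c where c: "\<And>z. z \<in> {0..<1} \<Longrightarrow> \<bar>g z - (\<Sum>j<N + l. c j * bspline (spline_knots l N) l j z)\<bar> \<le> K / real N ^ s"
      using approx[OF *(1)] by blast
    obtain \<gamma> where "\<And>z. (\<Sum>j<N + l. c j * bspline (spline_knots l N) l j z) = series_fun (N + l) \<beta> \<gamma> z"
      using bspline_in_span_orthonormal[OF *(2,1,3,4)] by blast
    with c show "\<exists>\<gamma>. \<forall>z\<in>{0..<1}. \<bar>g z - series_fun (N + l) \<beta> \<gamma> z\<bar> \<le> K / real N ^ s"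
      by (intro exI[of _ \<gamma>]) auto
  qed
qed

lemma series_fun_linear: "series_fun k \<beta> (\<lambda>j. \<gamma> j + x * \<gamma>' j) z = series_fun k \<beta> \<gamma> z + x * series_fun k \<beta> \<gamma>' z"
  by (simp add: series_fun_def distrib_left sum.distrib sum_distrib_left mult_ac)

text \<open>Membership in \<open>smooth_space s\<close> does not constrain a function outside the unit interval, where it
  may even be non-measurable.\<close>

definition restrict_unit :: "(real \<Rightarrow> real) \<Rightarrow> real \<Rightarrow> real" where
  "restrict_unit \<eta> z = (if z \<in> {0..1} then \<eta> z else 0)"

lemma restrict_unit_borel:
  assumes "\<eta> \<in> smooth_space s"
  shows "restrict_unit \<eta> \<in> borel_measurable borel"
proof -
  obtain D :: "nat \<Rightarrow> real \<Rightarrow> real" where D: "\<forall>x\<in>{0..1}. D 0 x = \<eta> x" "\<forall>j\<le>s. continuous_on {0..1} (D j)"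
    using assms unfolding smooth_space_def cont_diff_on_def mem_Collect_eq by metis
  then have "continuous_on {0..1} (D 0)" by blast
  then have "continuous_on {0..1} \<eta>" by (rule continuous_on_eq) (use D(1) in blast)
  from borel_measurable_continuous_on_if[OF _ this, of "\<lambda>_. 0"] show ?thesis
    unfolding restrict_unit_def[abs_def] by simp
qed

lemma plm_law_restrict_unit:
  "joint_density f \<Longrightarrow> plm_law \<sigma> f \<theta> \<eta> = plm_law \<sigma> f \<theta> (restrict_unit \<eta>)"
  by (rule plm_law_cong) (simp_all add: restrict_unit_def)

section \<open>Best regularity\<close>

theorem mainTheorem4:
  fixes \<sigma> \<theta>0 \<delta> C :: real
    and f :: "real \<times> real \<Rightarrow> real"
    and \<Theta> :: "real set"
    and s l :: nat
    and \<eta>0 b0 :: "real \<Rightarrow> real"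
    and N k m :: "nat \<Rightarrow> nat"
    and \<beta> :: "nat \<Rightarrow> nat \<Rightarrow> real \<Rightarrow> real"
    and a :: "nat \<Rightarrow> real"
    and T :: "nat \<Rightarrow> (nat \<Rightarrow> obs) \<Rightarrow> real"
    and P0 :: "obs measure"
  defines "P0 \<equiv> plm_law \<sigma> f \<theta>0 \<eta>0"
  assumes "\<sigma> > 0"
    and "joint_density f"
    and "\<theta>0 \<in> interior \<Theta>"
    and "\<delta> > 0"
    and "integrable P0 (\<lambda>x. \<bar>W_of x\<bar> powr (2 + \<delta>))"
    and "plm_information \<sigma> P0 > 0"
    and "\<And>j. N j \<ge> 1"
    and "\<And>j. k j = N j + l"
    and "\<And>j. orthonormal_bsplines l (N j) (Z_law P0) (\<beta> j)"
    and "filterlim k at_top sequentially"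
    and "filterlim m at_top sequentially"
    and "regression_W_Z P0 b0"
    and "\<And>n. L2_dist (Z_law P0) b0 (projection_W P0 (k (m n)) (\<beta> (m n))) \<le> a n"
    and "AE x in P0. real_cond_exp P0 Z_algebra (\<lambda>x. (W_of x)\<^sup>2) x \<le> C"
    and "(\<lambda>n. (real (k (m n)))\<^sup>2 / sqrt (real n)) \<longlonglongrightarrow> 0"
    and "(\<lambda>n. sup_norm_basis (k (m n)) (\<beta> (m n)) * real (k (m n)) / sqrt (real n)) \<longlonglongrightarrow> 0"
    and "(\<lambda>n. a n * sqrt (real (k (m n))) * sup_norm_basis (k (m n)) (\<beta> (m n))) \<longlonglongrightarrow> 0"
    and "\<eta>0 \<in> smooth_space s"
    and "l + 1 \<ge> s"
    and "(\<lambda>n. real (k (m n)) powr (- real s) * sqrt (real n)) \<longlonglongrightarrow> 0"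
    and "mle_theta_sequence \<Theta> \<sigma> f (\<lambda>n. k (m n)) (\<lambda>n. \<beta> (m n)) T"
  shows "best_regular s \<sigma> f \<theta>0 \<eta>0 T"
proof -
  note \<sigma> = \<open>\<sigma> > 0\<close> and f = \<open>joint_density f\<close> and ONB = \<open>\<And>j. orthonormal_bsplines l (N j) (Z_law P0) (\<beta> j)\<close>
    and T = \<open>mle_theta_sequence \<Theta> \<sigma> f (\<lambda>n. k (m n)) (\<lambda>n. \<beta> (m n)) T\<close>
  have N1: "N j \<ge> 1" and k: "k j = N j + l" for j by fact+
  define \<eta>r where "\<eta>r = restrict_unit \<eta>0"
  have \<eta>r: "\<eta>r \<in> borel_measurable borel"
    unfolding \<eta>r_def by (rule restrict_unit_borel) fact
  have P0: "P0 = plm_law \<sigma> f \<theta>0 \<eta>r"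
    unfolding P0_def \<eta>r_def by (rule plm_law_restrict_unit[OF f])
  define \<mu> where "\<mu> = design_law f"
  interpret \<mu>: prob_space \<mu> unfolding \<mu>_def by (rule prob_space_design_law[OF f])
  interpret P0: prob_space P0 unfolding P0 by (rule prob_space_plm_law[OF f \<sigma> \<eta>r])
  have \<mu>_meas: "g \<in> borel_measurable \<mu>" if "g \<in> borel_measurable borel" for g :: "real \<times> real \<Rightarrow> real"
    using that by (simp add: \<mu>_def design_law_def)
  have snd_meas: "(\<lambda>u. g (snd u)) \<in> borel_measurable (borel :: (real \<times> real) measure)"
    if [measurable]: "g \<in> borel_measurable borel" for g :: "real \<Rightarrow> real"
    unfolding borel_prod[symmetric] by measurable
  have fst_meas: "(fst :: real \<times> real \<Rightarrow> real) \<in> borel_measurable borel"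
    unfolding borel_prod[symmetric] by measurable
  note transfer = plm_law_design_integral[OF f \<sigma> \<eta>r, of _ \<theta>0, folded P0 \<mu>_def]
  have W2: "integrable \<mu> (\<lambda>u. (fst u)\<^sup>2)"
  proof (rule Bochner_Integration.integrable_bound[where f = "\<lambda>u. 1 + \<bar>fst u\<bar> powr (2 + \<delta>)"])
    have "integrable \<mu> (\<lambda>u. \<bar>fst u\<bar> powr (2 + \<delta>))"
      using transfer(1)[of "\<lambda>u. \<bar>fst u\<bar> powr (2 + \<delta>)"] fst_meas
        \<open>integrable P0 (\<lambda>x. \<bar>W_of x\<bar> powr (2 + \<delta>))\<close> by simp
    then show "integrable \<mu> (\<lambda>u. 1 + \<bar>fst u\<bar> powr (2 + \<delta>))" by simp
    have "w\<^sup>2 \<le> 1 + \<bar>w\<bar> powr (2 + \<delta>)" for w :: real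
    proof (cases "\<bar>w\<bar> \<le> 1")
      case True
      then have "w\<^sup>2 \<le> 1" by (simp add: abs_square_le_1)
      then show ?thesis by (simp add: add_increasing2)
    next
      case False
      then have "\<bar>w\<bar> powr 2 \<le> \<bar>w\<bar> powr (2 + \<delta>)" using \<open>\<delta> > 0\<close> by (intro powr_mono) auto
      moreover have "\<bar>w\<bar> powr 2 = w\<^sup>2" using False by (subst powr_numeral) auto
      ultimately show ?thesis by simp
    qed
    then show "AE u in \<mu>. norm ((fst u)\<^sup>2) \<le> norm (1 + \<bar>fst u\<bar> powr (2 + \<delta>))" by simp
  qed (use \<mu>_meas[OF fst_meas] in measurable)
  define U where "U u = fst u - b0 (snd u)" for u :: "real \<times> real"
  have b0_meas: "b0 \<in> borel_measurable borel"
    using \<open>regression_W_Z P0 b0\<close> by (simp add: regression_W_Z_def)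
  note regression = design_law_regression[OF f \<sigma> \<eta>r, of \<theta>0 b0, folded P0 \<mu>_def U_def, OF \<open>regression_W_Z P0 b0\<close> W2]
  have U_meas: "U \<in> borel_measurable \<mu>"
    unfolding U_def using \<mu>_meas[OF fst_meas] \<mu>_meas[OF snd_meas[OF b0_meas]] by measurable
  define V where "V = (\<integral>u. (U u)\<^sup>2 \<partial>\<mu>)"
  have J: "plm_information \<sigma> P0 = V / \<sigma>\<^sup>2" using regression(4) by (simp add: V_def)
  have V: "V > 0" using \<open>plm_information \<sigma> P0 > 0\<close> \<sigma> by (simp add: J zero_less_divide_iff)
  define s0 where "s0 = sqrt (1 / plm_information \<sigma> P0)"
  have s0: "s0 > 0" "s0\<^sup>2 = \<sigma>\<^sup>2 / V" using V \<sigma> by (simp_all add: s0_def J)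

  define \<xi> where "\<xi> n = sup_norm_basis (k (m n)) (\<beta> (m n))" for n
  define b where "b n j u = \<beta> (m n) j (snd u)" for n j and u :: "real \<times> real"
  define \<gamma>0 where "\<gamma>0 n j = (\<integral>x. W_of x * \<beta> (m n) j (Z_of x) \<partial>P0)" for n j
  define r where "r n u = b0 (snd u) - series_fun (k (m n)) (\<beta> (m n)) (\<gamma>0 n) (snd u)" for n and u :: "real \<times> real"
  \<comment> \<open>W splits into the part unexplained by Z, the error of projecting E(W | Z) on the
    splines, and a spline. The last part lies in the column space and disappears under the
    projection.\<close>
  have w_eq: "fst v = U v + r n v + (\<Sum>j<k (m n). \<beta> (m n) j (snd v) * \<gamma>0 n j)" for n v
    by (simp add: U_def r_def series_fun_def)
  have \<beta>_meas: "\<beta> j i \<in> borel_measurable borel" if "i < k j" for i j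
    using orthonormal_bsplines_borel[OF ONB] that by (simp add: k)
  have b_meas: "b n j \<in> borel_measurable \<mu>" if "j < k (m n)" for n j
    unfolding b_def by (rule \<mu>_meas[OF snd_meas[OF \<beta>_meas[OF that]]])
  have b_orth: "(\<integral>u. b n i u * b n j u \<partial>\<mu>) = (if i = j then 1 else 0)" if "i < k (m n)" "j < k (m n)" for n i j
  proof -
    have "(\<integral>u. b n i u * b n j u \<partial>\<mu>) = (\<integral>z. \<beta> (m n) i z * \<beta> (m n) j z \<partial>Z_law P0)"
      unfolding b_def \<mu>_def P0 using \<beta>_meas that
      by (subst Z_law_integral[OF f \<sigma> \<eta>r]) auto
    then show ?thesis using ONB[of "m n"] that by (simp add: orthonormal_bsplines_def k)
  qed
  have b_bounded: "\<exists>K. \<forall>j<k (m n). \<forall>u. \<bar>b n j u\<bar> \<le> K" for n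
    using orthonormal_bsplines_bounded[OF ONB N1, of "m n"] unfolding b_def k by metis
  have b2_int: "integrable \<mu> (\<lambda>u. (b n j u)\<^sup>2)" if j: "j < k (m n)" for n j
  proof -
    obtain K where "\<And>u. \<bar>b n j u\<bar> \<le> K" using b_bounded[of n] j by blast
    then have "(b n j u)\<^sup>2 \<le> K\<^sup>2" for u using power_mono[of "\<bar>b n j u\<bar>" K 2] by simp
    then show ?thesis using b_meas[OF j]
      by (intro \<mu>.integrable_const_bound[where B = "K\<^sup>2"]) auto
  qed
  have b_le: "AE u in \<mu>. (\<Sum>j<k (m n). (b n j u)\<^sup>2) \<le> (\<xi> n)\<^sup>2" for n
    using AE_design_law[OF f] unfolding \<mu>_def[symmetric]
  proof eventually_elim
    case (elim u)
    then show ?case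
      using sup_norm_basis_bound(1)[OF ONB N1, of "snd u" "m n"] by (simp add: b_def \<xi>_def k)
  qed
  have Ub: "(\<integral>u. U u * b n j u \<partial>\<mu>) = 0" if j: "j < k (m n)" for n j
    using regression(2)[OF \<beta>_meas[OF j]] b2_int[OF j] by (simp add: b_def)
  have series_meas: "series_fun (k (m n)) (\<beta> (m n)) (\<gamma>0 n) \<in> borel_measurable borel" for n
    unfolding series_fun_def[abs_def] using \<beta>_meas by (intro borel_measurable_sum borel_measurable_times) auto
  have r_meas: "r n \<in> borel_measurable \<mu>" for n
    unfolding r_def using \<mu>_meas[OF snd_meas[OF b0_meas]] \<mu>_meas[OF snd_meas[OF series_meas]] by measurable
  have r2_int: "integrable \<mu> (\<lambda>u. (r n u)\<^sup>2)" for n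
  proof -
    obtain K where K: "\<And>j u. j < k (m n) \<Longrightarrow> \<bar>b n j u\<bar> \<le> K" using b_bounded[of n] by blast
    define S where "S = (\<Sum>j<k (m n). K * \<bar>\<gamma>0 n j\<bar>)"
    have S: "\<bar>series_fun (k (m n)) (\<beta> (m n)) (\<gamma>0 n) (snd u)\<bar> \<le> S" for u :: "real \<times> real"
      unfolding series_fun_def S_def using K
      by (intro order.trans[OF sum_abs] sum_mono) (auto simp: abs_mult b_def intro!: mult_right_mono)
    have "(r n u)\<^sup>2 \<le> 2 * (b0 (snd u))\<^sup>2 + 2 * S\<^sup>2" for u
    proof -
      have "(series_fun (k (m n)) (\<beta> (m n)) (\<gamma>0 n) (snd u))\<^sup>2 \<le> S\<^sup>2"
        using power_mono[OF S[of u] abs_ge_zero, of 2] by simp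
      moreover have "(x - y)\<^sup>2 \<le> 2 * x\<^sup>2 + 2 * y\<^sup>2" for x y :: real
        using zero_le_power2[of "x + y"] by (simp add: power2_eq_square algebra_simps)
      ultimately show ?thesis unfolding r_def by (smt (verit))
    qed
    then have r_le: "norm ((r n u)\<^sup>2) \<le> norm (2 * (b0 (snd u))\<^sup>2 + 2 * S\<^sup>2)" for u by simp
    show ?thesis
    proof (rule Bochner_Integration.integrable_bound)
      show "integrable \<mu> (\<lambda>u. 2 * (b0 (snd u))\<^sup>2 + 2 * S\<^sup>2)"
        using regression(1) by (intro Bochner_Integration.integrable_add integrable_mult_right \<mu>.integrable_const)
      show "(\<lambda>u. (r n u)\<^sup>2) \<in> borel_measurable \<mu>" using r_meas[of n] by measurable
    qed (intro AE_I2 r_le)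
  qed
  have a0: "a n \<ge> 0" and r2_le: "(\<integral>u. (r n u)\<^sup>2 \<partial>\<mu>) \<le> (a n)\<^sup>2" for n
  proof -
    have "L2_dist (Z_law P0) b0 (projection_W P0 (k (m n)) (\<beta> (m n))) = sqrt (\<integral>u. (r n u)\<^sup>2 \<partial>\<mu>)"
    proof -
      have "projection_W P0 (k (m n)) (\<beta> (m n)) = series_fun (k (m n)) (\<beta> (m n)) (\<gamma>0 n)"
        by (simp add: projection_W_def \<gamma>0_def[abs_def])
      moreover have "(\<lambda>z. (b0 z - series_fun (k (m n)) (\<beta> (m n)) (\<gamma>0 n) z)\<^sup>2) \<in> borel_measurable borel"
        using b0_meas series_meas[of n] by measurable
      from Z_law_integral[OF f \<sigma> \<eta>r this, of \<theta>0]
      have "(\<integral>z. (b0 z - series_fun (k (m n)) (\<beta> (m n)) (\<gamma>0 n) z)\<^sup>2 \<partial>Z_law P0) = (\<integral>u. (r n u)\<^sup>2 \<partial>\<mu>)"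
        unfolding r_def \<mu>_def P0 .
      ultimately show ?thesis unfolding L2_dist_def by simp
    qed
    then have *: "sqrt (\<integral>u. (r n u)\<^sup>2 \<partial>\<mu>) \<le> a n"
      using \<open>\<And>n. L2_dist (Z_law P0) b0 (projection_W P0 (k (m n)) (\<beta> (m n))) \<le> a n\<close>[of n] by simp
    have 0: "(\<integral>u. (r n u)\<^sup>2 \<partial>\<mu>) \<ge> 0" by simp
    then show "a n \<ge> 0" using * real_sqrt_ge_zero[OF 0] by linarith
    show "(\<integral>u. (r n u)\<^sup>2 \<partial>\<mu>) \<le> (a n)\<^sup>2" using * by (rule sqrt_le_D)
  qed
  have \<xi>0: "\<xi> n \<ge> 0" for n
    using sup_norm_basis_bound(2)[OF ONB N1, of 0 "m n"] by (simp add: \<xi>_def k)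
  \<comment> \<open>Integrating the sum of squares of an orthonormal family gives its dimension.
    This yields \<xi> at least 1.\<close>
  have k_le: "real (k (m n)) \<le> (\<xi> n)\<^sup>2" for n
  proof -
    have "real (k (m n)) = (\<Sum>j<k (m n). \<integral>u. (b n j u)\<^sup>2 \<partial>\<mu>)"
      using b_orth[of _ n] by (simp add: power2_eq_square)
    also have "\<dots> = (\<integral>u. (\<Sum>j<k (m n). (b n j u)\<^sup>2) \<partial>\<mu>)"
      using b2_int by (subst Bochner_Integration.integral_sum) auto
    also have "\<dots> \<le> (\<integral>u. (\<xi> n)\<^sup>2 \<partial>\<mu>)"
      using b2_int b_le by (intro integral_mono_AE Bochner_Integration.integrable_sum) auto
    finally show ?thesis by (simp add: \<mu>.prob_space)
  qed
  have k1: "real (k (m n)) \<ge> 1" for n using N1[of "m n"] by (simp add: k)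
  have \<xi>1: "\<xi> n \<ge> 1" for n
  proof -
    have "1 \<le> (\<xi> n)\<^sup>2" using k1[of n] k_le[of n] by linarith
    then show ?thesis using \<xi>0[of n] abs_le_square_iff[of 1 "\<xi> n"] by simp
  qed
  have a_lim: "a \<longlonglongrightarrow> 0"
  proof (rule Lim_null_comparison)
    show "(\<lambda>n. a n * sqrt (real (k (m n))) * \<xi> n) \<longlonglongrightarrow> 0"
      unfolding \<xi>_def by fact
    \<comment> \<open>As k and \<xi> are at least 1, the rate assumed for the product already forces
      \<open>a\<close> itself to vanish.\<close>
    have "a n \<le> a n * sqrt (real (k (m n))) * \<xi> n" for n
    proof -
      have "1 * 1 \<le> sqrt (real (k (m n))) * \<xi> n" using k1[of n] \<xi>1[of n] by (intro mult_mono) auto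
      then show ?thesis using a0[of n] mult_left_mono[of 1 "sqrt (real (k (m n))) * \<xi> n" "a n"] by (simp add: mult.assoc)
    qed
    then show "\<forall>\<^sub>F n in sequentially. norm (a n) \<le> a n * sqrt (real (k (m n))) * \<xi> n"
      using a0 by simp
  qed

  define EH where "EH n = (\<integral>u. design_defect n (k (m n)) U V (r n) (b n) u \<partial>PiM {..<n} (\<lambda>_. \<mu>))" for n
  have H_int: "integrable (PiM {..<n} (\<lambda>_. \<mu>)) (design_defect n (k (m n)) U V (r n) (b n))" if "n > 0" for n
    unfolding V_def using that
    by (intro design_defect_expectation(1)[OF \<mu>.prob_space_axioms _ U_meas regression(3) r_meas r2_int b_meas b_le b_orth Ub]) auto
  have EH_lim: "EH \<longlonglongrightarrow> 0"
  proof (rule Lim_null_comparison)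
    define LL where "LL n = (\<integral>x. \<bar>(\<Sum>i<n. (U (x i))\<^sup>2) / real n - V\<bar> \<partial>PiM {..<n} (\<lambda>_. \<mu>))" for n
    \<comment> \<open>One null sequence for both variance terms: since k is at least 1, it dominates
      \<xi>^2 / n as well as \<xi>^2 k / n.\<close>
    define c where "c n = (\<xi> n * real (k (m n)) / sqrt (real n))\<^sup>2" for n
    have LL: "LL \<longlonglongrightarrow> 0"
      unfolding LL_def V_def by (rule L1_law_of_large_numbers(2)[OF \<mu>.prob_space_axioms regression(3)])
    have "(\<lambda>n. \<xi> n * real (k (m n)) / sqrt (real n)) \<longlonglongrightarrow> 0" unfolding \<xi>_def by fact
    from tendsto_power[OF this, of 2] have c: "c \<longlonglongrightarrow> 0" by (simp add: c_def[abs_def])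
    from tendsto_add[OF tendsto_add[OF tendsto_add[OF LL tendsto_power[OF a_lim, of 2]] tendsto_mult_left[OF c, of V]] c]
    show "(\<lambda>n. LL n + (a n)\<^sup>2 + V * c n + c n) \<longlonglongrightarrow> 0" by simp
    show "\<forall>\<^sub>F n in sequentially. norm (EH n) \<le> LL n + (a n)\<^sup>2 + V * c n + c n"
      using eventually_gt_at_top[of 0]
    proof eventually_elim
      case (elim n)
      have "EH n \<le> LL n + (\<integral>u. (r n u)\<^sup>2 \<partial>\<mu>) + (\<xi> n)\<^sup>2 * V / n + (\<xi> n)\<^sup>2 * k (m n) / n"
        unfolding EH_def LL_def V_def
        by (rule design_defect_expectation(2)[OF \<mu>.prob_space_axioms elim U_meas regression(3) r_meas r2_int b_meas b_le b_orth Ub])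
      moreover have cn: "c n = (\<xi> n)\<^sup>2 * (real (k (m n)))\<^sup>2 / n"
        by (simp add: c_def power_divide power_mult_distrib)
      moreover have "(\<xi> n)\<^sup>2 / n \<le> c n"
      proof -
        have "(\<xi> n)\<^sup>2 * 1 \<le> (\<xi> n)\<^sup>2 * (real (k (m n)))\<^sup>2" using k1[of n] by (intro mult_left_mono) (auto simp: one_le_power)
        then show ?thesis unfolding cn by (simp add: divide_right_mono)
      qed
      then have "(\<xi> n)\<^sup>2 * V / n \<le> V * c n" using V mult_left_mono[of "(\<xi> n)\<^sup>2 / n" "c n" V] by (simp add: mult.commute)
      moreover have "(\<xi> n)\<^sup>2 * k (m n) / n \<le> c n"
      proof -
        have "real (k (m n)) * 1 \<le> real (k (m n)) * real (k (m n))" using k1[of n] by (intro mult_left_mono) auto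
        then have "(\<xi> n)\<^sup>2 * k (m n) \<le> (\<xi> n)\<^sup>2 * (real (k (m n)))\<^sup>2" by (intro mult_left_mono) (auto simp: power2_eq_square)
        then show ?thesis unfolding cn by (simp add: divide_right_mono)
      qed
      moreover have "EH n \<ge> 0"
        unfolding EH_def by (intro integral_nonneg_AE AE_I2 order.trans[OF abs_ge_zero design_defect_ge(1)])
      ultimately show ?case using r2_le[of n] by simp
    qed
  qed

  obtain r0 where r0: "r0 > 0" "ball \<theta>0 r0 \<subseteq> \<Theta>"
    using \<open>\<theta>0 \<in> interior \<Theta>\<close> by (auto simp: mem_interior)
  have r0': "\<theta>' \<in> \<Theta>" if "\<bar>\<theta>' - \<theta>0\<bar> < r0" for \<theta>'
    using r0(2) that by (auto simp: dist_real_def abs_minus_commute)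
  have Q: "finite_measure (Z_law P0)" "sets (Z_law P0) = sets borel"
  proof -
    have "prob_space (Z_law P0)"
      unfolding Z_law_def by (rule P0.prob_space_distr) (simp add: P0 plm_law_def borel_prod[symmetric])
    then show "finite_measure (Z_law P0)" by (rule prob_space.finite_measure)
  qed (simp add: Z_law_def)

  \<comment> \<open>The path moves only the centring of \<open>T n\<close> and the regression
    function. The laws of design and noise, and with them \<open>EH\<close>, are the same for all
    \<tau> and \<open>h\<close>, so the limit cannot depend on the direction.\<close>
  have "weak_conv_m (\<lambda>n. distr (local_law \<sigma> f \<theta>0 \<eta>0 \<tau> h n) borel (\<lambda>x. sqrt (real n) * (T n x - \<theta>0 - \<tau> / sqrt (real n))))
      (density lborel (\<lambda>x. ennreal (normal_density 0 s0 x)))" if h: "h \<in> smooth_space s" for \<tau> h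
  proof -
    define \<theta>n where "\<theta>n n = \<theta>0 + \<tau> / sqrt (real n)" for n :: nat
    define \<eta>n where "\<eta>n n z = \<eta>r z + restrict_unit h z / sqrt (real n)" for n :: nat and z
    have \<eta>n_meas: "\<eta>n n \<in> borel_measurable borel" for n
      unfolding \<eta>n_def[abs_def] using \<eta>r restrict_unit_borel[OF h] by measurable
    have law: "local_law \<sigma> f \<theta>0 \<eta>0 \<tau> h n = PiM {..<n} (\<lambda>_. plm_law \<sigma> f (\<theta>n n) (\<eta>n n))" for n
    proof -
      have "plm_law \<sigma> f (\<theta>0 + \<tau> / sqrt (real n)) (\<lambda>z. \<eta>0 z + h z / sqrt (real n)) = plm_law \<sigma> f (\<theta>n n) (\<eta>n n)"
        unfolding \<theta>n_def[symmetric] by (rule plm_law_cong[OF f]) (simp add: \<eta>n_def \<eta>r_def restrict_unit_def)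
      then show ?thesis unfolding local_law_def by simp
    qed
    obtain K0 where K0: "K0 \<ge> 0" and approx0: "\<And>N Q \<beta>. N \<ge> 1 \<Longrightarrow> orthonormal_bsplines l N Q \<beta> \<Longrightarrow> finite_measure Q \<Longrightarrow>
        sets Q = sets borel \<Longrightarrow> \<exists>\<gamma>. \<forall>z\<in>{0..<1}. \<bar>\<eta>0 z - series_fun (N + l) \<beta> \<gamma> z\<bar> \<le> K0 / real N ^ s"
      using smooth_series_approximation[of s \<eta>0 l] \<open>\<eta>0 \<in> smooth_space s\<close> \<open>l + 1 \<ge> s\<close> unfolding smooth_space_def by blast
    obtain K1 where K1: "K1 \<ge> 0" and approx1: "\<And>N Q \<beta>. N \<ge> 1 \<Longrightarrow> orthonormal_bsplines l N Q \<beta> \<Longrightarrow> finite_measure Q \<Longrightarrow>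
        sets Q = sets borel \<Longrightarrow> \<exists>\<gamma>. \<forall>z\<in>{0..<1}. \<bar>h z - series_fun (N + l) \<beta> \<gamma> z\<bar> \<le> K1 / real N ^ s"
      using smooth_series_approximation[of s h l] h \<open>l + 1 \<ge> s\<close> unfolding smooth_space_def by blast
    \<comment> \<open>The direction \<open>h\<close> is smooth too and is approximated at the same
      rate; as 1 / sqrt n is at most 1, its error adds at most the \<open>K1\<close> part.\<close>
    define hn where "hn n = (K0 + K1) / real (N (m n)) ^ s" for n
    have hn0: "hn n \<ge> 0" for n using K0 K1 by (simp add: hn_def)
    have approx: "\<exists>\<gamma>. \<forall>z\<in>{0..<1}. \<bar>\<eta>n n z - series_fun (k (m n)) (\<beta> (m n)) \<gamma> z\<bar> \<le> hn n" if n: "n > 0" for n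
    proof -
      obtain \<gamma> where \<gamma>: "\<And>z. z \<in> {0..<1} \<Longrightarrow> \<bar>\<eta>0 z - series_fun (k (m n)) (\<beta> (m n)) \<gamma> z\<bar> \<le> K0 / real (N (m n)) ^ s"
        using approx0[OF N1 ONB Q, of "m n"] unfolding k by blast
      obtain \<gamma>' where \<gamma>': "\<And>z. z \<in> {0..<1} \<Longrightarrow> \<bar>h z - series_fun (k (m n)) (\<beta> (m n)) \<gamma>' z\<bar> \<le> K1 / real (N (m n)) ^ s"
        using approx1[OF N1 ONB Q, of "m n"] unfolding k by blast
      have sn: "1 / sqrt (real n) \<le> 1" "1 / sqrt (real n) \<ge> 0" using n by simp_all
      have "\<bar>\<eta>n n z - series_fun (k (m n)) (\<beta> (m n)) (\<lambda>j. \<gamma> j + 1 / sqrt (real n) * \<gamma>' j) z\<bar> \<le> hn n" if z: "z \<in> {0..<1}" for z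
      proof -
        define p where "p = series_fun (k (m n)) (\<beta> (m n)) \<gamma> z"
        define p' where "p' = series_fun (k (m n)) (\<beta> (m n)) \<gamma>' z"
        have "\<eta>n n z - series_fun (k (m n)) (\<beta> (m n)) (\<lambda>j. \<gamma> j + 1 / sqrt (real n) * \<gamma>' j) z =
            (\<eta>0 z - p) + 1 / sqrt (real n) * (h z - p')"
          unfolding series_fun_linear p_def p'_def using z
          by (simp add: \<eta>n_def \<eta>r_def restrict_unit_def diff_divide_distrib)
        moreover have "\<bar>1 / sqrt (real n) * (h z - p')\<bar> \<le> 1 * (K1 / real (N (m n)) ^ s)"
          unfolding abs_mult abs_of_nonneg[OF sn(2)] p'_def using \<gamma>'[OF z] sn by (intro mult_mono) auto
        moreover have "hn n = K0 / real (N (m n)) ^ s + K1 / real (N (m n)) ^ s" by (simp add: hn_def add_divide_distrib)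
        ultimately show ?thesis using \<gamma>[OF z] unfolding p_def by linarith
      qed
      then show ?thesis by blast
    qed
    have hn_lim: "(\<lambda>n. sqrt (real n) * hn n) \<longlonglongrightarrow> 0"
    proof (rule Lim_null_comparison)
      \<comment> \<open>Approximation is measured by the number N of mesh intervals, the assumption
        by k = N + l. Since N is at least 1, k is at most (l + 1) N, which costs the factor (l +
        1)^s.\<close>
      define C' where "C' = (K0 + K1) * real (l + 1) ^ s"
      have "(\<lambda>n. real (k (m n)) powr (- real s) * sqrt (real n)) \<longlonglongrightarrow> 0" by fact
      from tendsto_mult_left[OF this, of C']
      show "(\<lambda>n. C' * (real (k (m n)) powr (- real s) * sqrt (real n))) \<longlonglongrightarrow> 0" by simp
      have "hn n \<le> C' * real (k (m n)) powr (- real s)" for n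
      proof -
        have Npos: "real (N (m n)) > 0" using N1[of "m n"] by simp
        have kpos: "real (k (m n)) > 0" using k1[of n] by linarith
        have "k (m n) \<le> (l + 1) * N (m n)" using N1[of "m n"] mult_le_mono2[of 1 "N (m n)" l] by (simp add: k)
        then have "real (k (m n)) \<le> real (l + 1) * real (N (m n))" by (metis of_nat_le_iff of_nat_mult)
        then have "real (k (m n)) ^ s \<le> (real (l + 1) * real (N (m n))) ^ s" by (intro power_mono) auto
        then have "real (k (m n)) ^ s \<le> real (l + 1) ^ s * real (N (m n)) ^ s" by (simp only: power_mult_distrib)
        moreover have "1 / y \<le> c / x" if "x \<le> c * y" "0 < x" "0 < y" for c x y :: real
          using that by (simp add: field_simps)
        ultimately have "1 / real (N (m n)) ^ s \<le> real (l + 1) ^ s / real (k (m n)) ^ s"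
          using Npos kpos by simp
        from mult_left_mono[OF this, of "K0 + K1"] K0 K1
        have "hn n \<le> C' / real (k (m n)) ^ s" by (simp add: hn_def C'_def)
        also have "\<dots> = C' * real (k (m n)) powr (- real s)"
          using kpos by (simp add: powr_minus powr_realpow divide_inverse)
        finally show ?thesis .
      qed
      then have "sqrt (real n) * hn n \<le> C' * (real (k (m n)) powr (- real s) * sqrt (real n))" for n
        using mult_left_mono[of "hn n" "C' * real (k (m n)) powr (- real s)" "sqrt (real n)"] by (simp add: mult_ac)
      then show "\<forall>\<^sub>F n in sequentially. norm (sqrt (real n) * hn n) \<le> C' * (real (k (m n)) powr (- real s) * sqrt (real n))"
        using hn0 by (simp add: abs_mult)
    qed
    define L where "L n = distr (local_law \<sigma> f \<theta>0 \<eta>0 \<tau> h n) borel (\<lambda>x. sqrt (real n) * (T n x - \<theta>0 - \<tau> / sqrt (real n)))" for n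
    have L_eq: "L n = distr (PiM {..<n} (\<lambda>_. plm_law \<sigma> f (\<theta>n n) (\<eta>n n))) borel (\<lambda>x. sqrt (real n) * (T n x - \<theta>n n))" for n
      unfolding L_def law by (simp add: \<theta>n_def diff_diff_eq)
    have "weak_conv_m L (density lborel (\<lambda>x. ennreal (normal_density 0 s0 x)))"
    proof (rule levy_continuity)
      fix n
      interpret LP: prob_space "PiM {..<n} (\<lambda>_. plm_law \<sigma> f (\<theta>n n) (\<eta>n n))"
        by (intro prob_space_PiM prob_space_plm_law f \<sigma> \<eta>n_meas)
      have "sets (PiM {..<n} (\<lambda>_. plm_law \<sigma> f (\<theta>n n) (\<eta>n n))) = sets (PiM {..<n} (\<lambda>_. borel))"
        by (intro sets_PiM_cong) auto
      then have "T n \<in> borel_measurable (PiM {..<n} (\<lambda>_. plm_law \<sigma> f (\<theta>n n) (\<eta>n n)))"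
        using T by (simp add: mle_theta_sequence_def cong: measurable_cong_sets)
      then show "real_distribution (L n)"
        unfolding L_eq
        by (intro LP.real_distribution_distr borel_measurable_times borel_measurable_diff borel_measurable_const)
    next
      show "real_distribution (density lborel (\<lambda>x. ennreal (normal_density 0 s0 x)))"
        by (rule real_distribution_centred_normal[OF s0(1)])
    next
      fix t
      define \<phi> where "\<phi> q = exp (- (t\<^sup>2 * \<sigma>\<^sup>2 / q) / 2)" for q
      have "char (density lborel (\<lambda>x. ennreal (normal_density 0 s0 x))) t = \<phi> V"
        unfolding char_centred_normal[OF s0(1)] \<phi>_def s0(2) by (simp add: mult.commute)
      moreover have "(\<lambda>n. char (L n) t) \<longlonglongrightarrow> \<phi> V"
      proof (rule tendstoI)
        fix e :: real assume e: "e > 0"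
        have "isCont \<phi> V" unfolding \<phi>_def[abs_def] using V by (intro continuous_intros) auto
        then obtain d where d: "d > 0" "\<And>q. \<bar>q - V\<bar> < d \<Longrightarrow> \<bar>\<phi> q - \<phi> V\<bar> < e / 4"
          using e unfolding continuous_at_eps_delta dist_real_def by (metis zero_less_divide_iff zero_less_numeral)
        \<comment> \<open>The bound 1/4 is for the Gram matrix, \<open>V / 2\<close> keeps q away
          from zero, and \<open>d / 2\<close> puts q strictly inside the radius of continuity of
          \<phi> at V.\<close>
        define \<epsilon> where "\<epsilon> = min (1 / 4) (min (V / 2) (d / 2) / (V + 10))"
        have \<epsilon>: "0 < \<epsilon>" "\<epsilon> \<le> 1 / 4" using V d(1) by (auto simp: \<epsilon>_def)
        have "\<epsilon> * (V + 10) \<le> min (V / 2) (d / 2) / (V + 10) * (V + 10)"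
          using V by (intro mult_right_mono) (auto simp: \<epsilon>_def)
        then have "\<epsilon> * (V + 10) \<le> min (V / 2) (d / 2)" using V by simp
        then have \<epsilon>V: "\<epsilon> * (V + 10) \<le> V / 2" "\<epsilon> * (V + 10) < d" using d(1) by auto
        have lim1: "(\<lambda>n. \<bar>\<tau>\<bar> / sqrt (real n) + sqrt (real n) * hn n * sqrt (2 / V)) \<longlonglongrightarrow> 0"
        proof -
          have "(\<lambda>n. \<bar>\<tau>\<bar> / sqrt (real n)) \<longlonglongrightarrow> 0" 
            by (intro real_tendsto_divide_at_top[OF tendsto_const] filterlim_compose[OF sqrt_at_top filterlim_real_sequentially])
          from tendsto_add[OF this tendsto_mult_right[OF hn_lim, of "sqrt (2 / V)"]] show ?thesis by simp
        qed
        have lim2: "(\<lambda>n. \<bar>t\<bar> * (sqrt (real n) * hn n * sqrt (2 / V))) \<longlonglongrightarrow> 0"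
          using tendsto_mult_left[OF tendsto_mult_right[OF hn_lim, of "sqrt (2 / V)"], of "\<bar>t\<bar>"] by simp
        have lim3: "(\<lambda>n. 16 * \<sigma>\<^sup>2 / (V * real n * r0\<^sup>2)) \<longlonglongrightarrow> 0"
        proof -
          have "(\<lambda>n. 16 * \<sigma>\<^sup>2 / (V * r0\<^sup>2) / real n) \<longlonglongrightarrow> 0" by (rule lim_const_over_n)
          then show ?thesis by (simp add: mult_ac)
        qed
        have lim4: "(\<lambda>n. 2 * EH n / \<epsilon>\<^sup>2) \<longlonglongrightarrow> 0"
          using tendsto_divide[OF tendsto_mult_left[OF EH_lim, of 2] tendsto_const, of "\<epsilon>\<^sup>2"] \<epsilon>(1) by simp
        have "\<forall>\<^sub>F n in sequentially. \<bar>\<tau>\<bar> / sqrt (real n) + sqrt (real n) * hn n * sqrt (2 / V) < r0 / 2"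
          using r0(1) by (intro order_tendstoD(2)[OF lim1]) auto
        moreover have "\<forall>\<^sub>F n in sequentially. \<bar>t\<bar> * (sqrt (real n) * hn n * sqrt (2 / V)) < e / 4"
          using e by (intro order_tendstoD(2)[OF lim2]) auto
        moreover have "\<forall>\<^sub>F n in sequentially. 16 * \<sigma>\<^sup>2 / (V * real n * r0\<^sup>2) < e / 4"
          using e by (intro order_tendstoD(2)[OF lim3]) auto
        moreover have "\<forall>\<^sub>F n in sequentially. 2 * EH n / \<epsilon>\<^sup>2 < e / 4"
          using e by (intro order_tendstoD(2)[OF lim4]) auto
        ultimately show "\<forall>\<^sub>F n in sequentially. dist (char (L n) t) (\<phi> V) < e"
          using eventually_gt_at_top[of 0]
        proof eventually_elim
          case (elim n)
          obtain \<gamma>g where \<gamma>g: "\<And>z. z \<in> {0..<1} \<Longrightarrow> \<bar>\<eta>n n z - series_fun (k (m n)) (\<beta> (m n)) \<gamma>g z\<bar> \<le> hn n"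
            using approx[OF elim(5)] by blast
          \<comment> \<open>As sqrt n is at least 1, the limit that includes the factor sqrt n also
            gives the closeness of drift and bias without it.\<close>
          have "hn n * sqrt (2 / V) * 1 \<le> hn n * sqrt (2 / V) * sqrt (real n)"
            using hn0[of n] V elim(5) by (intro mult_left_mono) auto
          then have near: "\<bar>\<theta>n n - \<theta>0\<bar> + hn n * sqrt (2 / V) \<le> r0 / 2"
            using elim(1) by (simp add: \<theta>n_def mult_ac)
          have \<omega>: "\<bar>exp (- (t\<^sup>2 * \<sigma>\<^sup>2 / q) / 2) - exp (- (t\<^sup>2 * \<sigma>\<^sup>2 / V) / 2)\<bar> \<le> e / 4"
            if "\<bar>q - V\<bar> \<le> \<epsilon> * (V + 10)" for q
            using d(2)[of q] that \<epsilon>V(2) unfolding \<phi>_def by linarith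
          have "norm (char (L n) t - exp (- (t\<^sup>2 * \<sigma>\<^sup>2 / V) / 2)) \<le>
              e / 4 + \<bar>t\<bar> * (sqrt n * hn n * sqrt (2 / V)) + 16 * \<sigma>\<^sup>2 / (V * n * r0\<^sup>2) + 2 * EH n / \<epsilon>\<^sup>2"
            unfolding L_eq EH_def b_def \<mu>_def
            by (rule char_local_law_bound[OF T \<sigma> f elim(5) refl refl \<eta>n_meas V \<epsilon> \<epsilon>V(1)
                  H_int[OF elim(5), unfolded b_def \<mu>_def] w_eq \<gamma>g r0(1) r0' near \<omega>])
          then show ?case using elim(2-4) unfolding dist_norm \<phi>_def by simp
        qed
      qed
      ultimately show "(\<lambda>n. char (L n) t) \<longlonglongrightarrow> char (density lborel (\<lambda>x. ennreal (normal_density 0 s0 x))) t" by simp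
    qed
    then show ?thesis unfolding L_def[abs_def] .
  qed
  then show ?thesis
    unfolding best_regular_def regular_with_law_def P0_def[symmetric] s0_def[symmetric]
    using real_distribution_centred_normal[OF s0(1)] by blast
qed

end
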